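(* Let $\pi$ be a probability measure on $\{0,1,2,\dots\}$ with generating function $\phi$, let $\omega$ be a probability measure on $\mathbb{R}$, and write $\hat\phi=\phi'/\phi'(1)$ (with $\phi'(1)>0$). Assume that $\pi$ and $\omega$ have finite expectation, that $\omega$ is atomless and admits a (positive) density on some nonempty open interval, and that $t\mapsto\hat\phi(1-\hat\phi(1-t))$ has a finite number of fixed points in $[0,1]$. Consider the map $$F_\pi:x\in[0,1]\mapsto\phi(1-x)+\phi(1-\hat\phi(1-x))+\phi'(1)\,x\,\hat\phi(1-x)$$ and suppose that $\mathrm{argmax}\,F_\pi$ has at most two elements. Let $\mathcal{H}=(k,(h_0,\dots,h_k))$ be any solution (of type A or B, see context), let $\zeta'_{\mathcal H}$ be the associated distribution on $\{0,\dots,k\}\times\mathbb{R}$ and let $(i,Z)\sim\zeta'_{\mathcal H}$. Then the distribution of $i$ is described by: 1. If $\mathrm{argmax}\,F_\pi$ is reduced to a single point $\gamma$, then $k=1$ and the distribution of $i$ is $\gamma\delta_0+(1-\gamma)\delta_1$. 2. If $\mathrm{argmax}\,F_\pi$ has two distinct points $0<\underline\gamma<\overline\gamma<1$, then $k=2$ and the distribution of $i$ is $\underline\gamma\delta_0+(\overline\gamma-\underline\gamma)\delta_1+(1-\overline\gamma)\delta_2$. 3. If $\mathrm{argmax}\,F_\pi$ is not as in one of the previous two items, then it is equal to $\{0,1\}$, in which case $k=0$ and $i=0$ almost surely. Furthermore, let $b=\sup(\mathrm{supp}(\omega))$ and assume that there exists $a<b$ such that the interval $(a,b)$ is included in $\mathrm{supp}(\omega)$.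 Then there is a unique distribution $\zeta'$ associated with a solution.
   Context: Let $W\sim\omega$. In both cases below, $h_0,\dots,h_k:\mathbb{R}\to[0,1]$ are nondecreasing càdlàg functions with $\lim_{-\infty}h_j<\lim_{+\infty}h_j$ for $0\le j\le k$ and $\lim_{+\infty}h_j=\lim_{-\infty}h_{j+1}$ for $0\le j<k$. Type A solution: $k\ge1$, $h_j(t)=\hat\phi(1-\mathbb{E}[h_{k-j}(W-t)])$ for all $0<j\le k$, $t\in\mathbb{R}$, and $h_0(t)=\mathbbm{1}_{t\ge0}\,\hat\phi(1-\mathbb{E}[h_k(W-t)])$ for all $t\in\mathbb{R}$. Type B solution: $k\ge0$, $h_j(t)=\hat\phi(1-\mathbb{E}[h_{k-j}(W-t)])$ for all $0\le j\le k$, $t\in\mathbb{R}$, and $\lim_{-\infty}h_0=0$, $\lim_{+\infty}h_k=1$. The distribution $\zeta'_{\mathcal H}$ associated with $\mathcal{H}=(k,(h_0,\dots,h_k))$ is the law on $\{0,\dots,k\}\times\mathbb{R}$ of $(i,Z)$ with $\mathbb{P}(i=j,Z\le t)=h_j(t)-\lim_{-\infty}h_j$ for all $0\le j\le k$, $t\in\mathbb{R}$. *)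

theory Defs
  imports "HOL-Probability.Probability"
begin

definition gen_fun :: "nat pmf \<Rightarrow> real \<Rightarrow> real" where
  "gen_fun \<pi> x = measure_pmf.expectation \<pi> (\<lambda>n. x ^ n)"

text \<open>Generating functions live on the unit interval, so the derivative is taken within it;
  it is one-sided at the endpoints.\<close>

definition gen_fun_deriv :: "nat pmf \<Rightarrow> real \<Rightarrow> real" where
  "gen_fun_deriv \<pi> x = vector_derivative (gen_fun \<pi>) (at x within {0..1})"

definition phi_hat :: "nat pmf \<Rightarrow> real \<Rightarrow> real" where
  "phi_hat \<pi> x = gen_fun_deriv \<pi> x / gen_fun_deriv \<pi> 1"

definition F_fun :: "nat pmf \<Rightarrow> real \<Rightarrow> real" where
  "F_fun \<pi> x = gen_fun \<pi> (1 - x) + gen_fun \<pi> (1 - phi_hat \<pi> (1 - x))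
     + gen_fun_deriv \<pi> 1 * x * phi_hat \<pi> (1 - x)"

definition argmax_F :: "nat pmf \<Rightarrow> real set" where
  "argmax_F \<pi> = {x. is_arg_max (F_fun \<pi>) (\<lambda>x. x \<in> {0..1}) x}"

definition atomless :: "real measure \<Rightarrow> bool" where
  "atomless \<omega> \<longleftrightarrow> (\<forall>x. measure \<omega> {x} = 0)"

definition positive_density_on_some_interval :: "real measure \<Rightarrow> bool" where
  "positive_density_on_some_interval \<omega> \<longleftrightarrow>
     (\<exists>c d f. c < d \<and> f \<in> borel_measurable borel \<and> (\<forall>x\<in>{c<..<d}. 0 < f x) \<and>
        restrict_space \<omega> {c<..<d}
          = density (restrict_space lborel {c<..<d}) (\<lambda>x. ennreal (f x)))"

definition msupport :: "real measure \<Rightarrow> real set" where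
  "msupport \<omega> = {x. \<forall>U. open U \<and> x \<in> U \<longrightarrow> 0 < emeasure \<omega> U}"

definition cadlag :: "(real \<Rightarrow> real) \<Rightarrow> bool" where
  "cadlag f \<longleftrightarrow> (\<forall>t. continuous (at_right t) f \<and> (\<exists>l. (f \<longlongrightarrow> l) (at_left t)))"

text \<open>A tuple \<open>(h\<^sub>0, \<dots>, h\<^sub>k)\<close> is a sequence of functions of which only the entries with
  index at most \<open>k\<close> matter.\<close>

definition admissible_tuple :: "nat \<Rightarrow> (nat \<Rightarrow> real \<Rightarrow> real) \<Rightarrow> bool" where
  "admissible_tuple k h \<longleftrightarrow>
     (\<forall>j\<le>k. range (h j) \<subseteq> {0..1} \<and> mono (h j) \<and> cadlag (h j) \<and>
            Lim at_bot (h j) < Lim at_top (h j)) \<and>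
     (\<forall>j<k. Lim at_top (h j) = Lim at_bot (h (Suc j)))"

definition type_A :: "nat pmf \<Rightarrow> real measure \<Rightarrow> nat \<Rightarrow> (nat \<Rightarrow> real \<Rightarrow> real) \<Rightarrow> bool" where
  "type_A \<pi> \<omega> k h \<longleftrightarrow>
     admissible_tuple k h \<and> 1 \<le> k \<and>
     (\<forall>j t. 0 < j \<and> j \<le> k \<longrightarrow> h j t = phi_hat \<pi> (1 - (\<integral>w. h (k - j) (w - t) \<partial>\<omega>))) \<and>
     (\<forall>t. h 0 t = indicator {0..} t * phi_hat \<pi> (1 - (\<integral>w. h k (w - t) \<partial>\<omega>)))"

definition type_B :: "nat pmf \<Rightarrow> real measure \<Rightarrow> nat \<Rightarrow> (nat \<Rightarrow> real \<Rightarrow> real) \<Rightarrow> bool" where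
  "type_B \<pi> \<omega> k h \<longleftrightarrow>
     admissible_tuple k h \<and>
     (\<forall>j t. j \<le> k \<longrightarrow> h j t = phi_hat \<pi> (1 - (\<integral>w. h (k - j) (w - t) \<partial>\<omega>))) \<and>
     Lim at_bot (h 0) = 0 \<and> Lim at_top (h k) = 1"

definition is_solution :: "nat pmf \<Rightarrow> real measure \<Rightarrow> nat \<Rightarrow> (nat \<Rightarrow> real \<Rightarrow> real) \<Rightarrow> bool" where
  "is_solution \<pi> \<omega> k h \<longleftrightarrow> type_A \<pi> \<omega> k h \<or> type_B \<pi> \<omega> k h"

text \<open>The law on \<open>{0, \<dots>, k} \<times> \<real>\<close> with the prescribed partial distribution functions. It exists
  for every solution, since then the lower limit of \<open>h\<^sub>0\<close> is \<open>0\<close> and the upper limit of \<open>h\<^sub>k\<close> is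
  \<open>1\<close> (for type A this follows from the equations), so the masses telescope to \<open>1\<close>. It is unique
  because the sets \<open>{j} \<times> {..t}\<close> form a generating family stable under intersection
  (up to the empty set).\<close>

definition assoc_law :: "nat \<Rightarrow> (nat \<Rightarrow> real \<Rightarrow> real) \<Rightarrow> (nat \<times> real) measure" where
  "assoc_law k h = (THE \<zeta>. prob_space \<zeta> \<and> sets \<zeta> = sets (count_space {..k} \<Otimes>\<^sub>M borel) \<and>
     (\<forall>j\<le>k. \<forall>t. measure \<zeta> ({j} \<times> {..t}) = h j t - Lim at_bot (h j)))"

definition index_law :: "nat \<Rightarrow> (nat \<Rightarrow> real \<Rightarrow> real) \<Rightarrow> nat measure" where
  "index_law k h = distr (assoc_law k h) (count_space UNIV) fst"

end

theory Submission imports Defs begin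

text \<open>
  Write \<open>T x\<close> for \<open>phi_hat (1 - x)\<close>, a strictly decreasing function on the unit interval, \<open>K h t\<close> for the
  expectation of \<open>h (W - t)\<close>, and \<open>S s\<close> for the probability that \<open>W \<ge> s\<close>. The equations of a solution
  become \<open>h\<^sub>j = T (K h\<^bsub>k-j\<^esub>)\<close>, with \<open>h\<^sub>0\<close> cut off below \<open>0\<close> in type A.

  \<^bold>\<open>Energy.\<close> The function \<open>\<Phi> z = \<phi> (1 - z) / \<phi>' 1\<close> is convex with derivative \<open>- T\<close>. Its concave dual
  \<open>\<Psi> x = min\<^sub>z (x z + \<Phi> z)\<close> has as derivative the generalised inverse \<open>\<tau>\<close> of \<open>T\<close>, and up to the factor \<open>\<phi>' 1\<close>
  the function \<open>F z\<close> is the value at \<open>(T (T z), T z)\<close> of the energy \<open>E x y = \<Psi> x + \<Psi> y - x y\<close>. So, if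
  \<open>T x = y\<close>, \<open>T y = x\<close> and \<open>E x y\<close> is at least the energy of every point \<open>(T (T z), T z)\<close>, then \<open>x\<close> is a maximiser of \<open>F\<close>
  (\<open>maximizers_energy\<close>). Moreover \<open>T\<close> permutes the maximisers of \<open>F\<close> and reverses their order.

  \<^bold>\<open>The limits of a solution are maximisers.\<close> Let \<open>X\<close> and \<open>Y\<close> be the quantile functions of \<open>h\<^sub>j\<close> and
  \<open>h\<^bsub>k-j\<^esub>\<close>. The equation for \<open>h\<^sub>j\<close> says that the kernel \<open>S (X p + Y q)\<close>, integrated over \<open>q\<close>, gives \<open>\<tau> p\<close>
  minus the lower limit of \<open>h\<^bsub>k-j\<^esub>\<close>, up to an inequality where the cut is active. Both marginals of
  the kernel are thus known, and integrating them over strips turns energy differences into integrals of the kernel.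
  An elementary inequality between indicator functions then bounds the energy on the rectangle spanned
  by the limits of \<open>h\<^sub>j\<close> and \<open>h\<^bsub>k-j\<^esub>\<close> by its value at a chosen point plus a defect integral
  (\<open>energy_near_maximal\<close>). At the relevant corners the defect vanishes. These
  rectangles form a staircase that contains every point \<open>(T (T z), T z)\<close>, so the interior limits of a
  solution are maximisers of \<open>F\<close>, and for type B so are \<open>0\<close> and \<open>1\<close> (\<open>solution_levels_maximize\<close>). With at most two
  maximisers this forces \<open>k\<close> and the masses of the index.

  \<^bold>\<open>Comparison.\<close> For two solutions with the same limits, the difference of the two kernels is integrated
  against \<open>arctan (X' p - X p) + arctan (Y' q - Y q)\<close>. The integrand is nonnegative because \<open>S\<close> is
  decreasing and \<open>arctan\<close> is odd and increasing, while the marginals make the integral nonpositive. Hence the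
  kernels agree almost everywhere (\<open>kernels_agree\<close>). This is the convexity of the dual of the
  matching problem, whose unknowns are \<open>X\<close> and \<open>Y\<close>; the arctangent replaces the identity because quantiles need not
  be integrable.

  \<^bold>\<open>Uniqueness.\<close> If the support of \<open>W\<close> contains an interval that ends at its supremum, a flat piece of a profile
  would spread until it contradicts the equations. So quantiles are continuous, the kernels agree
  everywhere, and \<open>X' - X\<close> is locally constant (\<open>quantile_shift\<close>). The constant is \<open>0\<close>: for type A
  because \<open>h\<^sub>0\<close> has an atom at \<open>0\<close>, for a profile coupled with itself by symmetry.

  \<^bold>\<open>Existence.\<close> The single equation \<open>m = T (K m)\<close>, cut off below \<open>- n\<close>, has an order-reversing right-hand
  side. Alternating iteration yields two profiles that are mapped to each other; since their kernels agree,
  the average of their quantile functions solves the equation (\<open>exists_cut_solution\<close>). As \<open>n\<close> grows, the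
  solution looks constant between a transition near \<open>- n\<close>, one near \<open>n\<close> and possibly one near \<open>0\<close>. On a plateau the defect is
  small, so plateau values are maximisers of \<open>F\<close>, and limits of the transitions, taken with Helly's theorem, are the
  components of a solution (\<open>exists_layers\<close>).
\<close>

section \<open>Generating functions\<close>

lemma power_tangent_le:
  fixes x z :: real
  assumes "0 \<le> x" "0 \<le> z"
  shows "x ^ n + real n * x ^ (n - 1) * (z - x) \<le> z ^ n"
proof (cases n)
  case (Suc m)
  have "x ^ Suc m + real (Suc m) * x ^ m * (z - x) \<le> z ^ Suc m"
  proof (induction m)
    case (Suc m)
    have "0 \<le> real (Suc m) * x ^ m * (z - x)^2" using assms by simp
    moreover have "z * (x ^ Suc m + real (Suc m) * x ^ m * (z - x)) \<le> z * z ^ Suc m"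
      using Suc assms by (intro mult_left_mono)
    ultimately show ?case by (simp add: algebra_simps power2_eq_square)
  qed simp
  then show ?thesis using Suc by simp
qed simp

text \<open>The power series of \<open>\<phi>'\<close>, which still converges at \<open>1\<close>
because the mean is finite.\<close>

definition size_biased_series :: "nat pmf \<Rightarrow> real \<Rightarrow> real" where
  "size_biased_series \<pi> x = (\<Sum>n. pmf \<pi> n * (real n * x ^ (n - 1)))"

lemma pmf_expectation_sums:
  assumes "integrable (measure_pmf \<pi>) (f :: nat \<Rightarrow> real)"
  shows "(\<lambda>n. pmf \<pi> n * f n) sums measure_pmf.expectation \<pi> f"
    and "summable (\<lambda>n. \<bar>pmf \<pi> n * f n\<bar>)"
proof -
  have *: "integrable (count_space UNIV) (\<lambda>n. pmf \<pi> n * f n)"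
    using assms unfolding measure_pmf_eq_density
    by (subst (asm) integrable_density) auto
  have "measure_pmf.expectation \<pi> f = (\<integral>n. pmf \<pi> n * f n \<partial>count_space UNIV)"
    unfolding measure_pmf_eq_density by (subst integral_density) auto
  then show "(\<lambda>n. pmf \<pi> n * f n) sums measure_pmf.expectation \<pi> f"
    using sums_integral_count_space_nat[OF *] by simp
  show "summable (\<lambda>n. \<bar>pmf \<pi> n * f n\<bar>)"
    using * by (simp add: integrable_count_space_nat_iff)
qed

context
  fixes \<pi> :: "nat pmf"
  assumes mean: "integrable (measure_pmf \<pi>) real"
begin

lemma summable_mean: "summable (\<lambda>n. pmf \<pi> n * real n)"
  using pmf_expectation_sums[OF mean] sums_summable by blast

lemma size_biased_term_le:
  assumes "x \<in> {0..1}"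
  shows "norm (pmf \<pi> n * (real n * x ^ (n - 1))) \<le> pmf \<pi> n * real n"
proof -
  have "x ^ (n - 1) \<le> 1" using assms by (simp add: power_le_one)
  then have "real n * x ^ (n - 1) \<le> real n * 1" by (intro mult_left_mono) auto
  then show ?thesis using assms by (auto simp: abs_mult intro!: mult_left_mono)
qed

lemma size_biased_sums:
  assumes "x \<in> {0..1}"
  shows "(\<lambda>n. pmf \<pi> n * (real n * x ^ (n - 1))) sums size_biased_series \<pi> x"
  unfolding size_biased_series_def
  by (rule summable_sums, rule summable_comparison_test'[OF summable_mean])
     (rule size_biased_term_le[OF assms])

lemma size_biased_uniform:
  "uniform_limit {0..1} (\<lambda>n x. \<Sum>i<n. pmf \<pi> i * (real i * x ^ (i - 1)))
     (size_biased_series \<pi>) sequentially"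
  unfolding size_biased_series_def
  by (rule Weierstrass_m_test[OF _ summable_mean]) (rule size_biased_term_le)

lemma gen_fun_sums:
  assumes "x \<in> {0..1}"
  shows "(\<lambda>n. pmf \<pi> n * x ^ n) sums gen_fun \<pi> x"
  unfolding gen_fun_def
proof (rule pmf_expectation_sums(1))
  show "integrable (measure_pmf \<pi>) ((^) x)"
    by (rule measure_pmf.integrable_const_bound[where B = 1])
       (use assms in \<open>auto simp: power_le_one\<close>)
qed

text \<open>The differentiated series is dominated by the mean, uniformly on the closed unit
interval, so termwise differentiation is valid up to the endpoint \<open>1\<close>.\<close>

lemma gen_fun_has_derivative:
  assumes x: "x \<in> {0..1}"
  shows "(gen_fun \<pi> has_real_derivative size_biased_series \<pi> x) (at x within {0..1})"
proof -
  have "\<exists>g. \<forall>x\<in>{0..1}. (\<lambda>n. pmf \<pi> n * x ^ n) sums g x \<and>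
     (g has_field_derivative size_biased_series \<pi> x) (at x within {0..1})"
  proof (rule has_field_derivative_series)
    show "summable (\<lambda>n. pmf \<pi> n * 1 ^ n)"
      using gen_fun_sums[of 1] sums_summable by fastforce
    show "((\<lambda>x. pmf \<pi> n * x ^ n) has_real_derivative pmf \<pi> n * (real n * x ^ (n - 1)))
        (at x within {0..1})" for n and x :: real
      by (auto intro!: derivative_eq_intros)
  qed (use size_biased_uniform in auto)
  then obtain g where g: "\<And>x. x\<in>{0..1} \<Longrightarrow> (\<lambda>n. pmf \<pi> n * x ^ n) sums g x"
     "\<And>x. x\<in>{0..1} \<Longrightarrow> (g has_field_derivative size_biased_series \<pi> x) (at x within {0..1})"
    by blast
  have "g x = gen_fun \<pi> x" if "x \<in> {0..1}" for x
    using g(1)[OF that] gen_fun_sums[OF that] sums_unique2 by blast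
  then show ?thesis
    using g(2)[OF x] x has_field_derivative_transform_within[of g _ x "{0..1}" 1 "gen_fun \<pi>"]
    by auto
qed

lemma gen_fun_deriv_eq:
  assumes "x \<in> {0..1}"
  shows "gen_fun_deriv \<pi> x = size_biased_series \<pi> x"
  unfolding gen_fun_deriv_def
  using gen_fun_has_derivative[OF assms] assms
  by (intro vector_derivative_within_cbox[of 0 1, unfolded box_real])
     (auto simp: has_real_derivative_iff_has_vector_derivative)

lemma gen_fun_deriv_continuous: "continuous_on {0..1} (gen_fun_deriv \<pi>)"
proof -
  have "continuous_on {0..1} (size_biased_series \<pi>)"
    by (rule uniform_limit_theorem[OF _ size_biased_uniform])
       (auto intro!: continuous_intros always_eventually)
  then show ?thesis by (rule continuous_on_eq) (simp add: gen_fun_deriv_eq)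
qed

lemma gen_fun_deriv_nonneg:
  assumes "x \<in> {0..1}"
  shows "0 \<le> gen_fun_deriv \<pi> x"
  unfolding gen_fun_deriv_eq[OF assms] using assms
  by (intro sums_le[OF _ sums_zero size_biased_sums]) auto

lemma gen_fun_tangent_le:
  assumes "x \<in> {0..1}" "z \<in> {0..1}"
  shows "gen_fun \<pi> x + gen_fun_deriv \<pi> x * (z - x) \<le> gen_fun \<pi> z"
proof (rule sums_le)
  show "(\<lambda>n. pmf \<pi> n * x ^ n + pmf \<pi> n * (real n * x ^ (n - 1)) * (z - x)) sums
      (gen_fun \<pi> x + gen_fun_deriv \<pi> x * (z - x))"
    unfolding gen_fun_deriv_eq[OF assms(1)]
    by (intro sums_add gen_fun_sums sums_mult2 size_biased_sums assms)
  show "(\<lambda>n. pmf \<pi> n * z ^ n) sums gen_fun \<pi> z" by (rule gen_fun_sums[OF assms(2)])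
  show "pmf \<pi> n * x ^ n + pmf \<pi> n * (real n * x ^ (n - 1)) * (z - x) \<le> pmf \<pi> n * z ^ n" for n
    using mult_left_mono[OF power_tangent_le[of x z n], of "pmf \<pi> n"] assms
    by (simp add: algebra_simps)
qed

lemma gen_fun_deriv_strict:
  assumes "2 \<le> n" "0 < pmf \<pi> n" "0 \<le> x" "x < y" "y \<le> 1"
  shows "gen_fun_deriv \<pi> x < gen_fun_deriv \<pi> y"
proof -
  have xy: "x \<in> {0..1}" "y \<in> {0..1}" using assms by auto
  have "0 < (\<Sum>n. pmf \<pi> n * (real n * y ^ (n - 1)) - pmf \<pi> n * (real n * x ^ (n - 1)))"
  proof (rule suminf_pos2[where i = n])
    show "summable (\<lambda>n. pmf \<pi> n * (real n * y ^ (n - 1)) - pmf \<pi> n * (real n * x ^ (n - 1)))"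
      using size_biased_sums[OF xy(1)] size_biased_sums[OF xy(2)]
      by (intro summable_diff) (auto simp: sums_iff)
    show "0 \<le> pmf \<pi> n * (real n * y ^ (n - 1)) - pmf \<pi> n * (real n * x ^ (n - 1))" for n
      using assms by (auto intro!: mult_left_mono power_mono)
    have "x ^ (n - 1) < y ^ (n - 1)"
      using assms by (intro power_strict_mono) auto
    then show "0 < pmf \<pi> n * (real n * y ^ (n - 1)) - pmf \<pi> n * (real n * x ^ (n - 1))"
      using assms by auto
  qed
  also have "\<dots> = gen_fun_deriv \<pi> y - gen_fun_deriv \<pi> x"
    using sums_diff[OF size_biased_sums[OF xy(2)] size_biased_sums[OF xy(1)]]
    by (simp add: gen_fun_deriv_eq[OF xy(1)] gen_fun_deriv_eq[OF xy(2)] sums_iff)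
  finally show ?thesis by simp
qed

text \<open>An affine generating function makes \<open>F\<close> constant. A finite argmax therefore
excludes the only case in which \<open>\<phi>'\<close> is not strictly increasing.\<close>

lemma infinite_argmax_of_affine:
  assumes c: "0 < gen_fun_deriv \<pi> 1" and lin: "\<And>n. 2 \<le> n \<Longrightarrow> pmf \<pi> n = 0"
  shows "infinite (argmax_F \<pi>)"
proof -
  have d: "gen_fun_deriv \<pi> x = pmf \<pi> 1" if "x \<in> {0..1}" for x
  proof -
    have "(\<lambda>n. pmf \<pi> n * (real n * x ^ (n - 1))) sums (\<Sum>n\<in>{1}. pmf \<pi> n * (real n * x ^ (n - 1)))"
    proof (rule sums_finite)
      show "pmf \<pi> n * (real n * x ^ (n - 1)) = 0" if "n \<notin> {1}" for n
      proof -
        have "n = 0 \<or> 2 \<le> n" using that by auto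
        then show ?thesis using lin[of n] by auto
      qed
    qed auto
    then have "(\<lambda>n. pmf \<pi> n * (real n * x ^ (n - 1))) sums pmf \<pi> 1" by simp
    then show ?thesis
      using size_biased_sums[OF that] sums_unique2 gen_fun_deriv_eq[OF that] by metis
  qed
  have g: "gen_fun \<pi> x = pmf \<pi> 0 + pmf \<pi> 1 * x" if "x \<in> {0..1}" for x
  proof -
    have "(\<lambda>n. pmf \<pi> n * x ^ n) sums (\<Sum>n\<in>{0,1}. pmf \<pi> n * x ^ n)"
    proof (rule sums_finite)
      show "pmf \<pi> n * x ^ n = 0" if "n \<notin> {0,1}" for n
      proof -
        have "2 \<le> n" using that by auto
        then show ?thesis using lin[of n] by auto
      qed
    qed auto
    then have "(\<lambda>n. pmf \<pi> n * x ^ n) sums (pmf \<pi> 0 + pmf \<pi> 1 * x)" by simp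
    then show ?thesis
      using gen_fun_sums[OF that] sums_unique2 by metis
  qed
  have "F_fun \<pi> x = 2 * pmf \<pi> 0 + pmf \<pi> 1" if "x \<in> {0..1}" for x
    using that c g[of "1 - x"] g[of 0] d[of 1] d[of "1 - x"] d[of 0]
    by (simp add: F_fun_def phi_hat_def algebra_simps)
  then have "argmax_F \<pi> = {0..1}"
    by (auto simp: argmax_F_def is_arg_max_def)
  then show ?thesis by (simp add: infinite_Icc)
qed

end

section \<open>The response curve, its inverse and the energy\<close>

text \<open>The properties of \<open>T x = phi_hat (1 - x)\<close> and \<open>\<Phi> z = \<phi> (1 -
z) / \<phi>' 1\<close> on which the argument rests. The last one, a subgradient inequality, is the
form in which the convexity of \<open>\<phi>\<close> enters the duality.\<close>

locale response =
  fixes T \<Phi> :: "real \<Rightarrow> real"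
  assumes T_cont: "continuous_on {0..1} T"
    and T_less: "\<And>x y. 0 \<le> x \<Longrightarrow> x < y \<Longrightarrow> y \<le> 1 \<Longrightarrow> T y < T x"
    and T_0: "T 0 = 1"
    and T_1: "0 \<le> T 1"
    and tangent: "\<And>x z. x \<in> {0..1} \<Longrightarrow> z \<in> {0..1} \<Longrightarrow> \<Phi> x - T x * (z - x) \<le> \<Phi> z"
begin

lemma T_le: "0 \<le> x \<Longrightarrow> x \<le> y \<Longrightarrow> y \<le> 1 \<Longrightarrow> T y \<le> T x"
  using T_less[of x y] by (cases "x = y") auto

lemma T_range: "x \<in> {0..1} \<Longrightarrow> T x \<in> {0..1}"
  using T_le[of 0 x] T_le[of x 1] T_0 T_1 by auto

lemma T_less_iff: "x \<in> {0..1} \<Longrightarrow> y \<in> {0..1} \<Longrightarrow> T y < T x \<longleftrightarrow> x < y"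
  using T_less T_le by (metis atLeastAtMost_iff linorder_not_less)

lemma T_le_iff: "x \<in> {0..1} \<Longrightarrow> y \<in> {0..1} \<Longrightarrow> T y \<le> T x \<longleftrightarrow> x \<le> y"
  using T_less_iff by (metis linorder_not_less)

lemma T_inj: "inj_on T {0..1}"
  by (rule inj_onI) (metis T_less_iff linorder_neqE order_less_irrefl)

lemma T_eq_iff: "x \<in> {0..1} \<Longrightarrow> y \<in> {0..1} \<Longrightarrow> T y = T x \<longleftrightarrow> x = y"
  using T_inj by (auto simp: inj_on_def)

lemma T_image: "T ` {0..1} = {T 1..1}"
proof
  show "T ` {0..1} \<subseteq> {T 1..1}" using T_range T_le[of _ 1] by auto
  show "{T 1..1} \<subseteq> T ` {0..1}"
    using IVT2'[of T 1 _ 0] T_cont T_0 by (force simp: image_iff)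
qed

text \<open>The inverse of \<open>T\<close>, extended by the value \<open>1\<close> below \<open>T
1\<close>. This extension is the one that makes \<open>\<tau>\<close> the derivative of the dual
function \<open>\<Psi>\<close>.\<close>

definition \<tau> :: "real \<Rightarrow> real" where
  "\<tau> x = inv_into {0..1} T (max x (T 1))"

lemma \<tau>_range: "x \<in> {0..1} \<Longrightarrow> \<tau> x \<in> {0..1}"
  and T_\<tau>: "x \<in> {0..1} \<Longrightarrow> T (\<tau> x) = max x (T 1)"
  using T_image T_range[of 1] unfolding \<tau>_def
  by (auto intro!: inv_into_into f_inv_into_f simp del: atLeastAtMost_iff)
     (auto simp: inv_into_into f_inv_into_f max_def)

lemma \<tau>_T: "x \<in> {0..1} \<Longrightarrow> \<tau> (T x) = x"
  unfolding \<tau>_def using T_le[of x 1] T_inj by (simp add: max_absorb1)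

lemma \<tau>_cont: "continuous_on {0..1} \<tau>"
proof -
  have "continuous_on (T ` {0..1}) (inv_into {0..1} T)"
    using T_cont T_inj by (intro continuous_on_inv) auto
  then have "continuous_on {0..1} (inv_into {0..1} T \<circ> (\<lambda>x. max x (T 1)))"
    using T_range[of 1]
    by (intro continuous_on_compose continuous_intros) (auto simp: T_image elim!: continuous_on_subset)
  then show ?thesis by (simp add: o_def \<tau>_def[abs_def])
qed

lemma le_\<tau>: "x \<in> {0..1} \<Longrightarrow> z \<in> {0..1} \<Longrightarrow> x \<le> T z \<Longrightarrow> z \<le> \<tau> x"
  using T_le_iff[of z "\<tau> x"] T_\<tau>[of x] \<tau>_range[of x] T_le[of z 1] by auto

lemma \<tau>_le: "x \<in> {0..1} \<Longrightarrow> z \<in> {0..1} \<Longrightarrow> T z \<le> x \<Longrightarrow> \<tau> x \<le> z"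
  using T_le_iff[of "\<tau> x" z] T_\<tau>[of x] \<tau>_range[of x] by auto

text \<open>The concave dual of \<open>\<Phi>\<close>: the minimum over \<open>z\<close> of \<open>x
* z + \<Phi> z\<close>, which is attained at \<open>\<tau> x\<close>.\<close>

definition \<Psi> :: "real \<Rightarrow> real" where
  "\<Psi> x = x * \<tau> x + \<Phi> (\<tau> x)"

lemma \<Psi>_T: "z \<in> {0..1} \<Longrightarrow> \<Psi> (T z) = T z * z + \<Phi> z"
  by (simp add: \<Psi>_def \<tau>_T)

lemma Legendre_le:
  assumes "x \<in> {0..1}" "z \<in> {0..1}"
  shows "\<Psi> x \<le> x * z + \<Phi> z"
proof -
  have "\<Phi> (\<tau> x) - T (\<tau> x) * (z - \<tau> x) \<le> \<Phi> z"
    using assms by (intro tangent \<tau>_range)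
  moreover have "T (\<tau> x) * (z - \<tau> x) \<le> x * (z - \<tau> x)"
  proof (cases "T 1 \<le> x")
    case True
    then show ?thesis using T_\<tau>[OF assms(1)] by simp
  next
    case False
    then have "\<tau> x = 1" using T_inj by (simp add: \<tau>_def max_def)
    then show ?thesis using False assms by (intro mult_right_mono_neg) auto
  qed
  ultimately show ?thesis by (simp add: \<Psi>_def algebra_simps)
qed

text \<open>Applying duality at \<open>x\<close> and at \<open>y\<close> squeezes the difference
quotient between \<open>\<tau> x\<close> and \<open>\<tau> y\<close>.\<close>

lemma \<Psi>_has_derivative:
  assumes x: "x \<in> {0..1}"
  shows "(\<Psi> has_real_derivative \<tau> x) (at x within {0..1})"
  unfolding has_field_derivative_iff
proof (rule LIM_zero_cancel, rule Lim_null_comparison)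
  have t: "(\<tau> \<longlongrightarrow> \<tau> x) (at x within {0..1})"
    using \<tau>_cont x by (auto simp: continuous_on_def)
  show "((\<lambda>y. \<bar>\<tau> y - \<tau> x\<bar>) \<longlongrightarrow> 0) (at x within {0..1})"
    using tendsto_rabs[OF tendsto_diff[OF t tendsto_const[of "\<tau> x"]]] by simp
  show "\<forall>\<^sub>F y in at x within {0..1}. norm ((\<Psi> y - \<Psi> x) / (y - x) - \<tau> x) \<le> \<bar>\<tau> y - \<tau> x\<bar>"
    unfolding eventually_at_filter
  proof (intro always_eventually allI impI)
    fix y assume y: "y \<noteq> x" "y \<in> {0..1}"
    have 1: "\<Psi> y - \<Psi> x - \<tau> x * (y - x) \<le> 0"
      using Legendre_le[of y "\<tau> x"] \<tau>_range[OF x] y by (simp add: \<Psi>_def[of x] algebra_simps)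
    have 2: "(\<tau> y - \<tau> x) * (y - x) \<le> \<Psi> y - \<Psi> x - \<tau> x * (y - x)"
      using Legendre_le[of x "\<tau> y"] \<tau>_range[of y] x y by (simp add: \<Psi>_def[of y] algebra_simps)
    have "\<bar>\<Psi> y - \<Psi> x - \<tau> x * (y - x)\<bar> \<le> \<bar>(\<tau> y - \<tau> x) * (y - x)\<bar>" using 1 2 by linarith
    then have "\<bar>\<Psi> y - \<Psi> x - \<tau> x * (y - x)\<bar> / \<bar>y - x\<bar> \<le> \<bar>\<tau> y - \<tau> x\<bar>"
      using y by (simp add: abs_mult divide_le_eq)
    moreover have "(\<Psi> y - \<Psi> x) / (y - x) - \<tau> x = (\<Psi> y - \<Psi> x - \<tau> x * (y - x)) / (y - x)"
      using y by (simp add: field_simps)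
    ultimately show "norm ((\<Psi> y - \<Psi> x) / (y - x) - \<tau> x) \<le> \<bar>\<tau> y - \<tau> x\<bar>" by simp
  qed
qed

lemma \<Psi>_cont: "continuous_on {0..1} \<Psi>"
  using \<Psi>_has_derivative by (intro DERIV_continuous_on)

lemma integral_\<tau>:
  assumes "0 \<le> a" "a \<le> b" "b \<le> 1"
  shows "(\<integral>x. indicator {a..b} x * \<tau> x \<partial>lborel) = \<Psi> b - \<Psi> a"
proof -
  have "(\<integral>x. indicator {a..b} x *\<^sub>R \<tau> x \<partial>lborel) = \<Psi> b - \<Psi> a"
  proof (rule integral_FTC_atLeastAtMost[OF assms(2)])
    show "continuous_on {a..b} \<tau>" using \<tau>_cont assms by (auto elim!: continuous_on_subset)
    show "(\<Psi> has_vector_derivative \<tau> x) (at x within {a..b})" if "a \<le> x" "x \<le> b" for x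
      using \<Psi>_has_derivative[of x] that assms
      by (auto simp: has_real_derivative_iff_has_vector_derivative
               elim!: has_vector_derivative_within_subset)
  qed
  then show ?thesis by simp
qed

definition energy :: "real \<Rightarrow> real \<Rightarrow> real" where
  "energy x y = \<Psi> x + \<Psi> y - x * y"

lemma energy_commute: "energy x y = energy y x"
  by (simp add: energy_def mult.commute)

text \<open>The map \<open>F\<close> of the theorem, divided by \<open>\<phi>' 1\<close>.\<close>

definition profit :: "real \<Rightarrow> real" where
  "profit z = \<Phi> z + \<Phi> (T z) + z * T z"

lemma profit_eq_energy:
  assumes "z \<in> {0..1}"
  shows "profit z = energy (T (T z)) (T z)"
  using \<Psi>_T[OF assms] \<Psi>_T[OF T_range[OF assms]]
  by (simp add: profit_def energy_def algebra_simps)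

text \<open>Both values are of the form \<open>\<Psi> y + A\<close> with \<open>y = T (T z)\<close>:
for \<open>T z\<close> the second term is \<open>\<Phi> y\<close>, for \<open>z\<close> it is
\<open>\<Psi> x - x * y\<close> at \<open>x = T z\<close>, and duality says that the latter never
exceeds \<open>\<Phi> y\<close>.\<close>

lemma profit_T_ge:
  assumes "z \<in> {0..1}"
  shows "profit z \<le> profit (T z)"
proof -
  let ?w = "T (T z)"
  have w: "?w \<in> {0..1}" using assms T_range by blast
  have "profit (T z) = \<Psi> ?w + \<Phi> ?w"
    using \<Psi>_T[OF T_range[OF assms]] by (simp add: profit_def algebra_simps)
  moreover have "\<Psi> (T z) \<le> T z * ?w + \<Phi> ?w"
    using Legendre_le[of "T z" ?w] w T_range[OF assms] by simp
  ultimately show ?thesis using profit_eq_energy[OF assms] by (simp add: energy_def algebra_simps)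
qed

lemma profit_cont: "continuous_on {0..1} profit"
proof -
  have T2: "continuous_on {0..1} (\<lambda>z. T (T z))"
    using continuous_on_compose2[OF T_cont T_cont] T_range by (auto simp: image_subset_iff)
  have P: "continuous_on {0..1} (\<lambda>z. \<Psi> (T z))" "continuous_on {0..1} (\<lambda>z. \<Psi> (T (T z)))"
    using continuous_on_compose2[OF \<Psi>_cont T_cont] continuous_on_compose2[OF \<Psi>_cont T2] T_range
    by (auto simp: image_subset_iff)
  have "continuous_on {0..1} (\<lambda>z. energy (T (T z)) (T z))"
    unfolding energy_def by (intro continuous_intros P T2 T_cont)
  then show ?thesis by (rule continuous_on_eq) (simp add: profit_eq_energy)
qed

definition maximizers :: "real set" where
  "maximizers = {x. is_arg_max profit (\<lambda>x. x \<in> {0..1}) x}"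

lemma maximizersI:
  assumes "x \<in> {0..1}" "\<And>z. z \<in> {0..1} \<Longrightarrow> profit z \<le> profit x"
  shows "x \<in> maximizers"
  using assms by (force simp: maximizers_def is_arg_max_def)

lemma maximizersD:
  assumes "x \<in> maximizers"
  shows "x \<in> {0..1}" "\<And>z. z \<in> {0..1} \<Longrightarrow> profit z \<le> profit x"
  using assms by (force simp: maximizers_def is_arg_max_def)+

lemma maximizers_nonempty: "maximizers \<noteq> {}"
  using continuous_attains_sup[OF compact_Icc _ profit_cont] maximizersI by fastforce

lemma maximizers_T: "x \<in> maximizers \<Longrightarrow> T x \<in> maximizers"
  using maximizersD[of x] profit_T_ge[of x] T_range[of x]
  by (intro maximizersI) (auto intro: order_trans)

lemma maximizers_energy:
  assumes xy: "x \<in> {0..1}" "y \<in> {0..1}" "T x = y" "T y = x"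
    and max: "\<And>z. z \<in> {0..1} \<Longrightarrow> energy (T (T z)) (T z) \<le> energy x y"
  shows "x \<in> maximizers"
  using assms profit_eq_energy by (intro maximizersI) auto

lemma maximizers_single: "maximizers = {\<gamma>} \<Longrightarrow> T \<gamma> = \<gamma> \<and> 0 < \<gamma> \<and> \<gamma> < 1"
proof -
  assume m: "maximizers = {\<gamma>}"
  have g: "\<gamma> \<in> {0..1}" using maximizersD(1) m by blast
  have 1: "T \<gamma> = \<gamma>" using maximizers_T[of \<gamma>] m by auto
  moreover have "\<gamma> \<noteq> 0" using 1 T_0 by auto
  moreover have "\<gamma> \<noteq> 1" using 1 T_0 T_less[of 0 1] by auto
  ultimately show ?thesis using g by auto
qed

text \<open>Since \<open>T\<close> is decreasing and maps maximisers to maximisers, it exchanges the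
two points; as \<open>T 0 = 1\<close> and only \<open>0\<close> is sent to \<open>1\<close>, a
boundary point can only occur in the pair \<open>{0, 1}\<close>.\<close>

lemma maximizers_two:
  assumes m: "maximizers = {\<gamma>1, \<gamma>2}" "\<gamma>1 < \<gamma>2"
  shows "T \<gamma>1 = \<gamma>2" "T \<gamma>2 = \<gamma>1" "(0 < \<gamma>1 \<and> \<gamma>2 < 1) \<or> (\<gamma>1 = 0 \<and> \<gamma>2 = 1)"
proof -
  have g: "\<gamma>1 \<in> {0..1}" "\<gamma>2 \<in> {0..1}" using maximizersD(1) m by blast+
  have "T \<gamma>2 < T \<gamma>1" using g m T_less by auto
  moreover have "T \<gamma>1 \<in> {\<gamma>1, \<gamma>2}" "T \<gamma>2 \<in> {\<gamma>1, \<gamma>2}" using maximizers_T m by blast+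
  ultimately show 1: "T \<gamma>1 = \<gamma>2" "T \<gamma>2 = \<gamma>1" using m(2) by auto
  show "(0 < \<gamma>1 \<and> \<gamma>2 < 1) \<or> (\<gamma>1 = 0 \<and> \<gamma>2 = 1)"
  proof (cases "\<gamma>1 = 0")
    case True
    then show ?thesis using 1 T_0 by auto
  next
    case False
    then have "T \<gamma>1 < 1" using T_less[of 0 \<gamma>1] g T_0 by auto
    then show ?thesis using False g 1 by auto
  qed
qed

end

lemma response_of_gen_fun:
  fixes \<pi> :: "nat pmf"
  assumes mean: "integrable (measure_pmf \<pi>) real"
    and c: "0 < gen_fun_deriv \<pi> 1"
    and fin: "finite (argmax_F \<pi>)"
  defines "T \<equiv> \<lambda>x. phi_hat \<pi> (1 - x)"
  defines "\<Phi> \<equiv> \<lambda>x. gen_fun \<pi> (1 - x) / gen_fun_deriv \<pi> 1"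
  shows "response T \<Phi>"
    and "argmax_F \<pi> = response.maximizers T \<Phi>"
proof -
  obtain n where n: "2 \<le> n" "0 < pmf \<pi> n"
    using infinite_argmax_of_affine[OF mean c] fin
    by (metis pmf_nonneg order_less_le)
  show r: "response T \<Phi>"
  proof
    have "continuous_on {0..1} (gen_fun_deriv \<pi> \<circ> (\<lambda>x. 1 - x))"
      by (intro continuous_on_compose continuous_intros)
         (auto intro!: continuous_on_subset[OF gen_fun_deriv_continuous[OF mean]])
    then show "continuous_on {0..1} T"
      unfolding T_def phi_hat_def using c by (auto intro!: continuous_intros simp: o_def)
    show "T y < T x" if "0 \<le> x" "x < y" "y \<le> 1" for x y
      using gen_fun_deriv_strict[OF mean n, of "1 - y" "1 - x"] that c
      by (auto simp: T_def phi_hat_def divide_strict_right_mono)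
    show "T 0 = 1" "0 \<le> T 1"
      using c gen_fun_deriv_nonneg[OF mean, of 0] by (auto simp: T_def phi_hat_def)
    show "\<Phi> x - T x * (z - x) \<le> \<Phi> z" if "x \<in> {0..1}" "z \<in> {0..1}" for x z
    proof -
      have "gen_fun \<pi> (1 - x) + gen_fun_deriv \<pi> (1 - x) * ((1 - z) - (1 - x)) \<le> gen_fun \<pi> (1 - z)"
        using that by (intro gen_fun_tangent_le mean) auto
      then have "(gen_fun \<pi> (1 - x) + gen_fun_deriv \<pi> (1 - x) * ((1 - z) - (1 - x))) / gen_fun_deriv \<pi> 1
          \<le> gen_fun \<pi> (1 - z) / gen_fun_deriv \<pi> 1"
        using c by (intro divide_right_mono) auto
      then show ?thesis
        using c by (simp add: \<Phi>_def T_def phi_hat_def field_simps)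
    qed
  qed
  interpret response T \<Phi> by (rule r)
  have "F_fun \<pi> x = gen_fun_deriv \<pi> 1 * profit x" for x
    using c unfolding F_fun_def profit_def unfolding T_def \<Phi>_def by (simp add: field_simps)
  then show "argmax_F \<pi> = maximizers"
    using c by (simp add: argmax_F_def maximizers_def is_arg_max_def)
qed

section \<open>Profiles and their quantiles\<close>

definition unit_mono :: "(real \<Rightarrow> real) \<Rightarrow> bool" where
  "unit_mono h \<longleftrightarrow> mono h \<and> (\<forall>t. 0 \<le> h t \<and> h t \<le> 1)"

definition profile :: "(real \<Rightarrow> real) \<Rightarrow> real \<Rightarrow> real \<Rightarrow> bool" where
  "profile f a b \<longleftrightarrow> mono f \<and> (\<forall>t. continuous (at_right t) f) \<and>
     (f \<longlongrightarrow> a) at_bot \<and> (f \<longlongrightarrow> b) at_top \<and> 0 \<le> a \<and> a < b \<and> b \<le> 1"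

lemma mono_limit_at_bot:
  fixes f :: "real \<Rightarrow> real"
  assumes "mono f" "\<And>t. l \<le> f t"
  obtains a where "(f \<longlongrightarrow> a) at_bot" "\<And>t. a \<le> f t" "l \<le> a"
proof -
  define a where "a = Inf (range f)"
  have bdd: "bdd_below (range f)" using assms(2) by (auto intro!: bdd_belowI[of _ l])
  have a: "a \<le> f t" for t unfolding a_def using bdd by (intro cInf_lower) auto
  have "(f \<longlongrightarrow> a) at_bot"
  proof (rule order_tendstoI)
    show "\<forall>\<^sub>F x in at_bot. y < f x" if "y < a" for y
      using a that by (intro always_eventually) (meson less_le_trans)
    show "\<forall>\<^sub>F x in at_bot. f x < y" if ay: "a < y" for y
    proof -
      obtain t where "f t < y" using ay cInf_less_iff[OF _ bdd, of y] unfolding a_def by auto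
      then show ?thesis
        using monoD[OF assms(1)] unfolding eventually_at_bot_linorder by (meson le_less_trans)
    qed
  qed
  moreover have "l \<le> a" unfolding a_def using assms(2) by (intro cInf_greatest) auto
  ultimately show ?thesis using that a by blast
qed

lemma mono_limit_at_top:
  fixes f :: "real \<Rightarrow> real"
  assumes "mono f" "\<And>t. f t \<le> u"
  obtains b where "(f \<longlongrightarrow> b) at_top" "\<And>t. f t \<le> b" "b \<le> u"
proof -
  define b where "b = Sup (range f)"
  have bdd: "bdd_above (range f)" using assms(2) by (auto intro!: bdd_aboveI[of _ u])
  have b: "f t \<le> b" for t unfolding b_def using bdd by (intro cSup_upper) auto
  have "(f \<longlongrightarrow> b) at_top"
  proof (rule order_tendstoI)
    show "\<forall>\<^sub>F x in at_top. f x < y" if "b < y" for y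
      using b that by (intro always_eventually) (meson le_less_trans)
    show "\<forall>\<^sub>F x in at_top. y < f x" if yb: "y < b" for y
    proof -
      obtain t where "y < f t" using yb less_cSup_iff[OF _ bdd, of y] unfolding b_def by auto
      then show ?thesis
        using monoD[OF assms(1)] unfolding eventually_at_top_linorder by (meson less_le_trans)
    qed
  qed
  moreover have "b \<le> u" unfolding b_def using assms(2) by (intro cSup_least) auto
  ultimately show ?thesis using that b by blast
qed

lemma mono_ge_limit_at_bot:
  fixes f :: "real \<Rightarrow> real"
  assumes "mono f" "(f \<longlongrightarrow> a) at_bot"
  shows "a \<le> f t"
  by (rule tendsto_upperbound[OF assms(2)])
     (auto simp: eventually_at_bot_linorder intro!: exI[of _ t] monoD[OF assms(1)])

lemma mono_le_limit_at_top:
  fixes f :: "real \<Rightarrow> real"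
  assumes "mono f" "(f \<longlongrightarrow> b) at_top"
  shows "f t \<le> b"
  by (rule tendsto_lowerbound[OF assms(2)])
     (auto simp: eventually_at_top_linorder intro!: exI[of _ t] monoD[OF assms(1)])

lemma profile_bounds:
  assumes "profile f a b"
  shows "a \<le> f t" "f t \<le> b"
  using assms mono_ge_limit_at_bot mono_le_limit_at_top unfolding profile_def by blast+

lemma profile_unit_mono: "profile f a b \<Longrightarrow> unit_mono f"
  using profile_bounds[of f a b] unfolding unit_mono_def profile_def
  by (meson order_trans)

definition quantile :: "(real \<Rightarrow> real) \<Rightarrow> real \<Rightarrow> real" where
  "quantile f p = Inf {t. p \<le> f t}"

text \<open>Right continuity makes the infimum defining the quantile a minimum, which gives a Galois
connection between a profile and its quantile function.\<close>

lemma quantile_le_iff: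
  assumes f: "profile f a b" and p: "a < p" "p < b"
  shows "quantile f p \<le> t \<longleftrightarrow> p \<le> f t"
proof -
  have m: "mono f" and bot: "(f \<longlongrightarrow> a) at_bot" and top: "(f \<longlongrightarrow> b) at_top"
    using f by (auto simp: profile_def)
  have rc: "continuous (at_right t) f" for t using f by (auto simp: profile_def)
  obtain u where u: "f u < p"
    using order_tendstoD(2)[OF bot p(1)] by (auto simp: eventually_at_bot_linorder)
  obtain v where v: "p < f v"
    using order_tendstoD(1)[OF top p(2)] by (auto simp: eventually_at_top_linorder)
  have bdd: "bdd_below {t. p \<le> f t}"
  proof (rule bdd_belowI)
    fix t assume "t \<in> {t. p \<le> f t}"
    then show "u \<le> t" using u monoD[OF m, of t u] by (cases "u \<le> t") auto
  qed
  have *: "p \<le> f s" if qs: "quantile f p < s" for s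
  proof -
    have "v \<in> {t. p \<le> f t}" using v by simp
    then obtain t where "p \<le> f t" "t < s"
      using qs cInf_less_iff[OF _ bdd, of s] unfolding quantile_def by blast
    then show ?thesis using monoD[OF m, of t s] by auto
  qed
  have q: "p \<le> f (quantile f p)"
  proof (rule tendsto_lowerbound)
    show "(f \<longlongrightarrow> f (quantile f p)) (at_right (quantile f p))"
      using rc by (simp add: continuous_within)
    show "\<forall>\<^sub>F x in at_right (quantile f p). p \<le> f x"
      using * by (auto simp: eventually_at_filter)
  qed auto
  show ?thesis
  proof
    assume "quantile f p \<le> t" then show "p \<le> f t" using q monoD[OF m] order_trans by blast
  next
    assume "p \<le> f t" then show "quantile f p \<le> t"
      unfolding quantile_def using bdd by (intro cInf_lower) auto
  qed
qed

lemma quantile_gt_iff: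
  assumes "profile f a b" "a < p" "p < b"
  shows "t < quantile f p \<longleftrightarrow> f t < p"
  using quantile_le_iff[OF assms, of t] by linarith

lemma le_quantile: "profile f a b \<Longrightarrow> a < p \<Longrightarrow> p < b \<Longrightarrow> p \<le> f (quantile f p)"
  using quantile_le_iff by blast

lemma quantile_mono_on: "profile f a b \<Longrightarrow> mono_on {a<..<b} (quantile f)"
  using quantile_le_iff le_quantile
  by (intro mono_onI) (meson greaterThanLessThan_iff order_trans)

text \<open>Lebesgue measure on the interval of ranks of a profile that rises from \<open>a\<close>
to \<open>b\<close>: under it, the quantile function has the increments of the profile as its
law.\<close>

definition slab :: "real \<Rightarrow> real \<Rightarrow> real measure" where
  "slab a b = restrict_space lborel {a<..<b}"

lemma space_slab [simp]: "space (slab a b) = {a<..<b}"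
  by (simp add: slab_def space_restrict_space)

lemma sets_slab [measurable_cong]: "sets (slab a b) = sets (restrict_space borel {a<..<b})"
  by (simp add: slab_def sets_restrict_space)

lemma emeasure_slab:
  assumes "A \<in> sets borel" "A \<subseteq> {a<..<b}"
  shows "emeasure (slab a b) A = emeasure lborel A"
  using assms by (auto simp: slab_def emeasure_restrict_space)

lemma finite_measure_slab: "finite_measure (slab a b)"
  proof (rule finite_measureI)
  have "emeasure (slab a b) {a<..<b} \<le> emeasure lborel {a..b}"
    by (subst emeasure_slab) (auto intro!: emeasure_mono)
  also have "\<dots> < \<infinity>" by (simp add: emeasure_lborel_Icc_eq)
  finally show "emeasure (slab a b) (space (slab a b)) \<noteq> \<infinity>" by simp
qed

lemma measure_slab: "measure (slab a b) {p \<in> {a<..<b}. p \<le> x} = (if x < a then 0 else min x b - a)"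
  if "a < b" for a b x :: real
proof -
  have "{p \<in> {a<..<b}. p \<le> x} = (if x < b then {a<..x} else {a<..<b})" using that by auto
  moreover have "emeasure (slab a b) {a<..x} = ennreal (x - a)" if "a \<le> x" "x < b"
    using that by (subst emeasure_slab) auto
  moreover have "emeasure (slab a b) {a<..<b} = ennreal (b - a)"
    using that by (subst emeasure_slab) auto
  ultimately show ?thesis using that by (auto simp: measure_def)
qed

lemma quantile_measurable [measurable]:
  assumes "profile f a b"
  shows "quantile f \<in> borel_measurable (slab a b)"
  using borel_measurable_mono_on_fnc[OF quantile_mono_on[OF assms]]
  by (simp add: slab_def measurable_restrict_space1 cong: measurable_cong_sets)

section \<open>The averaging operator\<close>

locale matching_system = response T \<Phi> + real_distribution \<omega>
  for T \<Phi> :: "real \<Rightarrow> real" and \<omega> :: "real measure" +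
  assumes no_atom: "measure \<omega> {x} = 0"
begin

lemma prob_UNIV [simp]: "measure \<omega> UNIV = 1"
  using prob_space by simp

definition K :: "(real \<Rightarrow> real) \<Rightarrow> real \<Rightarrow> real" where
  "K h t = (\<integral>w. h (w - t) \<partial>\<omega>)"

definition S :: "real \<Rightarrow> real" where
  "S s = measure \<omega> {s..}"

lemma unit_mono_measurable [measurable]: "unit_mono h \<Longrightarrow> h \<in> borel_measurable borel"
  by (intro borel_measurable_mono) (simp add: unit_mono_def)

lemma K_integrable: "unit_mono h \<Longrightarrow> integrable \<omega> (\<lambda>w. h (w - t))"
  by (rule integrable_const_bound[where B = 1]) (auto simp: unit_mono_def unit_mono_measurable)

lemma K_range: assumes "unit_mono h" shows "K h t \<in> {0..1}"
proof -
  have "K h t \<le> (\<integral>w. 1 \<partial>\<omega>)" unfolding K_def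
    using assms by (intro integral_mono K_integrable) (auto simp: unit_mono_def)
  moreover have "0 \<le> K h t" unfolding K_def
    using assms by (intro Bochner_Integration.integral_nonneg) (auto simp: unit_mono_def)
  ultimately show ?thesis by (simp)
qed

lemma K_antimono: "unit_mono h \<Longrightarrow> s \<le> t \<Longrightarrow> K h t \<le> K h s"
  unfolding K_def by (intro integral_mono K_integrable) (auto simp: unit_mono_def intro: monoD)

lemma K_le: "unit_mono h \<Longrightarrow> unit_mono h' \<Longrightarrow> (\<And>t. h t \<le> h' t) \<Longrightarrow> K h t \<le> K h' t"
  unfolding K_def by (intro integral_mono K_integrable) auto

lemma AE_avoids_countable:
  assumes "countable C"
  shows "AE w in \<omega>. w - t \<notin> C"
proof -
  have "AE w in \<omega>. \<forall>c\<in>C. w \<noteq> c + t"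
  proof (rule AE_ball_countable[THEN iffD2, OF assms], intro ballI)
    fix c
    have "emeasure \<omega> {c + t} = 0" using no_atom by (simp add: emeasure_eq_measure)
    then show "AE w in \<omega>. w \<noteq> c + t" by (subst AE_iff_measurable[of "{c + t}"]) auto
  qed
  then show ?thesis by eventually_elim (metis diff_add_cancel)
qed

text \<open>Monotone functions are only known to converge outside a countable set, but
\<open>W\<close> has no atoms and does not see it. The drift \<open>d\<close> allows a moving frame;
with a constant sequence of functions it gives continuity of \<open>K h\<close>.\<close>

lemma K_limit:
  assumes h: "\<And>n. unit_mono (h n)" "unit_mono h'"
    and C: "countable C" and lim: "\<And>s. s \<notin> C \<Longrightarrow> (\<lambda>n. h n (s + d n)) \<longlonglongrightarrow> h' s"
  shows "(\<lambda>n. K (h n) (t - d n)) \<longlonglongrightarrow> K h' t"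
  unfolding K_def
proof (rule integral_dominated_convergence[where w = "\<lambda>_. 1"])
  show "AE w in \<omega>. (\<lambda>n. h n (w - (t - d n))) \<longlonglongrightarrow> h' (w - t)"
    using AE_avoids_countable[OF C, of t]
    by eventually_elim (use lim in \<open>force simp: algebra_simps\<close>)
qed (use h in \<open>auto simp: unit_mono_def intro!: measurable_compose[OF _ unit_mono_measurable] simp: unit_mono_measurable\<close>)

lemma unit_mono_discont: "unit_mono h \<Longrightarrow> countable {s. \<not> isCont h s}"
  using mono_ctble_discont by (auto simp: unit_mono_def)

lemma K_cont: assumes h: "unit_mono h" shows "isCont (K h) t"
  unfolding continuous_at_sequentially o_def
proof (intro allI impI)
  fix x :: "nat \<Rightarrow> real" assume x: "x \<longlonglongrightarrow> t"
  have "(\<lambda>n. K h (t - (t - x n))) \<longlonglongrightarrow> K h t"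
  proof (rule K_limit[OF h h unit_mono_discont[OF h]])
    fix s assume "s \<notin> {s. \<not> isCont h s}"
    then have c: "isCont h s" by simp
    have "(\<lambda>n. s + (t - x n)) \<longlonglongrightarrow> s + (t - t)" by (intro tendsto_intros x)
    then show "(\<lambda>n. h (s + (t - x n))) \<longlonglongrightarrow> h s"
      using isCont_tendsto_compose[OF c] by simp
  qed
  then show "(\<lambda>n. K h (x n)) \<longlonglongrightarrow> K h t" by simp
qed

lemma K_at_top:
  assumes h: "unit_mono h" and a: "(h \<longlongrightarrow> a) at_bot"
  shows "(K h \<longlongrightarrow> a) at_top"
proof -
  have "((\<lambda>t. \<integral>w. h (w - t) \<partial>\<omega>) \<longlongrightarrow> (\<integral>w. a \<partial>\<omega>)) at_top"
  proof (rule integral_dominated_convergence_at_top[where w = "\<lambda>_. 1"])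
    have "((\<lambda>t. h (w - t)) \<longlongrightarrow> a) at_top" for w
    proof (rule filterlim_compose[OF a])
      show "filterlim (\<lambda>t. w - t) at_bot at_top"
        unfolding filterlim_at_bot eventually_at_top_linorder
        by (metis add.commute diff_le_eq le_diff_eq)
    qed
    then show "AE w in \<omega>. ((\<lambda>t. h (w - t)) \<longlongrightarrow> a) at_top" by simp
  qed (use h in \<open>auto simp: unit_mono_def unit_mono_measurable\<close>)
  then show ?thesis by (simp add: K_def[abs_def] prob_UNIV)
qed

lemma K_at_bot:
  assumes h: "unit_mono h" and b: "(h \<longlongrightarrow> b) at_top"
  shows "(K h \<longlongrightarrow> b) at_bot"
proof -
  have "((\<lambda>t. \<integral>w. h (w - - t) \<partial>\<omega>) \<longlongrightarrow> (\<integral>w. b \<partial>\<omega>)) at_top"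
  proof (rule integral_dominated_convergence_at_top[where w = "\<lambda>_. 1"])
    have "((\<lambda>t. h (w - - t)) \<longlongrightarrow> b) at_top" for w
    proof (rule filterlim_compose[OF b])
      show "filterlim (\<lambda>t. w - - t) at_top at_top"
        unfolding filterlim_at_top eventually_at_top_linorder
        by (metis add.commute diff_le_eq diff_minus_eq_add)
    qed
    then show "AE w in \<omega>. ((\<lambda>t. h (w - - t)) \<longlongrightarrow> b) at_top" by simp
  qed (use h in \<open>auto simp: unit_mono_def unit_mono_measurable\<close>)
  then show ?thesis
    by (simp add: K_def[abs_def] filterlim_at_bot_mirror)
qed

lemma S_eq_K: "S = K (indicator {0..})"
proof
  fix t
  have "K (indicator {0..}) t = (\<integral>w. indicator {t..} w \<partial>\<omega>)"
    unfolding K_def by (intro Bochner_Integration.integral_cong) (auto simp: indicator_def)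
  then show "S t = K (indicator {0..}) t" by (simp add: S_def)
qed

lemma unit_mono_step: "unit_mono (indicator {0..})"
  by (auto simp: unit_mono_def mono_def indicator_def)

lemma S_range: "S t \<in> {0..1}" and S_antimono: "s \<le> t \<Longrightarrow> S t \<le> S s" and S_cont: "isCont S t"
  using K_range K_antimono K_cont unit_mono_step unfolding S_eq_K by blast+

lemma S_measurable [measurable]: "S \<in> borel_measurable borel"
  using S_cont by (intro borel_measurable_continuous_onI) (auto simp: continuous_at_imp_continuous_on)

lemma S_at_top: "(S \<longlongrightarrow> 0) at_top" and S_at_bot: "(S \<longlongrightarrow> 1) at_bot"
proof -
  have "((indicator {0::real..} :: real \<Rightarrow> real) \<longlongrightarrow> 0) at_bot"
    by (rule tendsto_eventually) (auto simp: eventually_at_bot_linorder intro!: exI[of _ "-1"])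
  then show "(S \<longlongrightarrow> 0) at_top" unfolding S_eq_K by (rule K_at_top[OF unit_mono_step])
  have "((indicator {0::real..} :: real \<Rightarrow> real) \<longlongrightarrow> 1) at_top"
    by (rule tendsto_eventually) (auto simp: eventually_at_top_linorder intro!: exI[of _ "0"])
  then show "(S \<longlongrightarrow> 1) at_bot" unfolding S_eq_K by (rule K_at_bot[OF unit_mono_step])
qed

lemma TK_cont: "unit_mono h \<Longrightarrow> isCont (\<lambda>t. T (K h t)) t"
proof -
  assume h: "unit_mono h"
  have "continuous_on UNIV (\<lambda>t. T (K h t))"
    using K_cont[OF h] K_range[OF h]
    by (intro continuous_on_compose2[OF T_cont]) (auto simp: continuous_at_imp_continuous_on)
  then show ?thesis by (simp add: continuous_on_eq_continuous_at)
qed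

lemma T_tendsto:
  assumes "(x \<longlongrightarrow> l) F" "\<And>n. x n \<in> {0..1}" "l \<in> {0..1}"
  shows "((\<lambda>n. T (x n)) \<longlongrightarrow> T l) F"
  using assms T_cont continuous_on_tendsto_compose[of "{0..1}" T x l F] by auto

lemma integral_S_measurable:
  fixes X :: "real \<Rightarrow> real"
  assumes X [measurable]: "X \<in> borel_measurable (slab a b)"
  shows "(\<integral>q. S (x + X q) \<partial>slab a b) = (\<integral>w. measure (slab a b) {q \<in> {a<..<b}. X q \<le> w - x} \<partial>\<omega>)"
proof -
  interpret slab: finite_measure "slab a b" by (rule finite_measure_slab)
  interpret pair_sigma_finite "slab a b" \<omega> ..
  let ?I = "\<lambda>q w. indicator {w. x + X q \<le> w} w :: real"
  have int: "integrable (slab a b \<Otimes>\<^sub>M \<omega>) (\<lambda>(q, w). ?I q w)"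
  proof (rule finite_measure.integrable_const_bound[where B = 1])
    show "finite_measure (slab a b \<Otimes>\<^sub>M \<omega>)"
      by (intro finite_measure_pair_measure slab.finite_measure_axioms finite_measure_axioms)
    show "(\<lambda>(q, w). ?I q w) \<in> borel_measurable (slab a b \<Otimes>\<^sub>M \<omega>)"
      by (simp add: indicator_def case_prod_unfold)
  qed (auto simp: indicator_def)
  have "(\<integral>q. S (x + X q) \<partial>slab a b) = (\<integral>q. (\<integral>w. ?I q w \<partial>\<omega>) \<partial>slab a b)"
    by (simp add: S_def atLeast_def)
  also have "\<dots> = (\<integral>w. (\<integral>q. ?I q w \<partial>slab a b) \<partial>\<omega>)"
    using Fubini_integral[OF int] by simp
  also have "\<dots> = (\<integral>w. measure (slab a b) {q \<in> {a<..<b}. X q \<le> w - x} \<partial>\<omega>)"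
  proof (intro Bochner_Integration.integral_cong refl)
    fix w
    have "(\<integral>q. ?I q w \<partial>slab a b) = (\<integral>q. indicator {q \<in> {a<..<b}. X q \<le> w - x} q \<partial>slab a b)"
      by (intro Bochner_Integration.integral_cong) (auto simp: indicator_def algebra_simps)
    then show "(\<integral>q. ?I q w \<partial>slab a b) = measure (slab a b) {q \<in> {a<..<b}. X q \<le> w - x}"
      by (simp add: Int_absorb2 subset_eq)
  qed
  finally show ?thesis .
qed

text \<open>Fubini: for fixed \<open>w\<close> the ranks \<open>q\<close> with \<open>x + quantile g
q \<le> w\<close> fill the interval from \<open>a\<close> to \<open>g (w - x)\<close>. This converts
the averaging operator into a marginal of the kernel \<open>S (X p + Y q)\<close>.\<close>

lemma integral_S_quantile:
  assumes g: "profile g a b"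
  shows "(\<integral>q. S (x + quantile g q) \<partial>slab a b) = K g x - a"
proof -
  have ab: "a < b" and um: "unit_mono g"
    using g profile_unit_mono by (auto simp: profile_def)
  have "measure (slab a b) {q \<in> {a<..<b}. quantile g q \<le> w - x} = g (w - x) - a" for w
  proof -
    have "{q \<in> {a<..<b}. quantile g q \<le> w - x} = {q \<in> {a<..<b}. q \<le> g (w - x)}"
      using quantile_le_iff[OF g] by auto
    then show ?thesis
      using measure_slab[OF ab] profile_bounds[OF g, of "w - x"] by auto
  qed
  then show ?thesis
    using K_integrable[OF um] by (simp add: integral_S_measurable[OF quantile_measurable[OF g]] K_def)
qed

end

section \<open>Marginals of the kernel and near-maximality of the energy\<close>

lemma slab_ident_measurable [measurable]: "(\<lambda>p. p) \<in> borel_measurable (slab a b)"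
  unfolding slab_def by (rule measurable_restrict_space1) simp

lemma slab_indicator_measurable [measurable]:
  "(indicator {..x} :: real \<Rightarrow> real) \<in> borel_measurable (slab a b)"
  unfolding slab_def by (rule measurable_restrict_space1) simp

lemma integral_slab_indicator:
  assumes "a < b" "x \<in> {a..b}"
  shows "(\<integral>p. indicator {..x} p \<partial>slab a b) = x - a"
proof -
  have "(\<integral>p. indicator {..x} p \<partial>slab a b) = (\<integral>p. indicator {p \<in> {a<..<b}. p \<le> x} p \<partial>slab a b)"
    by (intro Bochner_Integration.integral_cong) (auto simp: indicator_def)
  also have "\<dots> = measure (slab a b) {p \<in> {a<..<b}. p \<le> x}" by (simp add: Int_absorb2 subset_eq)
  finally show ?thesis using measure_slab[OF assms(1)] assms(2) by auto
qed

definition slab2 :: "real \<Rightarrow> real \<Rightarrow> real \<Rightarrow> real \<Rightarrow> (real \<times> real) measure" where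
  "slab2 a b a' b' = slab a b \<Otimes>\<^sub>M slab a' b'"

lemma pair_slab: "pair_sigma_finite (slab a b) (slab a' b')"
  by (intro pair_sigma_finite.intro finite_measure.axioms(1) finite_measure_slab)

lemma space_slab2 [simp]: "space (slab2 a b a' b') = {a<..<b} \<times> {a'<..<b'}"
  by (simp add: slab2_def space_pair_measure)

lemma slab2_fst [measurable (raw)]:
  "u \<in> borel_measurable (slab a b) \<Longrightarrow> (\<lambda>z. u (fst z)) \<in> borel_measurable (slab2 a b a' b')"
  and slab2_snd [measurable (raw)]:
  "v \<in> borel_measurable (slab a' b') \<Longrightarrow> (\<lambda>z. v (snd z)) \<in> borel_measurable (slab2 a b a' b')"
  unfolding slab2_def
  by (auto intro: measurable_compose[OF measurable_fst] measurable_compose[OF measurable_snd])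

lemma slab2_integrable:
  fixes u :: "real \<times> real \<Rightarrow> real"
  assumes "u \<in> borel_measurable (slab2 a b a' b')" "\<And>z. \<bar>u z\<bar> \<le> B"
  shows "integrable (slab2 a b a' b') u"
  unfolding slab2_def
  by (rule finite_measure.integrable_const_bound[where B = B])
     (use assms in \<open>auto simp: slab2_def intro!: finite_measure_pair_measure finite_measure_slab\<close>)

lemma slab_integrable:
  fixes u :: "real \<Rightarrow> real"
  assumes "u \<in> borel_measurable (slab a b)" "\<And>z. \<bar>u z\<bar> \<le> B"
  shows "integrable (slab a b) u"
  by (rule finite_measure.integrable_const_bound[OF finite_measure_slab, where B = B])
     (use assms in auto)

lemma integral_slab2_fst:
  fixes u :: "real \<times> real \<Rightarrow> real"
  assumes "integrable (slab2 a b a' b') u"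
  shows "(\<integral>z. u z \<partial>slab2 a b a' b') = (\<integral>p. (\<integral>q. u (p, q) \<partial>slab a' b') \<partial>slab a b)"
  using pair_sigma_finite.integral_fst'[OF pair_slab, of a b a' b' u] assms by (simp add: slab2_def)

lemma integral_slab2_snd:
  fixes u :: "real \<times> real \<Rightarrow> real"
  assumes "integrable (slab2 a b a' b') u"
  shows "(\<integral>z. u z \<partial>slab2 a b a' b') = (\<integral>q. (\<integral>p. u (p, q) \<partial>slab a b) \<partial>slab a' b')"
  using pair_sigma_finite.integral_snd[OF pair_slab, of a b a' b' "\<lambda>p q. u (p, q)"] assms
  by (simp add: slab2_def)

context matching_system
begin

text \<open>A rank \<open>p\<close> is free if the quantile at \<open>p\<close> lies strictly inside
the region \<open>U\<close> where the equation holds, so that the equation can be used on both sides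
of it.\<close>

definition free :: "(real \<Rightarrow> real) \<Rightarrow> (real \<Rightarrow> bool) \<Rightarrow> real \<Rightarrow> bool" where
  "free f U p \<longleftrightarrow> (\<exists>t. U t \<and> f t < p)"

text \<open>One of two coupled equations, valid on the upward closed set \<open>U\<close>: its
complement is the region cut off by the indicator in type A. A pair \<open>(h\<^sub>j,
h\<^bsub>k-j\<^esub>)\<close> of components of a solution consists of two such responses.\<close>

definition responds :: "(real \<Rightarrow> real) \<Rightarrow> (real \<Rightarrow> real) \<Rightarrow> real \<Rightarrow> real \<Rightarrow> (real \<Rightarrow> bool) \<Rightarrow> bool" where
  "responds f g a b U \<longleftrightarrow> profile f a b \<and> (\<forall>s t. U s \<longrightarrow> s \<le> t \<longrightarrow> U t) \<and>
     (\<forall>t. f t = (if U t then T (K g t) else a))"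

lemma responds_profile: "responds f g a b U \<Longrightarrow> profile f a b"
  and responds_eq: "responds f g a b U \<Longrightarrow> U t \<Longrightarrow> f t = T (K g t)"
  and responds_cut: "responds f g a b U \<Longrightarrow> \<not> U t \<Longrightarrow> f t = a"
  and responds_up: "responds f g a b U \<Longrightarrow> U s \<Longrightarrow> s \<le> t \<Longrightarrow> U t"
  by (auto simp: responds_def)

lemma responds_levels: "responds f g a b U \<Longrightarrow> 0 \<le> a \<and> a < b \<and> b \<le> 1"
  by (auto simp: responds_def profile_def)

lemma free_if_uncut:
  assumes "responds f g a b (\<lambda>_. True)" "a < p"
  shows "free f (\<lambda>_. True) p"
proof -
  have "(f \<longlongrightarrow> a) at_bot" using assms by (auto simp: responds_def profile_def)
  then show ?thesis
    using order_tendstoD(2)[OF _ assms(2)] eventually_happens'[OF trivial_limit_at_bot_linorder]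
    unfolding free_def by blast
qed

lemma responds_uncut:
  assumes "responds f g a b U" "a < p" "p < b"
  shows "U (quantile f p)"
  using assms le_quantile[OF responds_profile[OF assms(1)], of p] responds_cut[OF assms(1)] by fastforce

text \<open>At \<open>t = quantile f p\<close> the equation reads \<open>p \<le> T (K g t)\<close>,
which is turned around by the inverse \<open>\<tau>\<close> of \<open>T\<close>.\<close>

lemma K_quantile_le:
  assumes f: "responds f g a b U" and g: "unit_mono g" and p: "a < p" "p < b"
  shows "K g (quantile f p) \<le> \<tau> p"
proof -
  have "p \<le> f (quantile f p)" by (rule le_quantile[OF responds_profile[OF f] p])
  also have "\<dots> = T (K g (quantile f p))" by (rule responds_eq[OF f responds_uncut[OF f p]])
  finally show ?thesis using responds_levels[OF f] p K_range[OF g] by (intro le_\<tau>) auto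
qed

text \<open>To the left of the quantile the profile is below \<open>p\<close>, so the equation holds
there with the opposite inequality; continuity of \<open>K g\<close> carries it to the quantile.
Together with \<open>K_quantile_le\<close> this is the complementary slackness of the dual matching
problem: there is equality unless the quantile sits at the cut.\<close>

lemma K_quantile_eq:
  assumes f: "responds f g a b U" and g: "unit_mono g" and p: "a < p" "p < b" and fr: "free f U p"
  shows "K g (quantile f p) = \<tau> p"
proof (rule antisym[OF K_quantile_le[OF f g p]])
  let ?X = "quantile f p"
  obtain t0 where t0: "U t0" "f t0 < p" using fr by (auto simp: free_def)
  then have less: "t0 < ?X" using quantile_gt_iff[OF responds_profile[OF f] p] by simp
  show "\<tau> p \<le> K g ?X"
  proof (rule tendsto_lowerbound)
    show "(K g \<longlongrightarrow> K g ?X) (at_left ?X)"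
      using K_cont[OF g, of ?X] by (metis continuous_at_imp_continuous_at_within continuous_within)
    have *: "\<tau> p \<le> K g t" if "t0 < t" "t < ?X" for t
    proof -
      have "f t < p" using that quantile_gt_iff[OF responds_profile[OF f] p] by simp
      then have "T (K g t) \<le> p" using responds_eq[OF f responds_up[OF f t0(1), of t]] that by simp
      then show ?thesis using responds_levels[OF f] p K_range[OF g] by (intro \<tau>_le) auto
    qed
    show "\<forall>\<^sub>F t in at_left ?X. \<tau> p \<le> K g t"
      by (rule eventually_mono[OF eventually_at_left_real[OF less]]) (use * in auto)
  qed auto
qed

lemma integral_slab_\<tau>:
  assumes "0 \<le> a" "a < b" "b \<le> 1" "x \<in> {a..b}"
  shows "(\<integral>p. indicator {..x} p * \<tau> p \<partial>slab a b) = \<Psi> x - \<Psi> a"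
proof -
  have m [measurable]: "\<tau> \<in> borel_measurable (restrict_space borel {0..1})"
    by (intro borel_measurable_continuous_on_restrict \<tau>_cont)
  have "(\<integral>p. indicator {..x} p * \<tau> p \<partial>slab a b) =
      (\<integral>p. indicator {a<..<b} p * (indicator {..x} p * \<tau> p) \<partial>lborel)"
    unfolding slab_def by (subst integral_restrict_space) auto
  also have "\<dots> = (\<integral>p. indicator {a..x} p * \<tau> p \<partial>lborel)"
  proof (rule integral_cong_AE)
    have i: "(\<lambda>p. indicator {0..1} p *\<^sub>R \<tau> p) \<in> borel_measurable borel"
      using m by (subst (asm) borel_measurable_restrict_space_iff) auto
    have "(\<lambda>p. indicator A p * (indicator {0..1} p *\<^sub>R \<tau> p)) \<in> borel_measurable lborel"
      if "A \<in> sets borel" for A using i that by simp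
    note meas = this
    have "(\<lambda>p. indicator {a<..<b} p * (indicator {..x} p * \<tau> p)) =
        (\<lambda>p. indicator ({a<..<b} \<inter> {..x}) p * (indicator {0..1} p *\<^sub>R \<tau> p))"
      "(\<lambda>p. indicator {a..x} p * \<tau> p) = (\<lambda>p. indicator {a..x} p * (indicator {0..1} p *\<^sub>R \<tau> p))"
      using assms by (auto simp: indicator_def)
    then show "(\<lambda>p. indicator {a<..<b} p * (indicator {..x} p * \<tau> p)) \<in> borel_measurable lborel"
      "(\<lambda>p. indicator {a..x} p * \<tau> p) \<in> borel_measurable lborel"
      using meas[of "{a<..<b} \<inter> {..x}"] meas[of "{a..x}"] by simp_all
    show "AE p in lborel. indicator {a<..<b} p * (indicator {..x} p * \<tau> p) = indicator {a..x} p * \<tau> p"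
      using AE_lborel_singleton[of a] AE_lborel_singleton[of b]
      by eventually_elim (use assms in \<open>auto simp: indicator_def\<close>)
  qed
  also have "\<dots> = \<Psi> x - \<Psi> a" using assms by (intro integral_\<tau>) auto
  finally show ?thesis .
qed

lemma K_quantile_measurable:
  assumes "profile f a b" "unit_mono g"
  shows "(\<lambda>p. K g (quantile f p)) \<in> borel_measurable (slab a b)"
proof -
  have "K g \<in> borel_measurable borel"
    using K_cont[OF assms(2)] by (intro borel_measurable_continuous_onI) (auto simp: continuous_at_imp_continuous_on)
  then show ?thesis using quantile_measurable[OF assms(1)] by measurable
qed

text \<open>Integration of \<open>\<tau>\<close> against the signed indicator of the interval
between \<open>x\<close> and \<open>x'\<close>. Going up, complementary slackness gives an equality;
going down, the inequality \<open>K g (quantile f p) \<le> \<tau> p\<close> has the right sign. So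
freeness matters only above \<open>x\<close>.\<close>

lemma \<Psi>_increment_le:
  assumes f: "responds f g a b U" and g: "unit_mono g"
    and x: "x \<in> {a..b}" "x' \<in> {a..b}" and fr: "\<And>p. x < p \<Longrightarrow> p < b \<Longrightarrow> free f U p"
  shows "\<Psi> x' - \<Psi> x \<le>
    (\<integral>p. (indicator {..x'} p - indicator {..x} p) * K g (quantile f p) \<partial>slab a b)"
proof -
  note l = responds_levels[OF f]
  have int\<tau>: "integrable (slab a b) (\<lambda>p. indicator {..y} p * \<tau> p)" for y
  proof (rule finite_measure.integrable_const_bound[OF finite_measure_slab, where B = 1])
    show "AE p in slab a b. norm (indicator {..y} p * \<tau> p) \<le> 1"
      using \<tau>_range l by (intro AE_I2) (auto simp: indicator_def)
    have "\<tau> \<in> borel_measurable (restrict_space borel {a<..<b})"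
      using l by (intro borel_measurable_continuous_on_restrict continuous_on_subset[OF \<tau>_cont]) auto
    then have [measurable]: "\<tau> \<in> borel_measurable (slab a b)" by (simp cong: measurable_cong_sets add: sets_slab)
    show "(\<lambda>p. indicator {..y} p * \<tau> p) \<in> borel_measurable (slab a b)" by measurable
  qed
  have "\<Psi> x' - \<Psi> x = (\<integral>p. indicator {..x'} p * \<tau> p - indicator {..x} p * \<tau> p \<partial>slab a b)"
    using l x by (subst Bochner_Integration.integral_diff[OF int\<tau> int\<tau>]) (simp add: integral_slab_\<tau>)
  also have "\<dots> \<le> (\<integral>p. (indicator {..x'} p - indicator {..x} p) * K g (quantile f p) \<partial>slab a b)"
  proof (rule integral_mono)
    show "integrable (slab a b) (\<lambda>p. (indicator {..x'} p - indicator {..x} p) * K g (quantile f p))"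
    proof (rule slab_integrable[where B = 1])
      show "(\<lambda>p. (indicator {..x'} p - indicator {..x} p) * K g (quantile f p)) \<in> borel_measurable (slab a b)"
        using K_quantile_measurable[OF responds_profile[OF f] g] by measurable
      show "\<bar>(indicator {..x'} p - indicator {..x} p) * K g (quantile f p)\<bar> \<le> 1" for p
        using K_range[OF g, of "quantile f p"] by (auto simp: indicator_def)
    qed
    show "indicator {..x'} p * \<tau> p - indicator {..x} p * \<tau> p
        \<le> (indicator {..x'} p - indicator {..x} p) * K g (quantile f p)"
      if "p \<in> space (slab a b)" for p
      using that K_quantile_le[OF f g, of p] K_quantile_eq[OF f g, of p] fr[of p]
      by (auto simp: indicator_def)
  qed (intro Bochner_Integration.integrable_diff int\<tau>)
  finally show ?thesis .
qed

lemma kernel_measurable [measurable]: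
  assumes "profile f a b" "profile g a' b'"
  shows "(\<lambda>z. S (quantile f (fst z) + quantile g (snd z))) \<in> borel_measurable (slab2 a b a' b')"
proof -
  note quantile_measurable[OF assms(1), measurable] quantile_measurable[OF assms(2), measurable]
  show ?thesis by measurable
qed

lemma abs_mult_S_le: "\<bar>u\<bar> \<le> B \<Longrightarrow> \<bar>u * S s\<bar> \<le> B"
  using S_range[of s] mult_mono[of "\<bar>u\<bar>" B "S s" 1] by (auto simp: abs_mult)

lemma kernel_marginal_fst:
  assumes f: "profile f a b" and g: "profile g a' b'"
    and u: "u \<in> borel_measurable (slab a b)" "\<And>p. \<bar>u p\<bar> \<le> B"
  shows "(\<integral>z. u (fst z) * S (quantile f (fst z) + quantile g (snd z)) \<partial>slab2 a b a' b')
    = (\<integral>p. u p * (K g (quantile f p) - a') \<partial>slab a b)"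
proof -
  note u(1)[measurable] kernel_measurable[OF f g, measurable]
  have "integrable (slab2 a b a' b') (\<lambda>z. u (fst z) * S (quantile f (fst z) + quantile g (snd z)))"
    by (rule slab2_integrable[where B = B]) (auto intro: abs_mult_S_le u(2))
  then show ?thesis by (simp add: integral_slab2_fst integral_S_quantile[OF g])
qed

lemma kernel_marginal_snd:
  assumes f: "profile f a b" and g: "profile g a' b'"
    and v: "v \<in> borel_measurable (slab a' b')" "\<And>q. \<bar>v q\<bar> \<le> B"
  shows "(\<integral>z. v (snd z) * S (quantile f (fst z) + quantile g (snd z)) \<partial>slab2 a b a' b')
    = (\<integral>q. v q * (K f (quantile g q) - a) \<partial>slab a' b')"
proof -
  note v(1)[measurable] kernel_measurable[OF f g, measurable]
  have "integrable (slab2 a b a' b') (\<lambda>z. v (snd z) * S (quantile f (fst z) + quantile g (snd z)))"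
    by (rule slab2_integrable[where B = B]) (auto intro: abs_mult_S_le v(2))
  moreover have "(\<integral>p. S (quantile f p + x) \<partial>slab a b) = K f x - a" for x
    using integral_S_quantile[OF f, of x] by (simp add: add.commute)
  ultimately show ?thesis by (simp add: integral_slab2_snd)
qed

text \<open>The amount by which the kernel differs from \<open>1\<close> on the lower left quadrant
at \<open>(x, y)\<close>, and from \<open>0\<close> on the upper right one.\<close>

definition defect :: "(real \<Rightarrow> real) \<Rightarrow> (real \<Rightarrow> real) \<Rightarrow> real \<Rightarrow> real \<Rightarrow> real \<times> real \<Rightarrow> real" where
  "defect f g x y z =
     indicator {..x} (fst z) * indicator {..y} (snd z) * (1 - S (quantile f (fst z) + quantile g (snd z)))
   + (1 - indicator {..x} (fst z)) * (1 - indicator {..y} (snd z)) * S (quantile f (fst z) + quantile g (snd z))"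

text \<open>The energy difference is bounded by integrals of the kernel over strips. With \<open>i,
j\<close> and \<open>i', j'\<close> the indicators of \<open>p \<le> x\<close>, \<open>q \<le>
y\<close> and of \<open>p \<le> x'\<close>, \<open>q \<le> y'\<close>, and \<open>k\<close> the
kernel, what remains is the pointwise inequality \<open>k * (i' + j' - 1) \<le> i' * j'\<close>,
which holds for every \<open>k\<close> between \<open>0\<close> and \<open>1\<close>.\<close>

lemma energy_near_maximal:
  assumes f: "responds f g a b U" and g: "responds g f a' b' U'"
    and x: "x \<in> {a..b}" "x' \<in> {a..b}" and y: "y \<in> {a'..b'}" "y' \<in> {a'..b'}"
    and fr: "\<And>p. x < p \<Longrightarrow> p < b \<Longrightarrow> free f U p"
    and fr': "\<And>q. y < q \<Longrightarrow> q < b' \<Longrightarrow> free g U' q"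
  shows "energy x' y' \<le> energy x y + (\<integral>z. defect f g x y z \<partial>slab2 a b a' b')"
proof -
  note pf = responds_profile[OF f] and pg = responds_profile[OF g]
  note uf = profile_unit_mono[OF pf] and ug = profile_unit_mono[OF pg]
  note l = responds_levels[OF f] and l' = responds_levels[OF g]
  note kernel_measurable[OF pf pg, measurable]
  let ?P = "slab2 a b a' b'"
  let ?k = "\<lambda>z. S (quantile f (fst z) + quantile g (snd z))"
  define i :: "real \<Rightarrow> real \<Rightarrow> real" where "i x p = indicator {..x} p" for x p
  have [measurable]: "i x \<in> borel_measurable (slab c d)" for x c d
    unfolding i_def by measurable
  have i01: "i x p = 0 \<or> i x p = 1" for x p by (auto simp: i_def indicator_def)
  have inti: "(\<integral>p. i x p \<partial>slab c d) = x - c" if "c < d" "x \<in> {c..d}" for x c d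
    using integral_slab_indicator[OF that] by (simp add: i_def[abs_def])
  have integ_i: "integrable (slab c d) (i x)" for x c d
    by (rule slab_integrable[where B = 1]) (use i01[of x] in \<open>auto simp: i_def indicator_def\<close>)
  have integ: "integrable ?P (\<lambda>z. (i x' (fst z) - i x (fst z)) * ?k z)"
    "integrable ?P (\<lambda>z. (i y' (snd z) - i y (snd z)) * ?k z)"
    by (rule slab2_integrable[where B = 1], measurable,
        rule abs_mult_S_le, simp add: i_def indicator_def)+
  have integ2: "integrable ?P (\<lambda>z. i x (fst z) * i y (snd z))" for x y
    by (rule slab2_integrable[where B = 1]) (auto simp: i_def indicator_def)
  have intij: "(\<integral>z. i x (fst z) * i y (snd z) \<partial>?P) = (x - a) * (y - a')"
    if "x \<in> {a..b}" "y \<in> {a'..b'}" for x y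
    using that l l' by (subst integral_slab2_fst[OF integ2]) (simp add: inti)
  have split: "(\<integral>p. (i r' p - i r p) * (B p - e) \<partial>slab c d) = (\<integral>p. (i r' p - i r p) * B p \<partial>slab c d) - e * (r' - r)"
    if B: "B \<in> borel_measurable (slab c d)" "\<And>p. B p \<in> {0..1}" and "c < d" "r \<in> {c..d}" "r' \<in> {c..d}"
    for r r' B e c d
  proof -
    have 1: "integrable (slab c d) (\<lambda>p. (i r' p - i r p) * B p)"
      by (rule slab_integrable[where B = 1]) (use B in \<open>auto simp: i_def indicator_def\<close>)
    have "(\<integral>p. (i r' p - i r p) * (B p - e) \<partial>slab c d)
      = (\<integral>p. (i r' p - i r p) * B p - e * (i r' p - i r p) \<partial>slab c d)"
      by (simp add: algebra_simps)
    also have "\<dots> = (\<integral>p. (i r' p - i r p) * B p \<partial>slab c d) - e * (\<integral>p. (i r' p - i r p) \<partial>slab c d)"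
      using 1 integ_i by (subst Bochner_Integration.integral_diff) auto
    also have "(\<integral>p. (i r' p - i r p) \<partial>slab c d) = r' - r"
      using that integ_i inti[of c d r] inti[of c d r'] by (subst Bochner_Integration.integral_diff) auto
    finally show ?thesis .
  qed
  have A: "\<Psi> x' - \<Psi> x \<le> (\<integral>z. (i x' (fst z) - i x (fst z)) * ?k z \<partial>?P) + a' * (x' - x)"
  proof -
    have "\<Psi> x' - \<Psi> x \<le> (\<integral>p. (i x' p - i x p) * K g (quantile f p) \<partial>slab a b)"
      unfolding i_def by (rule \<Psi>_increment_le[OF f ug x fr])
    also have "\<dots> = (\<integral>p. (i x' p - i x p) * (K g (quantile f p) - a') \<partial>slab a b) + a' * (x' - x)"
      using l x K_range[OF ug] K_quantile_measurable[OF pf ug] by (subst split) auto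
    also have "(\<integral>p. (i x' p - i x p) * (K g (quantile f p) - a') \<partial>slab a b) =
        (\<integral>z. (i x' (fst z) - i x (fst z)) * ?k z \<partial>?P)"
      by (rule kernel_marginal_fst[OF pf pg, symmetric, where B = 1]) (auto simp: i_def indicator_def)
    finally show ?thesis .
  qed
  have B: "\<Psi> y' - \<Psi> y \<le> (\<integral>z. (i y' (snd z) - i y (snd z)) * ?k z \<partial>?P) + a * (y' - y)"
  proof -
    have "\<Psi> y' - \<Psi> y \<le> (\<integral>p. (i y' p - i y p) * K f (quantile g p) \<partial>slab a' b')"
      unfolding i_def by (rule \<Psi>_increment_le[OF g uf y fr'])
    also have "\<dots> = (\<integral>p. (i y' p - i y p) * (K f (quantile g p) - a) \<partial>slab a' b') + a * (y' - y)"
      using l' y K_range[OF uf] K_quantile_measurable[OF pg uf] by (subst split) auto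
    also have "(\<integral>p. (i y' p - i y p) * (K f (quantile g p) - a) \<partial>slab a' b') =
        (\<integral>z. (i y' (snd z) - i y (snd z)) * ?k z \<partial>?P)"
      by (rule kernel_marginal_snd[OF pf pg, symmetric, where B = 1]) (auto simp: i_def indicator_def)
    finally show ?thesis .
  qed
  have "energy x' y' - energy x y \<le> (\<integral>z. (i x' (fst z) - i x (fst z)) * ?k z \<partial>?P)
      + (\<integral>z. (i y' (snd z) - i y (snd z)) * ?k z \<partial>?P)
      - (\<integral>z. i x' (fst z) * i y' (snd z) \<partial>?P) + (\<integral>z. i x (fst z) * i y (snd z) \<partial>?P)"
    using A B intij[OF x(1) y(1)] intij[OF x(2) y(2)] by (simp add: energy_def algebra_simps)
  also have "\<dots> = (\<integral>z. (i x' (fst z) - i x (fst z)) * ?k z + (i y' (snd z) - i y (snd z)) * ?k z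
      - i x' (fst z) * i y' (snd z) + i x (fst z) * i y (snd z) \<partial>?P)"
    using integ integ2 by simp
  also have "\<dots> \<le> (\<integral>z. defect f g x y z \<partial>?P)"
  proof (rule integral_mono)
    show "integrable ?P (\<lambda>z. (i x' (fst z) - i x (fst z)) * ?k z + (i y' (snd z) - i y (snd z)) * ?k z
      - i x' (fst z) * i y' (snd z) + i x (fst z) * i y (snd z))"
      using integ integ2 by simp
    have "\<bar>defect f g x y z\<bar> \<le> 1" for z
      using S_range[of "quantile f (fst z) + quantile g (snd z)"] by (auto simp: defect_def indicator_def)
    then show "integrable ?P (\<lambda>z. defect f g x y z)"
      by (rule slab2_integrable[rotated]) (simp add: defect_def[abs_def] flip: i_def)
    show "(i x' (fst z) - i x (fst z)) * ?k z + (i y' (snd z) - i y (snd z)) * ?k z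
      - i x' (fst z) * i y' (snd z) + i x (fst z) * i y (snd z) \<le> defect f g x y z" for z
      using S_range[of "quantile f (fst z) + quantile g (snd z)"]
      by (auto simp: defect_def i_def indicator_def)
  qed
  finally show ?thesis by simp
qed

text \<open>At the corner \<open>(b, a')\<close> every rank \<open>p\<close> is at most
\<open>b\<close> and no rank \<open>q\<close> is at most \<open>a'\<close>, so both quadrants in the
defect are empty.\<close>

lemma energy_corner_maximal:
  assumes f: "responds f g a b U" and g: "responds g f a' b' U'"
    and x: "x' \<in> {a..b}" "y' \<in> {a'..b'}"
    and fr': "\<And>q. a' < q \<Longrightarrow> q < b' \<Longrightarrow> free g U' q"
  shows "energy x' y' \<le> energy b a'"
proof -
  have "(\<integral>z. defect f g b a' z \<partial>slab2 a b a' b') = (\<integral>z. 0 \<partial>slab2 a b a' b')"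
    by (intro Bochner_Integration.integral_cong) (auto simp: defect_def indicator_def)
  then show ?thesis
    using energy_near_maximal[OF f g, of b x' a' y'] x responds_levels[OF f] responds_levels[OF g] fr' by auto
qed

text \<open>If \<open>m\<close> barely grows between \<open>s\<close> and \<open>s'\<close>, where
\<open>s + r\<close> is far to the left and \<open>s' + r\<close> far to the right, the kernel is
nearly \<open>1\<close> on one quadrant at \<open>(m s, m r)\<close> and nearly \<open>0\<close> on
the other.\<close>

lemma energy_plateau:
  assumes m: "responds m m 0 1 U" and U: "U s" "U r" and s: "s \<le> s'"
    and x: "x' \<in> {0..1}" "y' \<in> {0..1}"
  shows "energy x' y' \<le> energy (m s) (m r) + (1 - S (s + r)) + S (s' + r) + (m s' - m s)"
proof -
  note pm = responds_profile[OF m]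
  have mb: "m t \<in> {0..1}" for t using profile_bounds[OF pm] by auto
  note quantile_measurable[OF pm, measurable]
  let ?P = "slab2 0 1 0 1"
  let ?e = "\<lambda>z. (1 - S (s + r)) + S (s' + r) + (indicator {..m s'} (fst z) - indicator {..m s} (fst z))"
  have i: "integrable ?P (\<lambda>z. indicator {..m t} (fst z) :: real)" for t
    by (rule slab2_integrable[where B = 1]) (auto simp: indicator_def)
  have ic: "integrable ?P (\<lambda>z. c :: real)" for c
    by (rule slab2_integrable[where B = "\<bar>c\<bar>"]) auto
  have one: "measure (slab 0 1) {0<..<1} = 1"
    by (simp add: measure_def emeasure_slab)
  have one2: "measure ?P ({0<..<1} \<times> {0<..<1}) = 1"
    using integral_slab2_fst[OF ic[of 1]] by (simp add: one)
  have "(\<integral>z. defect m m (m s) (m r) z \<partial>?P) \<le> (\<integral>z. ?e z \<partial>?P)"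
  proof (rule integral_mono)
    have "\<bar>defect m m x y z\<bar> \<le> 1" for z x y
      using S_range[of "quantile m (fst z) + quantile m (snd z)"] by (auto simp: defect_def indicator_def)
    then show "integrable ?P (\<lambda>z. defect m m (m s) (m r) z)"
      by (rule slab2_integrable[rotated]) (simp add: defect_def[abs_def])
    show "integrable ?P ?e" using i ic by auto
    fix z assume "z \<in> space ?P"
    then obtain p q where z: "z = (p, q)" "0 < p" "p < 1" "0 < q" "q < 1" by auto
    note Q = quantile_le_iff[OF pm z(2,3)] quantile_le_iff[OF pm z(4,5)]
    have 1: "1 - S (quantile m p + quantile m q) \<le> 1 - S (s + r)" if "p \<le> m s" "q \<le> m r"
      using that Q by (intro diff_left_mono S_antimono add_mono) auto
    have 2: "S (quantile m p + quantile m q) \<le> S (s' + r)" if "\<not> p \<le> m s'" "\<not> q \<le> m r"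
      using that Q(1)[of s'] Q(2)[of r] by (intro S_antimono add_mono) auto
    have 3: "m s \<le> m s'" using s pm by (auto simp: profile_def dest: monoD)
    show "defect m m (m s) (m r) z \<le> ?e z"
      using 1 2 3 S_range[of "quantile m p + quantile m q"] S_range[of "s + r"] S_range[of "s' + r"]
      by (auto simp: z(1) defect_def indicator_def)
  qed
  also have "\<dots> = (1 - S (s + r)) + S (s' + r) + (m s' - m s)"
  proof -
    have "(\<integral>z. indicator {..m t} (fst z) \<partial>?P) = m t" for t
      by (subst integral_slab2_fst[OF i])
         (use integral_slab_indicator[of 0 1 "m t"] mb[of t] one in simp)
    then show ?thesis using i ic one2 by simp
  qed
  finally have d: "(\<integral>z. defect m m (m s) (m r) z \<partial>?P) \<le> (1 - S (s + r)) + S (s' + r) + (m s' - m s)" .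
  have "energy x' y' \<le> energy (m s) (m r) + (\<integral>z. defect m m (m s) (m r) z \<partial>?P)"
    using x mb U by (intro energy_near_maximal[OF m m]) (auto simp: free_def)
  then show ?thesis using d by simp
qed

section \<open>Comparison of two solutions\<close>

text \<open>Complementary slackness fixes the sign of the marginals: where \<open>X' p > X
p\<close>, the rank \<open>p\<close> is free for the second solution, whose marginal is then the
maximal value \<open>\<tau> p\<close>; the opposite case is symmetric. So the pairing of the kernel
difference with \<open>arctan (X' p - X p) + arctan (Y' q - Y q)\<close> is at most
\<open>0\<close>. But its integrand is at least \<open>0\<close>, since \<open>arctan\<close> is odd
and increasing and the kernel decreases in the sum of the quantiles.\<close>

lemma kernels_agree:
  assumes f: "responds f g a b U" and g: "responds g f a' b' U'"
    and f': "responds f' g' a b U" and g': "responds g' f' a' b' U'"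
  shows "AE z in slab2 a b a' b'. S (quantile f (fst z) + quantile g (snd z))
     = S (quantile f' (fst z) + quantile g' (snd z))"
proof -
  note p = responds_profile[OF f] responds_profile[OF g] responds_profile[OF f'] responds_profile[OF g']
  note um = p[THEN profile_unit_mono]
  note p[THEN quantile_measurable, measurable]
  let ?P = "slab2 a b a' b'"
  let ?k = "\<lambda>z. S (quantile f (fst z) + quantile g (snd z))"
  let ?k' = "\<lambda>z. S (quantile f' (fst z) + quantile g' (snd z))"
  let ?D = "\<lambda>p. arctan (quantile f' p - quantile f p)"
  let ?E = "\<lambda>q. arctan (quantile g' q - quantile g q)"
  have arctan_bd: "\<bar>arctan x\<bar> \<le> 2" for x
    using arctan_bounded[of x] pi_less_4 by auto
  have mD: "?D \<in> borel_measurable (slab a b)" by measurable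
  have mE: "?E \<in> borel_measurable (slab a' b')" by measurable
  note mD[measurable] mE[measurable]
  have one_sided: "(\<integral>p. arctan (quantile h' p - quantile h p) * (K k (quantile h p) - e) \<partial>slab c d)
     - (\<integral>p. arctan (quantile h' p - quantile h p) * (K k' (quantile h' p) - e) \<partial>slab c d) \<le> 0"
    if h: "responds h k c d V" and h': "responds h' k' c d V" and k: "unit_mono k" "unit_mono k'" for h k c d V h' k' e
  proof -
    let ?u = "\<lambda>p. arctan (quantile h' p - quantile h p)"
    note ph = responds_profile[OF h] responds_profile[OF h']
    note ph[THEN quantile_measurable, measurable]
    note K_quantile_measurable[OF ph(1) k(1), measurable] K_quantile_measurable[OF ph(2) k(2), measurable]
    have mu [measurable]: "?u \<in> borel_measurable (slab c d)"
      by measurable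
    have I: "integrable (slab c d) (\<lambda>p. ?u p * (F p - e))"
      if "F \<in> borel_measurable (slab c d)" "\<And>p. F p \<in> {0..1}" for F
    proof (rule slab_integrable[where B = "2 * (1 + \<bar>e\<bar>)"])
      show "\<bar>?u p * (F p - e)\<bar> \<le> 2 * (1 + \<bar>e\<bar>)" for p
        unfolding abs_mult using that(2)[of p] arctan_bd by (intro mult_mono) auto
    qed (use that in measurable)
    have "(\<integral>p. ?u p * (K k (quantile h p) - e) \<partial>slab c d)
      - (\<integral>p. ?u p * (K k' (quantile h' p) - e) \<partial>slab c d)
      = (\<integral>p. ?u p * (K k (quantile h p) - e) - ?u p * (K k' (quantile h' p) - e) \<partial>slab c d)"
      using K_range[OF k(1)] K_range[OF k(2)]
      by (intro Bochner_Integration.integral_diff[symmetric] I) auto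
    also have "\<dots> = (\<integral>p. ?u p * (K k (quantile h p) - K k' (quantile h' p)) \<partial>slab c d)"
      by (simp add: algebra_simps)
    also have "\<dots> = - (\<integral>p. - (?u p * (K k (quantile h p) - K k' (quantile h' p))) \<partial>slab c d)"
      by simp
    also have "\<dots> \<le> 0"
    proof (subst neg_le_0_iff_le, rule Bochner_Integration.integral_nonneg)
      fix p assume "p \<in> space (slab c d)"
      then have p: "c < p" "p < d" by auto
      have le: "K k (quantile h p) \<le> \<tau> p" "K k' (quantile h' p) \<le> \<tau> p"
        by (rule K_quantile_le[OF h k(1) p], rule K_quantile_le[OF h' k(2) p])
      consider "quantile h p < quantile h' p" | "quantile h' p < quantile h p" | "quantile h p = quantile h' p"
        by linarith
      then show "0 \<le> - (?u p * (K k (quantile h p) - K k' (quantile h' p)))"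
      proof cases
        case 1
        then have "free h' V p"
          using responds_uncut[OF h p] quantile_gt_iff[OF ph(2) p] by (auto simp: free_def)
        then have "K k (quantile h p) \<le> K k' (quantile h' p)"
          using K_quantile_eq[OF h' k(2) p] le by simp
        moreover have "0 \<le> ?u p" using 1 by simp
        ultimately show ?thesis by (simp add: mult_nonneg_nonpos)
      next
        case 2
        then have "free h V p"
          using responds_uncut[OF h' p] quantile_gt_iff[OF ph(1) p] by (auto simp: free_def)
        then have "K k' (quantile h' p) \<le> K k (quantile h p)"
          using K_quantile_eq[OF h k(1) p] le by simp
        moreover have "?u p \<le> 0" using 2 by simp
        ultimately show ?thesis by (simp add: mult_nonpos_nonneg)
      qed simp
    qed
    finally show ?thesis .
  qed
  let ?w = "\<lambda>z. (?k z - ?k' z) * (?D (fst z) + ?E (snd z))"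
  have integ: "integrable ?P (\<lambda>z. ?D (fst z) * ?k z)" "integrable ?P (\<lambda>z. ?D (fst z) * ?k' z)"
    "integrable ?P (\<lambda>z. ?E (snd z) * ?k z)" "integrable ?P (\<lambda>z. ?E (snd z) * ?k' z)"
    by (rule slab2_integrable[where B = 2], measurable, rule abs_mult_S_le, rule arctan_bd)+
  have w_eq: "?w z = ?D (fst z) * ?k z - ?D (fst z) * ?k' z + (?E (snd z) * ?k z - ?E (snd z) * ?k' z)" for z
    by (simp add: algebra_simps)
  have w_int: "integrable ?P ?w" unfolding w_eq using integ by auto
  have "(\<integral>z. ?w z \<partial>?P) = ((\<integral>z. ?D (fst z) * ?k z \<partial>?P) - (\<integral>z. ?D (fst z) * ?k' z \<partial>?P))
     + ((\<integral>z. ?E (snd z) * ?k z \<partial>?P) - (\<integral>z. ?E (snd z) * ?k' z \<partial>?P))"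
    unfolding w_eq using integ by simp
  also have "\<dots> \<le> 0"
    using one_sided[OF f f' um(2,4), of a'] one_sided[OF g g' um(1,3), of a]
    using kernel_marginal_fst[OF p(1,2) mD arctan_bd] kernel_marginal_fst[OF p(3,4) mD arctan_bd]
      kernel_marginal_snd[OF p(1,2) mE arctan_bd] kernel_marginal_snd[OF p(3,4) mE arctan_bd]
    by simp
  finally have le0: "(\<integral>z. ?w z \<partial>?P) \<le> 0" .
  have pos: "0 \<le> ?w z" and zero: "?w z = 0 \<longrightarrow> ?k z = ?k' z" for z
  proof -
    let ?a = "quantile f (fst z) + quantile g (snd z)" and ?b = "quantile f' (fst z) + quantile g' (snd z)"
    have E: "- ?E (snd z) = arctan (quantile g (snd z) - quantile g' (snd z))"
      by (subst arctan_minus[symmetric]) simp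
    consider "?a < ?b" | "?b < ?a" | "?a = ?b" by linarith
    then have "0 \<le> ?w z \<and> (?w z = 0 \<longrightarrow> ?k z = ?k' z)"
    proof cases
      case 1
      then have "arctan (quantile g (snd z) - quantile g' (snd z)) < ?D (fst z)"
        by (simp add: arctan_less_iff)
      then have "0 < ?D (fst z) + ?E (snd z)" using E by linarith
      moreover have "?k' z \<le> ?k z" using 1 by (intro S_antimono) simp
      ultimately show ?thesis by auto
    next
      case 2
      then have "?D (fst z) < arctan (quantile g (snd z) - quantile g' (snd z))"
        by (simp add: arctan_less_iff)
      then have "?D (fst z) + ?E (snd z) < 0" using E by linarith
      moreover have "?k z \<le> ?k' z" using 2 by (intro S_antimono) simp
      ultimately show ?thesis by (auto intro: mult_nonpos_nonpos)
    qed auto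
    then show "0 \<le> ?w z" "?w z = 0 \<longrightarrow> ?k z = ?k' z" by blast+
  qed
  have "(\<integral>z. ?w z \<partial>?P) = 0"
    using le0 pos by (intro antisym) (auto intro!: Bochner_Integration.integral_nonneg)
  then have "AE z in ?P. ?w z = 0"
    using integral_nonneg_eq_0_iff_AE[OF w_int] pos by auto
  then show ?thesis by eventually_elim (use zero in blast)
qed

end

section \<open>Existence of a solution with a cut\<close>

lemma slab_AE_witness:
  assumes "AE p in slab a b. Q p" "a \<le> c" "c < d" "d \<le> b"
  obtains p where "c < p" "p < d" "Q p"
proof -
  have "\<exists>p. c < p \<and> p < d \<and> Q p"
  proof (rule ccontr)
    assume no: "\<not> ?thesis"
    have "AE p in slab a b. \<not> (c < p \<and> p < d)"
      by (rule eventually_mono[OF assms(1)]) (use no in auto)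
    moreover have cd: "{p \<in> space (slab a b). \<not> \<not> (c < p \<and> p < d)} = {c<..<d}" using assms by auto
    moreover have "{c<..<d} \<in> sets (slab a b)"
      using assms by (auto simp: sets_slab sets_restrict_space intro!: image_eqI[of _ _ "{c<..<d}"])
    ultimately have "emeasure (slab a b) {c<..<d} = 0"
      by (subst (asm) AE_iff_measurable[OF _ cd]) auto
    then have "emeasure lborel {c<..<d} = 0"
      using assms by (subst (asm) emeasure_slab) auto
    then show False using assms by simp
  qed
  then show ?thesis using that by blast
qed

context matching_system
begin

lemma TK_unit: "unit_mono h \<Longrightarrow> T (K h t) \<in> {0..1}"
  using K_range T_range by blast

lemma TK_mono: "unit_mono h \<Longrightarrow> s \<le> t \<Longrightarrow> T (K h s) \<le> T (K h t)"
  using K_range[of h] K_antimono[of h s t] by (intro T_le) auto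

lemma rcont_cut:
  assumes "unit_mono g"
  shows "continuous (at_right t) (\<lambda>t. if l \<le> t then T (K g t) else c)"
proof (cases "l \<le> t")
  case True
  have "((\<lambda>t. T (K g t)) \<longlongrightarrow> T (K g t)) (at_right t)"
    using TK_cont[OF assms, of t] by (metis continuous_at_imp_continuous_at_within continuous_within)
  then have "((\<lambda>t. if l \<le> t then T (K g t) else c) \<longlongrightarrow> T (K g t)) (at_right t)"
    by (rule Lim_transform_eventually) (use True in \<open>auto simp: eventually_at_filter\<close>)
  then show ?thesis using True by (simp add: continuous_within)
next
  case False
  have "((\<lambda>t. if l \<le> t then T (K g t) else c) \<longlongrightarrow> c) (at_right t)"
    by (rule tendsto_eventually, rule eventually_mono[OF eventually_at_right_real[of t l]])
       (use False in auto)
  then show ?thesis using False by (simp add: continuous_within)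
qed

lemma TK_at_top:
  assumes "unit_mono g" "(g \<longlongrightarrow> y) at_bot"
  shows "((\<lambda>t. T (K g t)) \<longlongrightarrow> T y) at_top"
proof (rule T_tendsto[OF K_at_top[OF assms]])
  have "y \<le> g 0" "0 \<le> y"
    using assms mono_ge_limit_at_bot[of g y 0]
    by (auto simp: unit_mono_def intro!: tendsto_lowerbound[OF assms(2)] always_eventually)
  then show "y \<in> {0..1}" using assms(1) by (auto simp: unit_mono_def intro: order_trans)
qed (use K_range assms in blast)

lemma TK_at_bot:
  assumes "unit_mono g" "(g \<longlongrightarrow> y) at_top"
  shows "((\<lambda>t. T (K g t)) \<longlongrightarrow> T y) at_bot"
proof (rule T_tendsto[OF K_at_bot[OF assms]])
  have "g 0 \<le> y" "y \<le> 1"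
    using assms mono_le_limit_at_top[of g y 0]
    by (auto simp: unit_mono_def intro!: tendsto_upperbound[OF assms(2)] always_eventually)
  then show "y \<in> {0..1}" using assms(1) by (auto simp: unit_mono_def intro: order_trans)
qed (use K_range assms in blast)

lemma responds_cutI:
  assumes f: "\<And>t. f t = (if l \<le> t then T (K g t) else 0)"
    and g: "unit_mono g" "(g \<longlongrightarrow> y) at_bot" and y: "0 < T y"
  shows "responds f g 0 (T y) (\<lambda>t. l \<le> t)"
proof -
  have feq: "f = (\<lambda>t. if l \<le> t then T (K g t) else 0)" using f by auto
  have "mono f"
    using TK_mono[OF g(1)] TK_unit[OF g(1)] by (force intro!: monoI simp: f)
  moreover have "(f \<longlongrightarrow> 0) at_bot"
    by (rule tendsto_eventually) (auto simp: f eventually_at_bot_linorder intro!: exI[of _ "l - 1"])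
  moreover have top: "(f \<longlongrightarrow> T y) at_top"
    by (rule Lim_transform_eventually[OF TK_at_top[OF g]])
       (auto simp: f eventually_at_top_linorder intro!: exI[of _ l])
  moreover have "T y \<le> 1"
    by (rule tendsto_upperbound[OF top]) (use TK_unit[OF g(1)] in \<open>auto simp: f\<close>)
  ultimately show ?thesis
    using y rcont_cut[OF g(1)] by (auto simp: responds_def profile_def feq)
qed

text \<open>The right-hand side of the equation reverses the order, so its even iterates starting
from \<open>0\<close> increase and its odd ones decrease. The two limits are mapped to each
other.\<close>

lemma exists_alternating_solution:
  fixes l :: real
  obtains a b where "responds a b 0 1 (\<lambda>t. l \<le> t)" "responds b a 0 1 (\<lambda>t. l \<le> t)"
proof -
  define P where "P h t = (if l \<le> t then T (K h t) else 0)" for h t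
  have um: "unit_mono (P h)" if "unit_mono h" for h
    using TK_mono[OF that] TK_unit[OF that] by (force simp: unit_mono_def P_def intro!: monoI)
  have anti: "P h' t \<le> P h t" if "unit_mono h" "unit_mono h'" "\<And>t. h t \<le> h' t" for h h' t
    using K_le[OF that] K_range[OF that(1)] K_range[OF that(2)] by (auto simp: P_def intro!: T_le)
  define A where "A n = ((P \<circ> P) ^^ n) (\<lambda>_. 0)" for n
  define B where "B n = P (A n)" for n
  have A0: "A 0 = (\<lambda>_. 0)" and ASuc: "A (Suc n) = P (B n)" for n by (auto simp: A_def B_def)
  have uA: "unit_mono (A n)" for n
    by (induction n) (auto simp: A0 ASuc B_def um unit_mono_def[of "\<lambda>_. 0"] mono_def)
  have uB: "unit_mono (B n)" for n by (simp add: B_def um uA)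
  have incA: "A n t \<le> A (Suc n) t" and decB: "B (Suc n) t \<le> B n t" for n t
  proof (induction n arbitrary: t)
    case 0
    { case 1 show ?case using uA[of "Suc 0"] by (auto simp: A0 unit_mono_def) }
    note * = this
    { case 2 show ?case unfolding B_def using uA * by (intro anti) auto }
  next
    case (Suc n)
    { case 1 show ?case unfolding ASuc[of "Suc n"] ASuc[of n] using uB Suc(2) by (intro anti) auto }
    note * = this
    { case 2 show ?case unfolding B_def using uA * by (intro anti) auto }
  qed
  have "convergent (\<lambda>n. A n t)" for t
    by (rule Bseq_monoseq_convergent)
       (use uA incA in \<open>auto simp: unit_mono_def monoseq_Suc intro!: BseqI'[of _ 1]\<close>)
  then have "\<forall>t. \<exists>l. (\<lambda>n. A n t) \<longlonglongrightarrow> l" by (simp add: convergent_def)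
  from choice[OF this] obtain a where a: "\<And>t. (\<lambda>n. A n t) \<longlonglongrightarrow> a t" by blast
  have "convergent (\<lambda>n. B n t)" for t
    by (rule Bseq_monoseq_convergent)
       (use uB decB in \<open>auto simp: unit_mono_def monoseq_Suc intro!: BseqI'[of _ 1]\<close>)
  then have "\<forall>t. \<exists>l. (\<lambda>n. B n t) \<longlonglongrightarrow> l" by (simp add: convergent_def)
  from choice[OF this] obtain b where b: "\<And>t. (\<lambda>n. B n t) \<longlonglongrightarrow> b t" by blast
  have lim_um: "unit_mono h" if "\<And>n. unit_mono (H n)" "\<And>t. (\<lambda>n. H n t) \<longlonglongrightarrow> h t" for H h
    unfolding unit_mono_def
  proof (intro conjI allI monoI)
    show "h x \<le> h y" if "x \<le> y" for x y
      by (rule LIMSEQ_le[OF \<open>\<And>t. (\<lambda>n. H n t) \<longlonglongrightarrow> h t\<close> \<open>\<And>t. (\<lambda>n. H n t) \<longlonglongrightarrow> h t\<close>])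
         (use \<open>\<And>n. unit_mono (H n)\<close> \<open>x \<le> y\<close> in \<open>auto simp: unit_mono_def dest: monoD\<close>)
    show "0 \<le> h t" "h t \<le> 1" for t
      using that(1) by (auto simp: unit_mono_def intro!: LIMSEQ_le_const[OF that(2)] LIMSEQ_le_const2[OF that(2)])
  qed
  have ua: "unit_mono a" and ub: "unit_mono b" using lim_um uA uB a b by blast+
  have lim: "(\<lambda>n. P (H n) t) \<longlonglongrightarrow> P h t"
    if "\<And>n. unit_mono (H n)" "unit_mono h" "\<And>t. (\<lambda>n. H n t) \<longlonglongrightarrow> h t" for H h t
  proof -
    have "(\<lambda>n. K (H n) (t - 0)) \<longlonglongrightarrow> K h t"
      using that by (intro K_limit[where C = "{}"]) auto
    then have "(\<lambda>n. T (K (H n) t)) \<longlonglongrightarrow> T (K h t)"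
      using K_range that(1,2) by (intro T_tendsto) auto
    then show ?thesis by (simp add: P_def)
  qed
  have "b t = P a t" for t
    using LIMSEQ_unique[OF b lim[OF uA ua a, folded B_def]] .
  moreover have "a t = P b t" for t
    using LIMSEQ_unique[OF LIMSEQ_Suc[OF a] lim[OF uB ub b, of t, folded ASuc]] .
  ultimately have ab: "b t = (if l \<le> t then T (K a t) else 0)" "a t = (if l \<le> t then T (K b t) else 0)" for t
    by (auto simp: P_def)
  have bot: "(a \<longlongrightarrow> 0) at_bot" "(b \<longlongrightarrow> 0) at_bot"
    by (rule tendsto_eventually, auto simp: ab eventually_at_bot_linorder intro!: exI[of _ "l - 1"])+
  show ?thesis
    using that responds_cutI[OF ab(2) ub bot(2)] responds_cutI[OF ab(1) ua bot(1)] by (simp add: T_0)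
qed

text \<open>The pairs \<open>(a, b)\<close> and \<open>(b, a)\<close> solve the same coupled
equations, so their kernels agree. By monotonicity of \<open>S\<close>, the average of the two
quantile functions has that same kernel, hence the marginals of both pairs, and complementary
slackness for the average follows from whichever of the two is strictly above the cut.\<close>

lemma exists_cut_solution:
  fixes l :: real
  obtains m where "responds m m 0 1 (\<lambda>t. l \<le> t)"
proof -
  obtain a b where a: "responds a b 0 1 (\<lambda>t. l \<le> t)" and b: "responds b a 0 1 (\<lambda>t. l \<le> t)"
    by (rule exists_alternating_solution)
  note pa = responds_profile[OF a] and pb = responds_profile[OF b]
  note ua = profile_unit_mono[OF pa] and ub = profile_unit_mono[OF pb]
  define X where "X p = (quantile a p + quantile b p) / 2" for p
  note quantile_measurable[OF pa, measurable] quantile_measurable[OF pb, measurable]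
  have X [measurable]: "X \<in> borel_measurable (slab 0 1)" unfolding X_def[abs_def] by measurable
  define V where "V t = (\<integral>q. S (t + X q) \<partial>slab 0 1)" for t
  define m where "m t = measure (slab 0 1) {p \<in> {0<..<1}. X p \<le> t}" for t
  interpret slab: finite_measure "slab 0 1" by (rule finite_measure_slab)
  have sets_m [measurable]: "{p \<in> {0<..<1}. X p \<le> t} \<in> sets (slab 0 1)" for t
  proof -
    have "{p \<in> space (slab 0 1). X p \<le> t} \<in> sets (slab 0 1)" by measurable
    then show ?thesis by simp
  qed
  have lX: "l \<le> quantile a p" "l \<le> quantile b p" "l \<le> X p" if "0 < p" "p < 1" for p
    using responds_uncut[OF a that] responds_uncut[OF b that] by (auto simp: X_def)
  have Xmono: "X p \<le> X q" if "0 < p" "p \<le> q" "q < 1" for p q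
    using that mono_onD[OF quantile_mono_on[OF pa], of p q] mono_onD[OF quantile_mono_on[OF pb], of p q]
    by (simp add: X_def)
  have m_sub: "measure (slab 0 1) {q \<in> {0<..<1}. q \<le> p} = p" if "0 < p" "p < 1" for p
    using that by (subst measure_slab) auto
  have below: "X p \<le> t" if "0 < p" "p < m t" "p < 1" for p t
  proof (rule ccontr)
    assume c: "\<not> X p \<le> t"
    have "m t \<le> measure (slab 0 1) {q \<in> {0<..<1}. q \<le> p}"
      unfolding m_def
    proof (rule slab.finite_measure_mono)
      show "{q \<in> {0<..<1}. X q \<le> t} \<subseteq> {q \<in> {0<..<1}. q \<le> p}"
      proof clarsimp
        fix q assume q: "0 < q" "q < 1" "X q \<le> t"
        show "q \<le> p"
        proof (rule ccontr)
          assume "\<not> q \<le> p"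
          then have "X p \<le> X q" using that(1) q(2) by (intro Xmono) auto
          then show False using c q(3) by simp
        qed
      qed
      have "{q \<in> space (slab 0 1). q \<le> p} \<in> sets (slab 0 1)" by measurable
      then show "{q \<in> {0<..<1}. q \<le> p} \<in> sets (slab 0 1)" by simp
    qed
    then show False using that m_sub by simp
  qed
  have above: "t < X p" if "m t < p" "0 < p" "p < 1" for p t
  proof (rule ccontr)
    assume c: "\<not> t < X p"
    have "measure (slab 0 1) {q \<in> {0<..<1}. q \<le> p} \<le> m t"
      unfolding m_def
      by (rule slab.finite_measure_mono[OF _ sets_m]) (use c Xmono[of _ p] that in force)
    then show False using that m_sub by simp
  qed
  have one: "measure (slab 0 1) {0<..<1} = 1" by (simp add: measure_def emeasure_slab)
  have m01: "0 \<le> m t" "m t \<le> 1" for t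
  proof -
    have "m t \<le> measure (slab 0 1) {0<..<1}"
      unfolding m_def using sets.top[of "slab 0 1"] by (intro slab.finite_measure_mono) auto
    then show "m t \<le> 1" "0 \<le> m t" using one by (auto simp: m_def)
  qed
  have um: "unit_mono m"
    unfolding unit_mono_def
  proof (intro conjI allI m01 monoI)
    fix s t :: real assume "s \<le> t"
    then show "m s \<le> m t" unfolding m_def by (intro slab.finite_measure_mono sets_m) auto
  qed
  have V: "V t = K m t" for t
    unfolding V_def K_def m_def by (rule integral_S_measurable[OF X])
  have V_anti: "V t \<le> V s" if "s \<le> t" for s t
    unfolding V by (rule K_antimono[OF um that])
  have eqS: "AE p in slab 0 1. AE q in slab 0 1. S (quantile a p + quantile b q) = S (quantile b p + quantile a q)"
    using pair_sigma_finite.AE_pair[OF pair_slab kernels_agree[OF a b b a, unfolded slab2_def]]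
    by simp
  have key: "AE p in slab 0 1. V (X p) \<le> \<tau> p \<and> (l < X p \<longrightarrow> V (X p) = \<tau> p)"
  proof (rule AE_mp[OF eqS], rule AE_I2, rule impI)
    fix p assume "p \<in> space (slab 0 1)"
      and ae: "AE q in slab 0 1. S (quantile a p + quantile b q) = S (quantile b p + quantile a q)"
    then have p: "0 < p" "p < 1" by auto
    \<comment> \<open>the sum of the averages lies between two sums at which \<open>S\<close> takes the same value\<close>
    have mid: "S (X p + X q) = S (quantile a p + quantile b q)"
      if "S (quantile a p + quantile b q) = S (quantile b p + quantile a q)" for q
    proof (cases "quantile a p + quantile b q \<le> quantile b p + quantile a q")
      case True
      then have "S (quantile b p + quantile a q) \<le> S (X p + X q)" "S (X p + X q) \<le> S (quantile a p + quantile b q)"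
        by (intro S_antimono; simp add: X_def field_simps)+
      then show ?thesis using that by simp
    next
      case False
      then have "S (quantile a p + quantile b q) \<le> S (X p + X q)" "S (X p + X q) \<le> S (quantile b p + quantile a q)"
        by (intro S_antimono; simp add: X_def field_simps)+
      then show ?thesis using that by simp
    qed
    have "V (X p) = (\<integral>q. S (quantile a p + quantile b q) \<partial>slab 0 1)"
      unfolding V_def
    proof (rule integral_cong_AE)
      show "AE q in slab 0 1. S (X p + X q) = S (quantile a p + quantile b q)"
        using ae by eventually_elim (rule mid)
    qed measurable
    then have Va: "V (X p) = K b (quantile a p)" using integral_S_quantile[OF pb] by simp
    have "V (X p) = (\<integral>q. S (quantile b p + quantile a q) \<partial>slab 0 1)"
      unfolding V_def
    proof (rule integral_cong_AE)
      show "AE q in slab 0 1. S (X p + X q) = S (quantile b p + quantile a q)"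
        using ae by eventually_elim (simp add: mid)
    qed measurable
    then have Vb: "V (X p) = K a (quantile b p)" using integral_S_quantile[OF pa] by simp
    have "V (X p) = \<tau> p" if "l < X p"
    proof (cases "l < quantile a p")
      case True
      then have "free a (\<lambda>t. l \<le> t) p" using quantile_gt_iff[OF pa p] by (auto simp: free_def)
      then show ?thesis unfolding Va by (rule K_quantile_eq[OF a ub p])
    next
      case False
      then have "l < quantile b p" using that lX[OF p] by (simp add: X_def)
      then have "free b (\<lambda>t. l \<le> t) p" using quantile_gt_iff[OF pb p] by (auto simp: free_def)
      then show ?thesis unfolding Vb by (rule K_quantile_eq[OF b ua p])
    qed
    then show "V (X p) \<le> \<tau> p \<and> (l < X p \<longrightarrow> V (X p) = \<tau> p)"
      using K_quantile_le[OF a ub p] Va by simp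
  qed
  \<comment> \<open>below \<open>T 1\<close> the function \<open>\<tau>\<close> does not invert \<open>T\<close>, but there the average sits at the cut\<close>
  have T1: "X p \<le> l" if "0 < p" "p < 1" "p \<le> T 1" for p
  proof -
    have "p \<le> a l" "p \<le> b l"
      using that responds_eq[OF a, of l] responds_eq[OF b, of l] K_range[OF ua, of l] K_range[OF ub, of l]
        T_le[of "K a l" 1] T_le[of "K b l" 1] by auto
    then show ?thesis
      using quantile_le_iff[OF pa that(1,2), of l] quantile_le_iff[OF pb that(1,2), of l]
      by (simp add: X_def)
  qed
  have V01: "V t \<in> {0..1}" for t using K_range[OF um] V by simp
  have "m t = (if l \<le> t then T (K m t) else 0)" for t
  proof (cases "l \<le> t")
    case False
    then have "{p \<in> {0<..<1}. X p \<le> t} = {}" using lX(3) by force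
    then show ?thesis using False unfolding m_def by (simp only: measure_empty if_False)
  next
    case True
    have "m t \<le> T (V t)"
    proof (rule ccontr)
      assume "\<not> m t \<le> T (V t)"
      then obtain p where p: "T (V t) < p" "p < m t" "V (X p) \<le> \<tau> p"
        using slab_AE_witness[OF key, of "T (V t)" "m t"] T_range[OF V01[of t]] m01[of t] by auto
      have p01: "0 < p" "p < 1" using p T_range[OF V01[of t]] m01[of t] by auto
      have "V t \<le> \<tau> p" using V_anti[OF below[OF p01(1) p(2) p01(2)]] p(3) by simp
      then have "T (\<tau> p) \<le> T (V t)" using V01[of t] \<tau>_range[of p] p01 by (intro T_le) auto
      then show False using T_\<tau>[of p] p01 p(1) by auto
    qed
    moreover have "T (V t) \<le> m t"
    proof (rule ccontr)
      assume "\<not> T (V t) \<le> m t"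
      then obtain p where p: "m t < p" "p < T (V t)" "l < X p \<longrightarrow> V (X p) = \<tau> p"
        using slab_AE_witness[OF key, of "m t" "T (V t)"] T_range[OF V01[of t]] m01[of t] by auto
      have p01: "0 < p" "p < 1" using p T_range[OF V01[of t]] m01[of t] by auto
      have tX: "t < X p" by (rule above[OF p(1) p01])
      then have "\<tau> p \<le> V t" using V_anti[of t "X p"] p(3) True by simp
      then have "T (V t) \<le> T (\<tau> p)" using V01[of t] \<tau>_range[of p] p01 by (intro T_le) auto
      moreover have "T 1 < p" using T1[OF p01] tX True by linarith
      ultimately show False using T_\<tau>[of p] p01 p(2) by auto
    qed
    ultimately show ?thesis using True V by simp
  qed
  moreover have "(m \<longlongrightarrow> 0) at_bot"
    by (rule tendsto_eventually) (use calculation in \<open>auto simp: eventually_at_bot_linorder intro!: exI[of _ "l - 1"]\<close>)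
  ultimately show ?thesis using that responds_cutI[of m l m 0] um by (simp add: T_0)
qed

end

context matching_system
begin

section \<open>Separation into layers\<close>

lemma responds_fullI:
  assumes f: "\<And>t. f t = T (K g t)"
    and g: "unit_mono g" "(g \<longlongrightarrow> y) at_bot" "(g \<longlongrightarrow> z) at_top" and yz: "T z < T y"
  shows "responds f g (T z) (T y) (\<lambda>_. True)"
proof -
  have feq: "f = (\<lambda>t. T (K g t))" using f by auto
  have "mono f" using TK_mono[OF g(1)] by (auto intro!: monoI simp: f)
  moreover have lim: "(f \<longlongrightarrow> T z) at_bot" "(f \<longlongrightarrow> T y) at_top"
    unfolding feq by (rule TK_at_bot[OF g(1,3)], rule TK_at_top[OF g(1,2)])
  moreover have "0 \<le> T z"
    by (rule tendsto_lowerbound[OF lim(1)]) (use TK_unit[OF g(1)] in \<open>auto simp: f\<close>)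
  moreover have "T y \<le> 1"
    by (rule tendsto_upperbound[OF lim(2)]) (use TK_unit[OF g(1)] in \<open>auto simp: f\<close>)
  moreover have "continuous (at_right t) f" for t
    unfolding feq using TK_cont[OF g(1)] continuous_at_imp_continuous_at_within by blast
  ultimately show ?thesis
    using yz by (auto simp: responds_def profile_def f)
qed

lemma energy_tendsto:
  assumes "(x \<longlongrightarrow> a) F" "(y \<longlongrightarrow> b) F" "\<And>n. x n \<in> {0..1}" "\<And>n. y n \<in> {0..1}"
    "a \<in> {0..1}" "b \<in> {0..1}"
  shows "((\<lambda>n. energy (x n) (y n)) \<longlongrightarrow> energy a b) F"
  unfolding energy_def
  using assms by (intro tendsto_intros continuous_on_tendsto_compose[OF \<Psi>_cont]) auto

lemma unit_mono_limits:
  assumes "unit_mono h"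
  obtains a b where "(h \<longlongrightarrow> a) at_bot" "(h \<longlongrightarrow> b) at_top" "a \<in> {0..1}" "b \<in> {0..1}" "a \<le> b"
proof -
  have h: "mono h" "\<And>t. 0 \<le> h t" "\<And>t. h t \<le> 1" using assms by (auto simp: unit_mono_def)
  obtain a where a: "(h \<longlongrightarrow> a) at_bot" "\<And>t. a \<le> h t" "0 \<le> a"
    by (rule mono_limit_at_bot[OF h(1,2)]) blast
  obtain b where b: "(h \<longlongrightarrow> b) at_top" "\<And>t. h t \<le> b" "b \<le> 1"
    by (rule mono_limit_at_top[OF h(1,3)]) blast
  have "a \<le> b" using a(2)[of 0] b(2)[of 0] by simp
  then show ?thesis using that[OF a(1) b(1)] a(3) b(3) by auto
qed

text \<open>Seen from \<open>d n\<close> and from \<open>- d n\<close>, the solutions converge to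
\<open>f\<close> and \<open>g\<close>. The limits of \<open>f\<close> on the right and of
\<open>g\<close> on the left are the two values of a plateau, and the bound of
\<open>energy_plateau\<close> becomes exact for them.\<close>

lemma plateau_limit:
  fixes d l :: "nat \<Rightarrow> real"
  assumes N: "\<And>n. responds (N n) (N n) 0 1 (\<lambda>t. l n \<le> t)"
    and f: "unit_mono f" "\<And>t. (\<lambda>n. N n (t + d n)) \<longlonglongrightarrow> f t" "(f \<longlongrightarrow> x) at_top"
    and g: "unit_mono g" "\<And>t. (\<lambda>n. N n (t - d n)) \<longlonglongrightarrow> g t" "(g \<longlongrightarrow> y) at_bot"
    and l: "\<And>t. 0 \<le> t \<Longrightarrow> \<forall>\<^sub>F n in sequentially. l n \<le> t + d n"
      "\<And>t. \<forall>\<^sub>F n in sequentially. l n \<le> t - d n"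
    and z: "x' \<in> {0..1}" "y' \<in> {0..1}"
  shows "energy x' y' \<le> energy x y"
proof -
  have N01: "N n t \<in> {0..1}" for n t using profile_bounds[OF responds_profile[OF N], of n t] by auto
  have f01: "f t \<in> {0..1}" and g01: "g t \<in> {0..1}" for t using f g by (auto simp: unit_mono_def)
  have x01: "x \<in> {0..1}"
    using tendsto_lowerbound[OF f(3), of 0] tendsto_upperbound[OF f(3), of 1] f(1) by (auto simp: unit_mono_def)
  have y01: "y \<in> {0..1}"
    using tendsto_lowerbound[OF g(3), of 0] tendsto_upperbound[OF g(3), of 1] g(1) by (auto simp: unit_mono_def)
  have bound: "energy x' y' \<le> energy (f t) (g (- 2 * t)) + (1 - S (- t)) + S t + (f (3 * t) - f t)"
    if t: "0 \<le> t" for t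
  proof (rule tendsto_lowerbound)
    \<comment> \<open>the points \<open>t\<close>, \<open>3 t\<close> and \<open>- 2 t\<close> give the sums \<open>- t\<close> and \<open>t\<close> required for a plateau\<close>
    let ?e = "\<lambda>n. energy (N n (t + d n)) (N n (- 2 * t - d n)) + (1 - S (- t)) + S t
       + (N n (3 * t + d n) - N n (t + d n))"
    show "?e \<longlonglongrightarrow> energy (f t) (g (- 2 * t)) + (1 - S (- t)) + S t + (f (3 * t) - f t)"
      using N01 f01 g01 by (intro tendsto_intros energy_tendsto f(2) g(2))
    show "\<forall>\<^sub>F n in sequentially. energy x' y' \<le> ?e n"
      using l(1)[OF t] l(2)[of "- 2 * t"]
    proof eventually_elim
      case (elim n)
      show ?case
        using energy_plateau[OF N elim, of "3 * t + d n" x' y'] t z by simp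
    qed
  qed auto
  have sc: "filterlim (\<lambda>t. c * t) at_top at_top" if "0 < c" for c :: real
    using that by (intro filterlim_tendsto_pos_mult_at_top[OF tendsto_const]) (auto simp: filterlim_ident)
  have sc': "filterlim (\<lambda>t::real. - 2 * t) at_bot at_top" "filterlim (\<lambda>t::real. - t) at_bot at_top"
    using sc[of 2] filterlim_ident by (auto simp: filterlim_uminus_at_bot)
  have "((\<lambda>t. energy (f t) (g (- 2 * t)) + (1 - S (- t)) + S t + (f (3 * t) - f t))
      \<longlongrightarrow> energy x y + (1 - 1) + 0 + (x - x)) at_top"
    by (intro tendsto_intros energy_tendsto f(3) f01 g01 x01 y01 S_at_top
        filterlim_compose[OF g(3) sc'(1)] filterlim_compose[OF S_at_bot sc'(2)]
        filterlim_compose[OF f(3) sc]) simp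
  then have "energy x' y' \<le> energy x y + (1 - 1) + 0 + (x - x)"
  proof (rule tendsto_lowerbound)
    show "\<forall>\<^sub>F t in at_top. energy x' y' \<le> energy (f t) (g (- 2 * t)) + (1 - S (- t)) + S t + (f (3 * t) - f t)"
      using eventually_ge_at_top[of 0] by eventually_elim (rule bound)
  qed auto
  then show ?thesis by simp
qed

lemma Helly_unit_mono:
  assumes "\<And>n. unit_mono (h n)" "\<And>n t. continuous (at_right t) (h n)"
  obtains r :: "nat \<Rightarrow> nat" and H C where "strict_mono r" "unit_mono H" "countable C"
    "\<And>t. t \<notin> C \<Longrightarrow> (\<lambda>n. h (r n) t) \<longlonglongrightarrow> H t"
proof -
  have "\<exists>r. strict_mono (r::nat \<Rightarrow> nat) \<and> (\<exists>F. (\<forall>x. continuous (at_right x) F) \<and> mono F \<and> (\<forall>x. \<bar>F x\<bar> \<le> 1) \<and>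
    (\<forall>x. continuous (at x) F \<longrightarrow> (\<lambda>n. h (r n) x) \<longlonglongrightarrow> F x))"
    using assms by (intro Helly_selection) (auto simp: unit_mono_def)
  then obtain r F where r: "strict_mono (r :: nat \<Rightarrow> nat)" and F: "mono F"
    "\<And>x. continuous (at x) F \<Longrightarrow> (\<lambda>n. h (r n) x) \<longlonglongrightarrow> F x" by blast
  define H where "H t = max 0 (min 1 (F t))" for t
  have "unit_mono H"
    using max.mono[OF order_refl min.mono[OF order_refl monoD[OF F(1)]]]
    by (auto simp: unit_mono_def H_def intro!: monoI)
  moreover have "(\<lambda>n. h (r n) t) \<longlonglongrightarrow> H t" if "t \<notin> {t. \<not> isCont F t}" for t
  proof -
    have "(\<lambda>n. max 0 (min 1 (h (r n) t))) \<longlonglongrightarrow> H t"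
      unfolding H_def using that by (intro tendsto_intros F(2)) auto
    then show ?thesis using assms(1) by (simp add: unit_mono_def min_absorb2 max_absorb2)
  qed
  ultimately show ?thesis using that[OF r _ mono_ctble_discont[OF F(1)]] by blast
qed

lemma TK_unit_mono: "unit_mono h \<Longrightarrow> unit_mono (\<lambda>t. T (K h t))"
  using TK_mono TK_unit by (auto simp: unit_mono_def intro!: monoI)

text \<open>The limits around \<open>- n\<close>, \<open>n\<close> and \<open>0\<close> of the
solutions cut at \<open>- n\<close>. Helly's theorem is applied only to the sequences around
\<open>n\<close> and \<open>0\<close>; all three limits are then redefined by the equations
themselves, so that convergence holds at every point. The middle limit \<open>c\<close> is constant
when there is no transition near \<open>0\<close>.\<close>

lemma exists_layers:
  obtains f g c x y u v where
    "\<And>t. f t = (if 0 \<le> t then T (K g t) else 0)" "\<And>t. g t = T (K f t)" "\<And>t. c t = T (K c t)"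
    "unit_mono f" "unit_mono g" "unit_mono c"
    "(f \<longlongrightarrow> x) at_top" "(g \<longlongrightarrow> y) at_bot" "(c \<longlongrightarrow> u) at_bot" "(c \<longlongrightarrow> v) at_top"
    "x = T y" "y = T x" "u = T v" "v = T u" "x \<le> y" "u \<le> v" "x \<in> maximizers" "u \<in> maximizers"
proof -
  define M where "M n = (SOME m. responds m m 0 1 (\<lambda>t. - real n \<le> t))" for n
  have M: "responds (M n) (M n) 0 1 (\<lambda>t. - real n \<le> t)" for n
    unfolding M_def
    by (rule exists_cut_solution[of "- real n"])
       (erule someI[where P = "\<lambda>m. responds m m 0 1 (\<lambda>t. - real n \<le> t)"])
  have uM: "unit_mono (M n)" for n by (rule profile_unit_mono[OF responds_profile[OF M]])
  have rcM: "continuous (at_right t) (M n)" for n t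
    using responds_profile[OF M[of n]] by (simp add: profile_def)
  have um1: "unit_mono (\<lambda>t. M n (t + real n))" for n
    using uM[of n] by (auto simp: unit_mono_def mono_def)
  have rc1: "continuous (at_right t) (\<lambda>t. M n (t + real n))" for n t
  proof -
    have "((\<lambda>t. M n (t + real n)) \<longlongrightarrow> M n (t + real n)) (at_right t)"
      using rcM[of "t + real n" n]
      by (simp add: continuous_within filterlim_at_right_to_0[of _ _ "t + real n"]
          filterlim_at_right_to_0[of _ _ t] add.assoc)
    then show ?thesis by (simp add: continuous_within)
  qed
  obtain r1 G C where r1: "strict_mono r1" and G: "unit_mono G" "countable C"
    "\<And>t. t \<notin> C \<Longrightarrow> (\<lambda>n. M (r1 n) (t + real (r1 n))) \<longlonglongrightarrow> G t"
    by (rule Helly_unit_mono[of "\<lambda>n t. M n (t + real n)", OF um1 rc1], rule that)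
  obtain r2 E D where r2: "strict_mono r2" and E: "unit_mono E" "countable D"
    "\<And>t. t \<notin> D \<Longrightarrow> (\<lambda>n. M (r1 (r2 n)) t) \<longlonglongrightarrow> E t"
    by (rule Helly_unit_mono[of "\<lambda>n. M (r1 n)", OF uM rcM], rule that)
  define N where "N n = M (r1 (r2 n))" for n
  define L where "L n = real (r1 (r2 n))" for n
  have N: "responds (N n) (N n) 0 1 (\<lambda>t. - L n \<le> t)" and uN: "unit_mono (N n)" for n
    unfolding N_def L_def by (rule M, rule uM)
  have N_eq: "N n t = (if - L n \<le> t then T (K (N n) t) else 0)" for n t
    using responds_eq[OF N, of n t] responds_cut[OF N, of n t] by auto
  have L_top: "filterlim L at_top sequentially"
    unfolding L_def using strict_mono_o[OF r1 r2]
    by (intro filterlim_compose[OF filterlim_real_sequentially] filterlim_subseq) (simp add: o_def)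
  have L_ge: "\<forall>\<^sub>F n in sequentially. z \<le> L n" for z using L_top by (simp add: filterlim_at_top)
  have GL: "(\<lambda>n. N n (t + L n)) \<longlonglongrightarrow> G t" if "t \<notin> C" for t
    using LIMSEQ_subseq_LIMSEQ[OF G(3)[OF that] r2] by (simp add: N_def L_def o_def)
  have EL: "(\<lambda>n. N n (t + 0)) \<longlonglongrightarrow> E t" if "t \<notin> D" for t
    using E(3)[OF that] by (simp add: N_def)
  have T_lim: "(\<lambda>n. T (K (N n) (s n))) \<longlonglongrightarrow> T (K h t)"
    if "unit_mono h" "(\<lambda>n. K (N n) (s n)) \<longlonglongrightarrow> K h t" for h s t
    using that K_range uN by (intro T_tendsto) auto
  define f where "f t = (if 0 \<le> t then T (K G t) else 0)" for t
  have uf: "unit_mono f"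
    using TK_mono[OF G(1)] TK_unit[OF G(1)] by (force simp: unit_mono_def f_def intro!: monoI)
  have fL: "(\<lambda>n. N n (t - L n)) \<longlonglongrightarrow> f t" for t
  proof (cases "0 \<le> t")
    case True
    then show ?thesis
      using T_lim[OF G(1) K_limit[where d = L, OF uN G(1,2) GL]] by (simp add: f_def N_eq)
  qed (simp add: f_def N_eq)
  define g where "g t = T (K f t)" for t
  have ug: "unit_mono g" unfolding g_def[abs_def] by (rule TK_unit_mono[OF uf])
  have gL: "(\<lambda>n. N n (t + L n)) \<longlonglongrightarrow> g t" for t
  proof -
    have "(\<lambda>n. T (K (N n) (t - - L n))) \<longlonglongrightarrow> T (K f t)"
      using fL by (intro T_lim[OF uf] K_limit[where C = "{}" and d = "\<lambda>n. - L n", OF uN uf]) auto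
    moreover have "\<forall>\<^sub>F n in sequentially. T (K (N n) (t - - L n)) = N n (t + L n)"
      using L_ge[of "- t / 2"] by eventually_elim (simp add: N_eq)
    ultimately show ?thesis unfolding g_def by (rule Lim_transform_eventually)
  qed
  have KG: "K G t = K g t" for t
    using LIMSEQ_unique[OF K_limit[where d = L, OF uN G(1,2) GL]
        K_limit[where C = "{}" and d = L, OF uN ug _ gL]] by auto
  define c where "c t = T (K E t)" for t
  have uc: "unit_mono c" unfolding c_def[abs_def] by (rule TK_unit_mono[OF E(1)])
  have cL: "(\<lambda>n. N n (t + 0)) \<longlonglongrightarrow> c t" for t
  proof -
    have "(\<lambda>n. T (K (N n) (t - 0))) \<longlonglongrightarrow> T (K E t)"
      by (intro T_lim[OF E(1)] K_limit[where d = "\<lambda>_. 0", OF uN E(1,2) EL])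
    moreover have "\<forall>\<^sub>F n in sequentially. T (K (N n) (t - 0)) = N n (t + 0)"
      using L_ge[of "- t"] by eventually_elim (simp add: N_eq)
    ultimately show ?thesis unfolding c_def by (rule Lim_transform_eventually)
  qed
  have KE: "K E t = K c t" for t
    using LIMSEQ_unique[OF K_limit[where d = "\<lambda>_. 0", OF uN E(1,2) EL]
        K_limit[where C = "{}" and d = "\<lambda>_. 0", OF uN uc _ cL]] by auto
  have f_eq: "f t = (if 0 \<le> t then T (K g t) else 0)" and c_eq: "c t = T (K c t)" for t
    by (simp_all add: f_def c_def KG KE)
  obtain y z where y: "(g \<longlongrightarrow> y) at_bot" "y \<in> {0..1}" by (rule unit_mono_limits[OF ug])
  obtain x where x: "(f \<longlongrightarrow> x) at_top" "x \<in> {0..1}" by (rule unit_mono_limits[OF uf])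
  obtain u v where uv: "(c \<longlongrightarrow> u) at_bot" "(c \<longlongrightarrow> v) at_top" "u \<in> {0..1}" "v \<in> {0..1}" "u \<le> v"
    by (rule unit_mono_limits[OF uc])
  have "(f \<longlongrightarrow> T y) at_top"
    by (rule Lim_transform_eventually[OF TK_at_top[OF ug y(1)]])
       (auto simp: f_eq eventually_at_top_linorder intro!: exI[of _ 0])
  then have xy: "x = T y" by (rule tendsto_unique[OF _ x(1), rotated]) simp
  have "(g \<longlongrightarrow> T x) at_bot"
    unfolding g_def[abs_def] by (rule TK_at_bot[OF uf x(1)])
  then have yx: "y = T x" by (rule tendsto_unique[OF _ y(1), rotated]) simp
  have "(c \<longlongrightarrow> T u) at_top"
    by (rule Lim_transform_eventually[OF TK_at_top[OF uc uv(1)]]) (use c_eq in auto)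
  then have vu: "v = T u" by (rule tendsto_unique[OF _ uv(2), rotated]) simp
  have "(c \<longlongrightarrow> T v) at_bot"
    by (rule Lim_transform_eventually[OF TK_at_bot[OF uc uv(2)]]) (use c_eq in auto)
  then have uv': "u = T v" by (rule tendsto_unique[OF _ uv(1), rotated]) simp
  have E1: "energy x' y' \<le> energy x y" if "x' \<in> {0..1}" "y' \<in> {0..1}" for x' y'
  proof (rule plateau_limit[where N = N and d = "\<lambda>n. - L n" and l = "\<lambda>n. - L n" and f = f and g = g])
    show "\<forall>\<^sub>F n in sequentially. - L n \<le> t - - L n" for t
      using L_ge[of "- t / 2"] by eventually_elim simp
  qed (use N uf ug fL gL x y that in auto)
  have E2: "energy x' y' \<le> energy v u" if "x' \<in> {0..1}" "y' \<in> {0..1}" for x' y'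
  proof (rule plateau_limit[where N = N and d = "\<lambda>n. 0" and l = "\<lambda>n. - L n" and f = c and g = c])
    show "\<forall>\<^sub>F n in sequentially. - L n \<le> t - 0" "\<forall>\<^sub>F n in sequentially. - L n \<le> t + 0" for t
      using L_ge[of "- t"] by (eventually_elim, simp)+
  qed (use N uc cL uv that in auto)
  have "x \<le> y"
  proof (rule tendsto_le)
    have "filterlim (\<lambda>t::real. - t) at_bot at_top" by (simp add: filterlim_uminus_at_bot filterlim_ident)
    then show "((\<lambda>t. g (- t)) \<longlongrightarrow> y) at_top" by (rule filterlim_compose[OF y(1)])
    show "\<forall>\<^sub>F t in at_top. f t \<le> g (- t)"
    proof (intro always_eventually allI)
      fix t
      show "f t \<le> g (- t)"
      proof (rule tendsto_le[OF _ gL fL])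
        show "\<forall>\<^sub>F n in sequentially. N n (t - L n) \<le> N n (- t + L n)"
          using L_ge[of t]
          by eventually_elim (use uN in \<open>auto simp: unit_mono_def intro: monoD\<close>)
      qed simp
    qed
  qed (use x in auto)
  moreover have "x \<in> maximizers"
    by (rule maximizers_energy[OF x(2) y(2) yx[symmetric] xy[symmetric]], rule E1)
       (use T_range in blast)+
  moreover have "u \<in> maximizers"
    by (rule maximizers_energy[OF uv(3,4) vu[symmetric] uv'[symmetric]],
        subst (2) energy_commute, rule E2) (use T_range in blast)+
  ultimately show ?thesis
    by (intro that[of f g c x y u v] f_eq g_def c_eq uf ug uc x(1) y(1) uv(1,2) xy yx uv' vu uv(5))
qed

end

section \<open>Uniqueness when the support contains an interval ending at its supremum\<close>

lemma open_real_interval: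
  fixes p :: real
  assumes "open U" "p \<in> U"
  obtains e where "0 < e" "{p - e<..<p + e} \<subseteq> U"
  using openE[OF assms] by (metis ball_eq_greaterThanLessThan)

lemma quantile_isCont:
  assumes f: "profile f a b" and p: "a < p" "p < b"
    and strict: "\<And>t. quantile f p < t \<Longrightarrow> f (quantile f p) < f t"
  shows "isCont (quantile f) p"
  unfolding isCont_def
proof (rule order_tendstoI)
  have ab: "\<forall>\<^sub>F p' in at p. a < p' \<and> p' < b"
    using eventually_at_in_open'[of "{a<..<b}" p] p by auto
  fix y
  { assume "y < quantile f p"
    then have "f y < p" using quantile_gt_iff[OF f p] by simp
    then have "\<forall>\<^sub>F p' in at p. f y < p'"
      using eventually_at_in_open'[of "{f y<..}" p] by auto
    with ab show "\<forall>\<^sub>F p' in at p. y < quantile f p'"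
      by eventually_elim (use quantile_gt_iff[OF f] in auto) }
  { assume "quantile f p < y"
    then obtain s where s: "quantile f p < s" "s < y" using dense by blast
    have "p < f s" using le_quantile[OF f p] strict[OF s(1)] by simp
    then have "\<forall>\<^sub>F p' in at p. p' < f s"
      using eventually_at_in_open'[of "{..<f s}" p] by auto
    with ab show "\<forall>\<^sub>F p' in at p. quantile f p' < y"
    proof eventually_elim
      case (elim p')
      then have "quantile f p' \<le> s" using quantile_le_iff[OF f, of p' s] by simp
      then show ?case using s by simp
    qed }
qed

lemma profile_eq_if_quantile_eq:
  assumes f: "profile f a b" and f': "profile f' a b"
    and eq: "\<And>p. a < p \<Longrightarrow> p < b \<Longrightarrow> quantile f' p = quantile f p"
  shows "f' t = f t"
proof -
  have *: "h t \<le> h' t"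
    if h: "profile h a b" and h': "profile h' a b"
      and eq: "\<And>p. a < p \<Longrightarrow> p < b \<Longrightarrow> quantile h' p = quantile h p" for h h'
  proof (rule dense_ge)
    fix p assume less: "h' t < p"
    show "h t \<le> p"
    proof (cases "p < b")
      case True
      have "a < p" using less profile_bounds(1)[OF h', of t] by simp
      then have "\<not> p \<le> h t"
        using less True eq[of p] quantile_le_iff[OF h, of p t] quantile_le_iff[OF h', of p t] by simp
      then show ?thesis by simp
    next
      case False
      then show ?thesis using profile_bounds(2)[OF h, of t] by simp
    qed
  qed
  show ?thesis using *[OF f f'] *[OF f' f] eq by (intro antisym) auto
qed

context matching_system
begin

text \<open>Where the two continuous kernels differ, they differ on a whole box, which is not a null
set.\<close>

lemma kernel_eq_at:
  assumes p: "profile f a b" "profile g a' b'" "profile f' a b" "profile g' a' b'"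
    and ae: "AE z in slab2 a b a' b'. S (quantile f (fst z) + quantile g (snd z))
     = S (quantile f' (fst z) + quantile g' (snd z))"
    and pq: "p \<in> {a<..<b}" "q \<in> {a'<..<b'}"
    and c: "isCont (quantile f) p" "isCont (quantile f') p" "isCont (quantile g) q" "isCont (quantile g') q"
  shows "S (quantile f p + quantile g q) = S (quantile f' p + quantile g' q)"
proof (rule ccontr)
  define d where "d z = S (quantile f (fst z) + quantile g (snd z))
     - S (quantile f' (fst z) + quantile g' (snd z))" for z
  assume ne: "\<not> ?thesis"
  have fst: "isCont (\<lambda>z. h (fst z)) (p, q)" if "isCont h p" for h :: "real \<Rightarrow> real"
    by (rule isCont_o2[of "(p, q)" fst h]) (use that in \<open>auto intro: continuous_intros\<close>)
  have snd: "isCont (\<lambda>z. h (snd z)) (p, q)" if "isCont h q" for h :: "real \<Rightarrow> real"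
    by (rule isCont_o2[of "(p, q)" snd h]) (use that in \<open>auto intro: continuous_intros\<close>)
  have S2: "isCont (\<lambda>z. S (u z)) (p, q)" if "isCont u (p, q)" for u
    by (rule isCont_o2[OF that S_cont])
  have "isCont d (p, q)"
    unfolding d_def[abs_def] by (intro continuous_intros S2 fst snd c)
  moreover have "d (p, q) \<noteq> 0" using ne by (simp add: d_def)
  ultimately have "\<forall>\<^sub>F z in nhds (p, q). d z \<noteq> 0"
    using tendsto_imp_eventually_ne[of d "d (p, q)" "nhds (p, q)" 0]
    by (simp add: continuous_at_imp_continuous_at_within isCont_def tendsto_nhds_iff)
  then obtain A where A: "open A" "(p, q) \<in> A" "\<And>z. z \<in> A \<Longrightarrow> d z \<noteq> 0"
    by (auto simp: eventually_nhds)
  then obtain P Q where PQ: "open P" "open Q" "p \<in> P" "q \<in> Q" "P \<times> Q \<subseteq> A"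
    by (metis open_prod_elim mem_Sigma_iff)
  obtain e1 where e1: "0 < e1" "{p - e1<..<p + e1} \<subseteq> P \<inter> {a<..<b}"
    by (rule open_real_interval[of "P \<inter> {a<..<b}" p]) (use PQ pq in auto)
  obtain e2 where e2: "0 < e2" "{q - e2<..<q + e2} \<subseteq> Q \<inter> {a'<..<b'}"
    by (rule open_real_interval[of "Q \<inter> {a'<..<b'}" q]) (use PQ pq in auto)
  have e1': "a \<le> p - e1" "p + e1 \<le> b" and e2': "a' \<le> q - e2" "q + e2 \<le> b'"
    using e1 e2 by (auto simp: greaterThanLessThan_subseteq_greaterThanLessThan)
  have ae2: "AE p in slab a b. AE q in slab a' b'. d (p, q) = 0"
    using pair_sigma_finite.AE_pair[OF pair_slab ae[unfolded slab2_def]] by (simp add: d_def)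
  obtain p' where p': "p - e1 < p'" "p' < p + e1" "AE q in slab a' b'. d (p', q) = 0"
    using slab_AE_witness[OF ae2, of "p - e1" "p + e1"] e1' e1(1) by auto
  obtain q' where q': "q - e2 < q'" "q' < q + e2" "d (p', q') = 0"
    using slab_AE_witness[OF p'(3), of "q - e2" "q + e2"] e2' e2(1) by auto
  have "p' \<in> P" "q' \<in> Q" using e1 e2 p' q' by auto
  then show False using PQ(5) A(3)[of "(p', q')"] q'(3) by auto
qed

end

locale supported_system = matching_system T \<Phi> \<omega> for T \<Phi> \<omega> +
  fixes lo hi :: ereal
  assumes lo_hi: "lo < hi"
    and support: "einterval lo hi \<subseteq> msupport \<omega>"
    and hi: "hi = Sup (ereal ` msupport \<omega>)"
begin

abbreviation window :: "real set" where "window \<equiv> einterval lo hi"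

lemma window_witness: obtains w where "w \<in> window"
  using ereal_dense2[OF lo_hi] by (auto simp: einterval_def)

lemma measure_window_pos:
  assumes "w \<in> window" "open U" "w \<in> U"
  shows "0 < measure \<omega> U"
  using assms support unfolding msupport_def by (auto simp: emeasure_eq_measure subset_eq)

text \<open>The complement of the support is a union of open null sets, and countably many of them
suffice because the line is second countable.\<close>

lemma AE_le_hi: "AE w in \<omega>. ereal w \<le> hi"
proof -
  define F where "F = {U. open U \<and> emeasure \<omega> U = 0}"
  obtain F' where F': "F' \<subseteq> F" "countable F'" "\<Union>F' = \<Union>F"
    using Lindelof[of F] by (auto simp: F_def)
  have "(\<Union>U\<in>F'. U) \<in> null_sets \<omega>"
    using F' by (intro null_sets_UN') (auto simp: F_def null_sets_def)
  then have "\<Union>F \<in> null_sets \<omega>" using F'(3) by simp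
  then have "AE w in \<omega>. w \<notin> \<Union>F" by (rule AE_not_in)
  then show ?thesis
  proof eventually_elim
    case (elim w)
    then have "w \<in> msupport \<omega>" unfolding F_def msupport_def using zero_less_iff_neq_zero by auto
    then show ?case unfolding hi by (intro Sup_upper) auto
  qed
qed

lemma S_window_less:
  assumes "s < s'" "w \<in> window" "s < w" "w < s'"
  shows "S s' < S s"
proof -
  have "S s = measure \<omega> ({s..<s'} \<union> {s'..})"
    unfolding S_def using assms by (intro arg_cong[where f = "measure \<omega>"]) auto
  also have "\<dots> = measure \<omega> {s..<s'} + S s'"
    unfolding S_def by (intro finite_measure_Union) auto
  finally have "S s = measure \<omega> {s..<s'} + S s'" .
  moreover have "measure \<omega> {s<..<s'} \<le> measure \<omega> {s..<s'}"
    by (intro finite_measure_mono) auto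
  moreover have "0 < measure \<omega> {s<..<s'}"
    using assms by (intro measure_window_pos[of w]) auto
  ultimately show ?thesis by simp
qed

lemma window_near: 
  assumes "w \<in> window" 
  obtains e where "0 < e" "{w - e<..<w + e} \<subseteq> window"
  by (rule open_real_interval[OF open_einterval assms])

lemma S_inj_window:
  assumes "S s = S s'" "s \<in> window"
  shows "s = s'"
proof (rule ccontr)
  assume ne: "s \<noteq> s'"
  obtain e where e: "0 < e" "{s - e<..<s + e} \<subseteq> window" by (rule window_near[OF assms(2)])
  consider "s < s'" | "s' < s" using ne by linarith
  then show False
  proof cases
    case 1
    let ?w = "min (s + e / 2) ((s + s') / 2)"
    have w: "?w \<in> {s - e<..<s + e}" "s < ?w" "?w < s'" using e(1) 1 by (auto simp: min_def)
    show False using S_window_less[OF 1 subsetD[OF e(2) w(1)] w(2,3)] assms(1) by simp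
  next
    case 2
    let ?w = "max (s - e / 2) ((s + s') / 2)"
    have w: "?w \<in> {s - e<..<s + e}" "s' < ?w" "?w < s" using e(1) 2 by (auto simp: max_def)
    show False using S_window_less[OF 2 subsetD[OF e(2) w(1)] w(2,3)] assms(1) by simp
  qed
qed

text \<open>If \<open>K g\<close> takes the same value at two points, the two translates of
\<open>g\<close> agree almost surely at \<open>W\<close>. Right continuity would extend any
disagreement at a point of the window to an interval of positive mass.\<close>

lemma flat_if_K_eq:
  assumes g: "profile g a b" and eq: "K g t1 = K g t2" "t1 \<le> t2" and w: "w \<in> window"
  shows "g (w - t1) = g (w - t2)"
proof (rule ccontr)
  assume ne: "g (w - t1) \<noteq> g (w - t2)"
  note um = profile_unit_mono[OF g]
  have mono: "g (v - t2) \<le> g (v - t1)" for v using um eq(2) by (auto simp: unit_mono_def intro: monoD)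
  have int: "integrable \<omega> (\<lambda>w. g (w - t1) - g (w - t2))"
    by (intro Bochner_Integration.integrable_diff K_integrable um)
  have "(\<integral>w. g (w - t1) - g (w - t2) \<partial>\<omega>) = 0"
    using eq(1) K_integrable[OF um] by (simp add: K_def)
  then have ae: "AE w in \<omega>. g (w - t1) - g (w - t2) = 0"
    using integral_nonneg_eq_0_iff_AE[OF int] mono by simp
  have rc: "((\<lambda>v. g (v - t)) \<longlongrightarrow> g (w - t)) (at_right w)" for t
  proof -
    have "(g \<longlongrightarrow> g (w - t)) (at_right (w - t))" using g by (auto simp: profile_def continuous_within)
    then show ?thesis
      by (simp add: filterlim_at_right_to_0[of _ _ "w - t"] filterlim_at_right_to_0[of _ _ w] algebra_simps)
  qed
  have "((\<lambda>v. g (v - t1) - g (v - t2)) \<longlongrightarrow> g (w - t1) - g (w - t2)) (at_right w)"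
    by (intro tendsto_diff rc)
  moreover have "0 < g (w - t1) - g (w - t2)" using mono[of w] ne by simp
  ultimately have "\<forall>\<^sub>F v in at_right w. 0 < g (v - t1) - g (v - t2)" by (rule order_tendstoD(1))
  then obtain r where r: "w < r" "\<And>v. w < v \<Longrightarrow> v < r \<Longrightarrow> 0 < g (v - t1) - g (v - t2)"
    using eventually_at_right_field by (metis (no_types, lifting))
  obtain e where e: "0 < e" "{w - e<..<w + e} \<subseteq> window" by (rule window_near[OF w])
  let ?v = "min ((w + r) / 2) (w + e / 2)"
  have "?v \<in> window" "?v \<in> {w<..<r}" using e r(1) by (auto simp: min_def)
  then have "0 < measure \<omega> {w<..<r}" by (intro measure_window_pos) auto
  moreover have "AE v in \<omega>. v \<notin> {w<..<r}" using ae by eventually_elim (use r(2) in force)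
  then have "measure \<omega> {w<..<r} = 0" by (subst (asm) prob_eq_0[symmetric]) auto
  ultimately show False by simp
qed

text \<open>The intervals \<open>[w - s2, w - s1]\<close> on which \<open>g\<close> is flat overlap
for \<open>w = w1\<close> and \<open>w = w2\<close>, so \<open>g\<close> is flat on their union,
which is longer than \<open>[s1, s2]\<close> by \<open>w2 - w1\<close>.\<close>

lemma flat_spreads:
  assumes g: "profile g a b" and eq: "K g s1 = K g s2" and s: "s1 \<le> s2"
    and w: "w1 \<in> window" "w2 \<in> window" "w1 \<le> w2" "w2 - w1 \<le> s2 - s1"
  shows "g (w1 - s2) = g (w2 - s1)"
proof -
  have m: "mono g" using g by (simp add: profile_def)
  have "g (w2 - s1) = g (w2 - s2)" "g (w1 - s1) = g (w1 - s2)"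
    using flat_if_K_eq[OF g eq s] w by auto
  moreover have "g (w2 - s2) \<le> g (w1 - s1)" "g (w1 - s2) \<le> g (w2 - s1)"
    using w s by (auto intro!: monoD[OF m])
  ultimately show ?thesis by simp
qed

lemma window_pair:
  assumes "0 < (r::real)"
  obtains w1 w2 where "w1 \<in> window" "w2 \<in> window" "w1 < w2" "w2 - w1 \<le> r"
proof -
  obtain w where w: "w \<in> window" by (rule window_witness)
  obtain e where e: "0 < e" "{w - e<..<w + e} \<subseteq> window" by (rule window_near[OF w])
  have w': "w + min r (e / 2) \<in> {w - e<..<w + e}" using e(1) assms by (auto simp: min_def)
  show ?thesis by (rule that[OF w subsetD[OF e(2) w']]) (use e(1) assms in auto)
qed

lemma K_eq_if_eq:
  assumes "responds f g a b U" "unit_mono g" "U s" "U t" "f s = f t"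
  shows "K g s = K g t"
  using responds_eq[OF assms(1,3)] responds_eq[OF assms(1,4)] assms(5) T_eq_iff K_range[OF assms(2)] by metis

text \<open>A flat piece of \<open>f\<close> produces a longer one of \<open>g\<close>, which
produces an even longer one of \<open>f\<close>. Each round adds the same length on both sides, so
\<open>f\<close> would be constant.\<close>

lemma full_strict:
  assumes f: "responds f g a b (\<lambda>_. True)" and g: "responds g f a' b' (\<lambda>_. True)" and s: "s1 < s2"
  shows "f s1 < f s2"
proof (rule ccontr)
  note pf = responds_profile[OF f] and pg = responds_profile[OF g]
  have m: "mono f" and lim: "(f \<longlongrightarrow> a) at_bot" "(f \<longlongrightarrow> b) at_top"
    using pf by (auto simp: profile_def)
  assume "\<not> f s1 < f s2"
  then have eq: "f s1 = f s2" using monoD[OF m, of s1 s2] s by auto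
  obtain w1 w2 where w: "w1 \<in> window" "w2 \<in> window" "w1 < w2" "w2 - w1 \<le> s2 - s1"
    by (rule window_pair[of "s2 - s1"]) (use s in auto)
  let ?d = "w2 - w1"
  have flat: "f (s1 - real n * ?d) = f (s2 + real n * ?d)" for n
  proof (induction n)
    case (Suc n)
    let ?u = "s1 - real n * ?d" and ?v = "s2 + real n * ?d"
    have n: "0 \<le> real n * ?d" using w by simp
    have uv: "?u \<le> ?v" "w2 - w1 \<le> ?v - ?u" "w1 - ?v \<le> w2 - ?u" "w2 - w1 \<le> (w2 - ?u) - (w1 - ?v)"
      using n w s by linarith+
    have "g (w1 - ?v) = g (w2 - ?u)"
      by (rule flat_spreads[OF pg K_eq_if_eq[OF f profile_unit_mono[OF pg] _ _ Suc] uv(1) w(1,2) _ uv(2)])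
         (use w in auto)
    then have "K f (w1 - ?v) = K f (w2 - ?u)"
      using K_eq_if_eq[OF g profile_unit_mono[OF pf], of "w1 - ?v" "w2 - ?u"] by simp
    then have "f (w1 - (w2 - ?u)) = f (w2 - (w1 - ?v))"
      by (rule flat_spreads[OF pf _ uv(3) w(1,2) _ uv(4)]) (use w in auto)
    then show ?case by (simp add: algebra_simps)
  qed (simp add: eq)
  have lin: "filterlim (\<lambda>n. real n * ?d) at_top sequentially"
    using w by (intro filterlim_at_top_mult_tendsto_pos[OF tendsto_const _ filterlim_real_sequentially]) auto
  have "(\<lambda>n. f (s1 - real n * ?d)) \<longlonglongrightarrow> a"
    using lin by (intro filterlim_compose[OF lim(1)])
      (simp add: filterlim_uminus_at_top filterlim_tendsto_add_at_bot_iff[OF tendsto_const] diff_conv_add_uminus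
         del: add_uminus_conv_diff)
  moreover have "(\<lambda>n. f (s2 + real n * ?d)) \<longlonglongrightarrow> b"
    using lin by (intro filterlim_compose[OF lim(2)] filterlim_tendsto_add_at_top[OF tendsto_const])
  ultimately have "a = b" using LIMSEQ_unique flat by force
  then show False using responds_levels[OF f] by simp
qed

text \<open>As in \<open>full_strict\<close> the flat piece grows on both sides, but to the left it
stops at the cut. So \<open>f\<close> would be a step function, which would force \<open>g\<close>
to be at its bottom level throughout the window; but then \<open>K f\<close> is constant there as
well, which the step at \<open>0\<close> prevents.\<close>

lemma cut_strict:
  assumes f: "responds f g 0 b (\<lambda>t. 0 \<le> t)" and g: "responds g f a' b' (\<lambda>_. True)" and s: "0 \<le> s1" "s1 < s2"
  shows "f s1 < f s2"
proof (rule ccontr)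
  note pf = responds_profile[OF f] and pg = responds_profile[OF g]
  have m: "mono f" and mg: "mono g" and lim: "(f \<longlongrightarrow> b) at_top" "(g \<longlongrightarrow> a') at_bot"
    using pf pg by (auto simp: profile_def)
  note um = profile_unit_mono[OF pf] profile_unit_mono[OF pg]
  assume "\<not> f s1 < f s2"
  then have eq: "f s1 = f s2" using monoD[OF m, of s1 s2] s by auto
  obtain w1 w2 where w: "w1 \<in> window" "w2 \<in> window" "w1 < w2" "w2 - w1 \<le> s2 - s1"
    by (rule window_pair[of "s2 - s1"]) (use s in auto)
  let ?d = "w2 - w1"
  have flat: "f (max 0 (s1 - real n * ?d)) = f (s2 + real n * ?d)" for n
  proof (induction n)
    case (Suc n)
    let ?u = "max 0 (s1 - real n * ?d)" and ?v = "s2 + real n * ?d"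
    have n: "0 \<le> real n * ?d" using w by simp
    have u: "?u \<le> s1" using n s(1) by (intro max.boundedI) linarith+
    have u0: "0 \<le> ?u" by simp
    have uv: "?u \<le> ?v" "w2 - w1 \<le> ?v - ?u" "w1 - ?v \<le> w2 - ?u" "w2 - w1 \<le> (w2 - ?u) - (w1 - ?v)" "0 \<le> ?v"
      using n w s u u0 by linarith+
    have "g (w1 - ?v) = g (w2 - ?u)"
      by (rule flat_spreads[OF pg K_eq_if_eq[OF f um(2) u0 uv(5) Suc] uv(1) w(1,2) _ uv(2)])
         (use w in auto)
    then have "K f (w1 - ?v) = K f (w2 - ?u)"
      using K_eq_if_eq[OF g um(1), of "w1 - ?v" "w2 - ?u"] by simp
    then have *: "f (w1 - (w2 - ?u)) = f (w2 - (w1 - ?v))"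
      by (rule flat_spreads[OF pf _ uv(3) w(1,2) _ uv(4)]) (use w in auto)
    have "f (?u - ?d) \<le> f (max 0 (s1 - real (Suc n) * ?d))"
      using w by (intro monoD[OF m]) (auto simp: algebra_simps max_def)
    moreover have "f (max 0 (s1 - real (Suc n) * ?d)) \<le> f (s2 + real (Suc n) * ?d)"
      using w s n by (intro monoD[OF m]) (auto simp: algebra_simps)
    ultimately show ?case using * by (simp add: algebra_simps)
  qed (simp add: eq s)
  have f0: "f 0 = f t" if "0 \<le> t" for t
  proof -
    obtain n :: nat where n: "s1 + t \<le> real n * ?d"
      using w real_arch_simple[of "(s1 + t) / ?d"] by (auto simp: field_simps)
    then have "max 0 (s1 - real n * ?d) = 0" using that by (intro max_absorb1) linarith
    then have "f 0 = f (s2 + real n * ?d)" using flat[of n] by simp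
    moreover have "f 0 \<le> f t" "f t \<le> f (s2 + real n * ?d)"
      using that n s by (auto intro!: monoD[OF m])
    ultimately show ?thesis by simp
  qed
  have g_bot: "g v = a'" if v: "v \<in> window" for v
  proof -
    have "g v = g (v - t)" if "0 \<le> t" for t
      using flat_if_K_eq[OF pg K_eq_if_eq[OF f um(2) _ _ f0[OF that]] that v] that by simp
    from this[of "v - s" for s] have "g s = g v" if "s \<le> v" for s using that by simp
    then have "\<forall>\<^sub>F s in at_bot. g s = g v"
      unfolding eventually_at_bot_linorder by blast
    then have "(g \<longlongrightarrow> g v) at_bot" by (rule tendsto_eventually)
    then show ?thesis using lim(2) tendsto_unique by force
  qed
  have "K f w1 = K f w2"
    using K_eq_if_eq[OF g um(1), of w1 w2] g_bot w by simp
  moreover obtain e where e: "0 < e" "{w1 - e<..<w1 + e} \<subseteq> window" by (rule window_near[OF w(1)])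
  let ?v = "min ((w1 + w2) / 2) (w1 + e / 2)"
  have v: "?v \<in> window" "w1 < ?v" "?v < w2" using e w by (auto simp: min_def)
  ultimately have "f (?v - w1) = f (?v - w2)" using flat_if_K_eq[OF pf _ _ v(1), of w1 w2] w by simp
  moreover have "f (?v - w2) = 0" using responds_cut[OF f, of "?v - w2"] v by simp
  moreover have "f (?v - w1) = f 0" using f0[of "?v - w1"] v by simp
  ultimately have "f 0 = 0" by simp
  have "(f \<longlongrightarrow> f 0) at_top"
    by (rule tendsto_eventually, rule eventually_mono[OF eventually_ge_at_top[of 0]], rule f0[symmetric])
  then have "b = f 0" using lim(1) tendsto_unique by force
  then show False using \<open>f 0 = 0\<close> responds_levels[OF f] by simp
qed

lemma uncut_strict:
  assumes f: "responds f g 0 b (\<lambda>t. 0 \<le> t)" and g: "responds g f a' b' (\<lambda>_. True)"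
    and t: "t1 < t2" "ereal t1 < hi"
  shows "g t1 < g t2"
proof (rule ccontr)
  note pf = responds_profile[OF f] and pg = responds_profile[OF g]
  have mg: "mono g" using pg by (auto simp: profile_def)
  assume "\<not> g t1 < g t2"
  then have "g t1 = g t2" using monoD[OF mg, of t1 t2] t by auto
  then have K: "K f t1 = K f t2" using K_eq_if_eq[OF g profile_unit_mono[OF pf], of t1 t2] by simp
  \<comment> \<open>a point \<open>w\<close> of the window above \<open>t1\<close> puts \<open>w - t1\<close> where \<open>f\<close> is strictly increasing\<close>
  have "max lo (ereal t1) < hi" using lo_hi t by simp
  then obtain w where w: "max lo (ereal t1) < ereal w" "ereal w < hi" using ereal_dense2 by blast
  then have ww: "w \<in> window" "t1 < w" by (auto simp: einterval_def)
  have eq: "f (w - t1) = f (w - t2)" using flat_if_K_eq[OF pf K _ ww(1)] t by simp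
  show False
  proof (cases "0 \<le> w - t2")
    case True
    then show False using cut_strict[OF f g True, of "w - t1"] eq t by simp
  next
    case False
    then have "f (w - t1) = 0" using eq responds_cut[OF f, of "w - t2"] by simp
    then show False
      using cut_strict[OF f g, of 0 "w - t1"] ww profile_bounds(1)[OF pf, of 0] by simp
  qed
qed

text \<open>Otherwise \<open>K g 0 = 1\<close>, and then \<open>K g\<close> is equal to
\<open>1\<close> on the left of \<open>0\<close>, so that \<open>g\<close> would have a flat
piece.\<close>

lemma cut_atom:
  assumes f: "responds f g 0 b (\<lambda>t. 0 \<le> t)" and g: "responds g f a' b' (\<lambda>_. True)"
  shows "0 < f 0"
proof (rule ccontr)
  note pf = responds_profile[OF f] and pg = responds_profile[OF g]
  note um = profile_unit_mono[OF pg]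
  assume "\<not> 0 < f 0"
  then have "T (K g 0) = 0" using responds_eq[OF f, of 0] profile_bounds(1)[OF pf, of 0] by simp
  then have "K g 0 = 1"
    using T_less[of "K g 0" 1] T_1 K_range[OF um, of 0] by force
  then have "K g (- 1) = K g 0"
    using K_antimono[OF um, of "-1" 0] K_range[OF um, of "-1"] by simp
  moreover obtain w where w: "w \<in> window" by (rule window_witness)
  ultimately have "g (w - - 1) = g (w - 0)" using flat_if_K_eq[OF pg, of "-1" 0 w] by simp
  then show False using uncut_strict[OF f g, of w "w + 1"] w by (simp add: einterval_def)
qed

text \<open>For \<open>t = hi\<close> the argument \<open>W - t\<close> is almost surely negative,
so \<open>K f\<close> vanishes there and \<open>g\<close> has already reached \<open>T 0 =
1\<close>.\<close>

lemma uncut_quantile_less_hi: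
  assumes f: "responds f g 0 b (\<lambda>t. 0 \<le> t)" and g: "responds g f a' 1 (\<lambda>_. True)"
    and q: "a' < q" "q < 1"
  shows "ereal (quantile g q) < hi"
proof (cases hi)
  case (real r)
  note pf = responds_profile[OF f] and pg = responds_profile[OF g]
  note um = profile_unit_mono[OF pf]
  have "AE w in \<omega>. w - r \<notin> {0}" by (rule AE_avoids_countable) simp
  then have "AE w in \<omega>. f (w - r) = 0"
    using AE_le_hi by eventually_elim (use responds_cut[OF f] real in auto)
  then have "K f r = (\<integral>w. 0 \<partial>\<omega>)"
    unfolding K_def by (intro integral_cong_AE) (auto intro: K_integrable[OF um] borel_measurable_integrable)
  then have "g r = 1" using responds_eq[OF g, of r] T_0 by simp
  have "g = (\<lambda>t. T (K f t))" using responds_eq[OF g] by auto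
  then have "isCont g r" using TK_cont[OF um, of r] by simp
  then have "(g \<longlongrightarrow> 1) (at_left r)"
    using \<open>g r = 1\<close> by (metis continuous_at_imp_continuous_at_within continuous_within)
  then have "\<forall>\<^sub>F t in at_left r. q < g t" using q by (intro order_tendstoD(1)) auto
  then have "\<forall>\<^sub>F t in at_left r. q < g t \<and> t < r" by (simp add: eventually_at_filter)
  then obtain t where "q < g t" "t < r" using eventually_happens'[OF trivial_limit_at_left_real] by blast
  then show ?thesis using quantile_le_iff[OF pg q, of t] real by simp
qed (use lo_hi in auto)

text \<open>Where the sum of the quantiles lies in the window, equality of the kernels means
equality of the sums, because \<open>S\<close> is injective there. Fixing \<open>q\<close> and
moving \<open>p\<close> shows that the difference of the two quantile functions is locally
constant.\<close>

lemma quantile_shift: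
  assumes f: "responds f g a b U" and g: "responds g f a' b' U'"
    and f': "responds f' g' a b U" and g': "responds g' f' a' b' U'"
    and cont: "\<And>p. a < p \<Longrightarrow> p < b \<Longrightarrow> isCont (quantile f) p \<and> isCont (quantile f') p"
      "\<And>q. a' < q \<Longrightarrow> q < b' \<Longrightarrow> isCont (quantile g) q \<and> isCont (quantile g') q"
    and reach: "\<And>p. a < p \<Longrightarrow> p < b \<Longrightarrow> \<exists>q. a' < q \<and> q < b' \<and> quantile f p + quantile g q \<in> window"
  shows "\<exists>d. (\<forall>p. a < p \<longrightarrow> p < b \<longrightarrow> quantile f' p = quantile f p + d) \<and>
     (\<exists>q. a' < q \<and> q < b' \<and> quantile g' q = quantile g q - d)"
proof -
  note p = responds_profile[OF f] responds_profile[OF g] responds_profile[OF f'] responds_profile[OF g']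
  have S_eq: "S (quantile f p + quantile g q) = S (quantile f' p + quantile g' q)"
    if "a < p" "p < b" "a' < q" "q < b'" for p q
    using kernel_eq_at[OF p kernels_agree[OF f g f' g']] cont that by simp
  have sum_eq: "quantile f p + quantile g q = quantile f' p + quantile g' q"
    if "a < p" "p < b" "a' < q" "q < b'" "quantile f p + quantile g q \<in> window" for p q
    by (rule S_inj_window[OF S_eq]) (use that in auto)
  let ?D = "\<lambda>p. quantile f' p - quantile f p"
  define p0 where "p0 = (a + b) / 2"
  have p0: "p0 \<in> {a<..<b}" using responds_levels[OF f] by (auto simp: p0_def)
  have "?D p0 = ?D p" if pp: "p \<in> {a<..<b}" for p
  proof (rule connected_local_const[of "{a<..<b}" p0 p ?D, OF _ p0 pp], simp, intro ballI)
    fix p assume pp: "p \<in> {a<..<b}"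
    then obtain q where q: "a' < q" "q < b'" "quantile f p + quantile g q \<in> window"
      using reach by auto
    have "((\<lambda>x. quantile f x + quantile g q) \<longlongrightarrow> quantile f p + quantile g q) (at p)"
      using cont(1)[of p] pp by (intro tendsto_intros) (auto simp: isCont_def)
    then have "\<forall>\<^sub>F x in at p. quantile f x + quantile g q \<in> window"
      by (rule topological_tendstoD[OF _ open_einterval q(3)])
    moreover have "\<forall>\<^sub>F x in at p. x \<in> {a<..<b}"
      by (rule eventually_at_in_open'[OF open_greaterThanLessThan pp])
    ultimately have "\<forall>\<^sub>F x in at p. ?D p = ?D x"
    proof eventually_elim
      case (elim x)
      then show ?case using sum_eq[of p q] sum_eq[of x q] q pp by simp
    qed
    then show "\<forall>\<^sub>F x in at p within {a<..<b}. ?D p = ?D x"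
      by (rule filter_leD[OF at_le[OF subset_UNIV]])
  qed
  then have "quantile f' p = quantile f p + ?D p0" if "a < p" "p < b" for p using that by force
  moreover obtain q where "a' < q" "q < b'" "quantile f p0 + quantile g q \<in> window"
    using reach p0 by auto
  moreover from this have "quantile g' q = quantile g q - ?D p0" using sum_eq[of p0 q] p0 by simp
  ultimately show ?thesis by blast
qed

lemma quantile_of_value:
  assumes f: "profile f a b" and strict: "\<And>s. s < t \<Longrightarrow> f s < f t" and p: "a < f t" "f t < b"
  shows "quantile f (f t) = t"
proof (rule antisym)
  show "quantile f (f t) \<le> t" using quantile_le_iff[OF f p] by simp
  show "t \<le> quantile f (f t)"
    by (rule dense_le) (use quantile_gt_iff[OF f p] strict in \<open>auto intro: less_imp_le\<close>)
qed

text \<open>Shifting one partner to the right shifts the other to the left, so a profile coupled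
with itself admits no shift.\<close>

lemma self_solution_unique:
  assumes f: "responds f f a b (\<lambda>_. True)" and f': "responds f' f' a b (\<lambda>_. True)"
  shows "f' t = f t"
proof -
  note p = responds_profile[OF f] responds_profile[OF f']
  note strict = full_strict[OF f f] and strict' = full_strict[OF f' f']
  have cont: "isCont (quantile f) p \<and> isCont (quantile f') p" if "a < p" "p < b" for p
    using that by (intro conjI quantile_isCont[OF p(1)] quantile_isCont[OF p(2)] strict strict')
  have "\<exists>q. a < q \<and> q < b \<and> quantile f p + quantile f q \<in> window" if "a < p" "p < b" for p
  proof -
    obtain w where w: "w \<in> window" by (rule window_witness)
    let ?t = "w - quantile f p"
    have "a < f ?t" "f ?t < b"
      using profile_bounds[OF p(1), of "?t - 1"] profile_bounds[OF p(1), of "?t + 1"]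
        strict[of "?t - 1" ?t] strict[of ?t "?t + 1"] by auto
    moreover from this have "quantile f (f ?t) = ?t"
      using strict by (intro quantile_of_value[OF p(1)]) auto
    ultimately show ?thesis using w by (intro exI[of _ "f ?t"]) auto
  qed
  from quantile_shift[OF f f f' f' cont cont this]
  obtain d q where d: "\<And>p. a < p \<Longrightarrow> p < b \<Longrightarrow> quantile f' p = quantile f p + d"
    "a < q" "q < b" "quantile f' q = quantile f q - d" by blast
  then have "d = 0" using d(1)[of q] by simp
  then show ?thesis using d(1) by (intro profile_eq_if_quantile_eq[OF p]) auto
qed

text \<open>Below a common part of the two atoms at \<open>0\<close> both quantile functions vanish,
so the shift is \<open>0\<close>.\<close>

lemma cut_solution_unique:
  assumes f: "responds f g 0 b (\<lambda>t. 0 \<le> t)" and g: "responds g f a' 1 (\<lambda>_. True)"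
    and f': "responds f' g' 0 b (\<lambda>t. 0 \<le> t)" and g': "responds g' f' a' 1 (\<lambda>_. True)"
  shows "f' t = f t" "g' t = g t"
proof -
  note p = responds_profile[OF f] responds_profile[OF f'] responds_profile[OF g] responds_profile[OF g']
  have cont: "isCont (quantile f) p \<and> isCont (quantile f') p" if "0 < p" "p < b" for p
    using that responds_uncut[OF f that] responds_uncut[OF f' that]
    by (intro conjI quantile_isCont[OF p(1)] quantile_isCont[OF p(2)] cut_strict[OF f g] cut_strict[OF f' g'])
  have cont': "isCont (quantile g) q \<and> isCont (quantile g') q" if "a' < q" "q < 1" for q
    using that uncut_quantile_less_hi[OF f g that] uncut_quantile_less_hi[OF f' g' that]
    by (intro conjI quantile_isCont[OF p(3)] quantile_isCont[OF p(4)] uncut_strict[OF f g] uncut_strict[OF f' g'])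
  have "\<exists>q. a' < q \<and> q < 1 \<and> quantile f p + quantile g q \<in> window" if "0 < p" "p < b" for p
  proof -
    obtain w where w: "w \<in> window" by (rule window_witness)
    let ?t = "w - quantile f p"
    have t_hi: "ereal s < hi" if "s \<le> ?t" for s
    proof -
      have "ereal s \<le> ereal w" using that responds_uncut[OF f \<open>0 < p\<close> \<open>p < b\<close>] by simp
      also have "\<dots> < hi" using w by (simp add: einterval_def)
      finally show ?thesis .
    qed
    have strict: "g s < g u" if "s < u" "s \<le> ?t" for s u
      using uncut_strict[OF f g that(1) t_hi[OF that(2)]] .
    have "a' < g ?t" "g ?t < 1"
      using profile_bounds[OF p(3), of "?t - 1"] profile_bounds[OF p(3), of "?t + 1"]
        strict[of "?t - 1" ?t] strict[of ?t "?t + 1"] by auto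
    moreover from this have "quantile g (g ?t) = ?t"
      using strict by (intro quantile_of_value[OF p(3)]) auto
    ultimately show ?thesis using w by (intro exI[of _ "g ?t"]) auto
  qed
  from quantile_shift[OF f g f' g' cont cont' this]
  obtain d where d: "\<And>p. 0 < p \<Longrightarrow> p < b \<Longrightarrow> quantile f' p = quantile f p + d" by blast
  \<comment> \<open>a rank below both atoms at \<open>0\<close>; the bound \<open>b / 2\<close> keeps it below the top level\<close>
  define e where "e = min (min (f 0) (f' 0)) (b / 2)"
  have e: "0 < e" "e < b" using cut_atom[OF f g] cut_atom[OF f' g'] responds_levels[OF f] by (auto simp: e_def)
  have "quantile f e = 0" "quantile f' e = 0"
    using responds_uncut[OF f e] responds_uncut[OF f' e] quantile_le_iff[OF p(1) e, of 0] quantile_le_iff[OF p(2) e, of 0]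
    by (auto simp: e_def)
  then have "d = 0" using d[OF e] by simp
  then have ff: "f' t = f t" for t using d by (intro profile_eq_if_quantile_eq[OF p(1,2)]) auto
  then have "f' = f" by auto
  then show "f' t = f t" "g' t = g t" using responds_eq[OF g, of t] responds_eq[OF g', of t] by auto
qed

end

section \<open>The levels of a solution\<close>

lemma admissible_profile:
  assumes "admissible_tuple k h" "j \<le> k"
  shows "profile (h j) (Lim at_bot (h j)) (Lim at_top (h j))"
proof -
  have h: "mono (h j)" "cadlag (h j)" "Lim at_bot (h j) < Lim at_top (h j)"
    and range: "range (h j) \<subseteq> {0..1}"
    using assms by (auto simp: admissible_tuple_def)
  have h01: "0 \<le> h j t" "h j t \<le> 1" for t using range by (auto simp: image_subset_iff)
  obtain a where a: "(h j \<longlongrightarrow> a) at_bot" "0 \<le> a" by (rule mono_limit_at_bot[OF h(1) h01(1)]) blast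
  obtain b where b: "(h j \<longlongrightarrow> b) at_top" "b \<le> 1" by (rule mono_limit_at_top[OF h(1) h01(2)]) blast
  have "Lim at_bot (h j) = a" "Lim at_top (h j) = b" using a b by (auto intro: tendsto_Lim)
  then show ?thesis using h a b by (auto simp: profile_def cadlag_def)
qed

context matching_system
begin

text \<open>Both types at once: \<open>B\<close> stands for type B, in which \<open>h 0\<close> has
no cut, and \<open>lv\<close> lists the levels \<open>0 = lv 0 < \<dots> < lv (Suc k) = 1\<close>
between which the components rise.\<close>

definition solution :: "bool \<Rightarrow> nat \<Rightarrow> (nat \<Rightarrow> real \<Rightarrow> real) \<Rightarrow> (nat \<Rightarrow> real) \<Rightarrow> bool" where
  "solution B k h lv \<longleftrightarrow>
     (\<forall>j\<le>k. responds (h j) (h (k - j)) (lv j) (lv (Suc j)) (\<lambda>t. 0 < j \<or> B \<or> 0 \<le> t)) \<and>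
     lv 0 = 0 \<and> lv (Suc k) = 1 \<and> (B \<or> 1 \<le> k)"

lemma solution_responds: "solution B k h lv \<Longrightarrow> j \<le> k \<Longrightarrow>
    responds (h j) (h (k - j)) (lv j) (lv (Suc j)) (\<lambda>t. 0 < j \<or> B \<or> 0 \<le> t)"
  by (simp add: solution_def)

lemma solution_responds_full: "solution B k h lv \<Longrightarrow> j \<le> k \<Longrightarrow> 0 < j \<or> B \<Longrightarrow>
    responds (h j) (h (k - j)) (lv j) (lv (Suc j)) (\<lambda>_. True)"
  using solution_responds[of B k h lv j] by auto

lemma solution_profile: "solution B k h lv \<Longrightarrow> j \<le> k \<Longrightarrow> profile (h j) (lv j) (lv (Suc j))"
  using solution_responds responds_profile by blast

lemma responds_cadlag:
  assumes f: "responds f g a b U" and g: "unit_mono g"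
  shows "cadlag f"
  unfolding cadlag_def
proof (intro allI conjI)
  show "continuous (at_right t) f" for t using responds_profile[OF f] by (simp add: profile_def)
  show "\<exists>l. (f \<longlongrightarrow> l) (at_left t)" for t
  proof (cases "\<exists>s<t. U s")
    case True
    then obtain s where s: "s < t" "U s" by blast
    have "((\<lambda>t. T (K g t)) \<longlongrightarrow> T (K g t)) (at_left t)"
      using TK_cont[OF g, of t] by (metis continuous_at_imp_continuous_at_within continuous_within)
    then have "(f \<longlongrightarrow> T (K g t)) (at_left t)"
    proof (rule Lim_transform_eventually)
      show "\<forall>\<^sub>F x in at_left t. T (K g x) = f x"
        by (rule eventually_mono[OF eventually_at_left_real[OF s(1)]])
           (use responds_eq[OF f responds_up[OF f s(2)]] in auto)
    qed
    then show ?thesis by blast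
  next
    case False
    have "\<forall>\<^sub>F x in at_left t. x < t" by (simp add: eventually_at_filter)
    then have "\<forall>\<^sub>F x in at_left t. f x = a" by eventually_elim (use False responds_cut[OF f] in blast)
    then show ?thesis using tendsto_eventually by blast
  qed
qed

lemma solution_admissible:
  assumes s: "solution B k h lv"
  shows "admissible_tuple k h" "\<And>j. j \<le> k \<Longrightarrow> Lim at_bot (h j) = lv j"
    "\<And>j. j \<le> k \<Longrightarrow> Lim at_top (h j) = lv (Suc j)"
proof -
  note p = solution_profile[OF s]
  show bot: "Lim at_bot (h j) = lv j" if "j \<le> k" for j
    using p[OF that] by (intro tendsto_Lim) (auto simp: profile_def)
  show top: "Lim at_top (h j) = lv (Suc j)" if "j \<le> k" for j
    using p[OF that] by (intro tendsto_Lim) (auto simp: profile_def)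
  have "range (h j) \<subseteq> {0..1} \<and> mono (h j) \<and> cadlag (h j) \<and> Lim at_bot (h j) < Lim at_top (h j)"
    if "j \<le> k" for j
    using p[OF that] profile_unit_mono[OF p[OF that]] bot top that
      responds_cadlag[OF solution_responds[OF s that] profile_unit_mono[OF p[of "k - j"]]]
    by (auto simp: profile_def unit_mono_def)
  then show "admissible_tuple k h" using bot top by (auto simp: admissible_tuple_def)
qed

lemma typeA_equations_iff:
  "(\<exists>lv. solution False k h lv) \<longleftrightarrow> admissible_tuple k h \<and> 1 \<le> k \<and>
     (\<forall>j t. 0 < j \<and> j \<le> k \<longrightarrow> h j t = T (K (h (k - j)) t)) \<and>
     (\<forall>t. h 0 t = indicator {0..} t * T (K (h k) t))" (is "?L \<longleftrightarrow> ?R")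
proof
  assume ?L
  then obtain lv where s: "solution False k h lv" by blast
  have "h j t = T (K (h (k - j)) t)" if "0 < j" "j \<le> k" for j t
    using responds_eq[OF solution_responds[OF s that(2)], of t] that by simp
  moreover have "h 0 t = indicator {0..} t * T (K (h k) t)" for t
    using responds_eq[OF solution_responds[OF s], of 0 t] responds_cut[OF solution_responds[OF s], of 0 t] s
    by (cases "0 \<le> t") (auto simp: solution_def)
  ultimately show ?R using solution_admissible[OF s] s by (auto simp: solution_def)
next
  assume R: ?R
  define lv where "lv j = (if j \<le> k then Lim at_bot (h j) else Lim at_top (h k))" for j
  have p: "profile (h j) (lv j) (lv (Suc j))" if "j \<le> k" for j
    using admissible_profile[of k h j] R that by (cases "j = k") (auto simp: lv_def admissible_tuple_def)
  have "(h 0 \<longlongrightarrow> 0) at_bot"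
    using R by (intro tendsto_eventually) (auto simp: eventually_at_bot_linorder intro!: exI[of _ "-1"])
  then have lv0: "lv 0 = 0" by (simp add: lv_def tendsto_Lim)
  have responds: "responds (h j) (h (k - j)) (lv j) (lv (Suc j)) (\<lambda>t. 0 < j \<or> False \<or> 0 \<le> t)" if "j \<le> k" for j
    using p[OF that] R that lv0 by (cases "j = 0") (auto simp: responds_def)
  have "(h k \<longlongrightarrow> T (lv 0)) at_top"
    by (rule Lim_transform_eventually[OF TK_at_top[OF profile_unit_mono[OF p[of 0]]]])
       (use R p[of 0] in \<open>auto simp: profile_def\<close>)
  moreover have "(h k \<longlongrightarrow> lv (Suc k)) at_top" using p[of k] by (simp add: profile_def)
  ultimately have "T (lv 0) = lv (Suc k)" by (rule tendsto_unique[rotated]) simp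
  then show ?L using responds lv0 T_0 R by (auto simp: solution_def intro!: exI[of _ lv])
qed

lemma typeB_equations_iff:
  "(\<exists>lv. solution True k h lv) \<longleftrightarrow> admissible_tuple k h \<and>
     (\<forall>j t. j \<le> k \<longrightarrow> h j t = T (K (h (k - j)) t)) \<and> Lim at_bot (h 0) = 0 \<and> Lim at_top (h k) = 1"
  (is "?L \<longleftrightarrow> ?R")
proof
  assume ?L
  then obtain lv where s: "solution True k h lv" by blast
  have "h j t = T (K (h (k - j)) t)" if "j \<le> k" for j t
    using responds_eq[OF solution_responds[OF s that], of t] by simp
  then show ?R using solution_admissible[OF s] s by (auto simp: solution_def)
next
  assume R: ?R
  define lv where "lv j = (if j \<le> k then Lim at_bot (h j) else Lim at_top (h k))" for j
  have p: "profile (h j) (lv j) (lv (Suc j))" if "j \<le> k" for j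
    using admissible_profile[of k h j] R that by (cases "j = k") (auto simp: lv_def admissible_tuple_def)
  have "responds (h j) (h (k - j)) (lv j) (lv (Suc j)) (\<lambda>t. 0 < j \<or> True \<or> 0 \<le> t)" if "j \<le> k" for j
    using p[OF that] R that by (auto simp: responds_def)
  then show ?L using R by (auto simp: solution_def lv_def intro!: exI[of _ lv])
qed

lemma solution_levels_less: "solution B k h lv \<Longrightarrow> j \<le> k \<Longrightarrow> lv j < lv (Suc j)"
  using solution_profile by (auto simp: profile_def)

lemma solution_levels_mono:
  assumes s: "solution B k h lv" and ij: "i < j" "j \<le> Suc k"
  shows "lv i < lv j"
  using ij
proof (induction j)
  case (Suc j)
  then show ?case using solution_levels_less[OF s, of j] by (cases "i = j") auto
qed simp

lemma solution_levels_unit: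
  assumes s: "solution B k h lv" and j: "j \<le> Suc k"
  shows "lv j \<in> {0..1}"
proof -
  have "lv 0 \<le> lv j" "lv j \<le> lv (Suc k)"
    using solution_levels_mono[OF s, of 0 j] solution_levels_mono[OF s, of j "Suc k"] j
    by (cases "j = 0"; cases "j = Suc k"; auto)+
  then show ?thesis using s by (simp add: solution_def)
qed

lemma solution_T_level:
  assumes s: "solution B k h lv" and j: "j \<le> k"
  shows "T (lv j) = lv (Suc k - j)"
proof -
  note p = solution_profile[OF s]
  have "\<forall>\<^sub>F t in at_top. T (K (h j) t) = h (k - j) t"
    using responds_eq[OF solution_responds[OF s], of "k - j"] j
    by (auto simp: eventually_at_top_linorder intro!: exI[of _ 0])
  then have "(h (k - j) \<longlongrightarrow> T (lv j)) at_top"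
    using p[OF j] by (intro Lim_transform_eventually[OF TK_at_top[OF profile_unit_mono[OF p[OF j]]]])
      (auto simp: profile_def)
  moreover have "(h (k - j) \<longlongrightarrow> lv (Suc (k - j))) at_top" using p[of "k - j"] by (simp add: profile_def)
  ultimately have "T (lv j) = lv (Suc (k - j))" by (rule tendsto_unique[rotated]) simp
  then show ?thesis using j by (simp add: Suc_diff_le)
qed

lemma solution_T_top:
  assumes s: "solution True k h lv"
  shows "T 1 = 0"
proof -
  note p = solution_profile[OF s]
  have "(h 0 \<longlongrightarrow> T (lv (Suc k))) at_bot"
    by (rule Lim_transform_eventually[OF TK_at_bot[OF profile_unit_mono[OF p[of k]]]])
       (use responds_eq[OF solution_responds[OF s], of 0] p[of k] in \<open>auto simp: profile_def\<close>)
  moreover have "(h 0 \<longlongrightarrow> lv 0) at_bot" using p[of 0] by (simp add: profile_def)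
  ultimately have "T (lv (Suc k)) = lv 0" by (rule tendsto_unique[rotated]) simp
  then show ?thesis using s by (simp add: solution_def)
qed

lemma solution_T_level_ge:
  assumes s: "solution B k h lv" and j: "j \<le> Suc k"
  shows "lv (Suc k - j) \<le> T (lv j)"
proof (cases "j = Suc k")
  case True
  then show ?thesis using s T_1 by (simp add: solution_def)
next
  case False
  then show ?thesis using solution_T_level[OF s, of j] j by simp
qed

lemma solution_corner_right:
  assumes s: "solution B k h lv" and j: "j < k \<or> B" "j \<le> k"
    and x: "x \<in> {lv j..lv (Suc j)}" "y \<in> {lv (k - j)..lv (Suc k - j)}"
  shows "energy x y \<le> energy (lv (Suc j)) (lv (k - j))"
proof (rule energy_corner_maximal[OF solution_responds[OF s j(2)]])
  show g: "responds (h (k - j)) (h j) (lv (k - j)) (lv (Suc (k - j))) (\<lambda>_. True)"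
    using solution_responds_full[OF s, of "k - j"] j by auto
  show "free (h (k - j)) (\<lambda>_. True) q" if "lv (k - j) < q" for q
    by (rule free_if_uncut[OF g that])
qed (use x j in \<open>auto simp: Suc_diff_le\<close>)

lemma solution_corner_left:
  assumes s: "solution B k h lv" and j: "0 < j \<or> B" "j \<le> k"
    and x: "x \<in> {lv j..lv (Suc j)}" "y \<in> {lv (k - j)..lv (Suc k - j)}"
  shows "energy x y \<le> energy (lv j) (lv (Suc k - j))"
proof -
  have "energy y x \<le> energy (lv (Suc (k - j))) (lv (k - (k - j)))"
    using x j by (intro solution_corner_right[OF s, of "k - j"]) (auto simp: Suc_diff_le)
  then show ?thesis using j by (simp add: energy_commute[of x] energy_commute[of "lv j"] Suc_diff_le)
qed

text \<open>The rectangles spanned by the levels of \<open>h\<^sub>j\<close> and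
\<open>h\<^bsub>k-j\<^esub>\<close> form a staircase that \<open>T\<close> reflects into itself,
since it maps each level to the opposite one.\<close>

lemma solution_square:
  assumes s: "solution B k h lv" and z: "z \<in> {0..1}"
  obtains j where "j \<le> k" "T (T z) \<in> {lv j..lv (Suc j)}" "T z \<in> {lv (k - j)..lv (Suc k - j)}"
proof -
  have map: "T x \<in> {lv (k - j)..lv (Suc k - j)}" if j: "j \<le> k" and x: "x \<in> {lv j..lv (Suc j)}" for x j
  proof -
    have u: "lv j \<in> {0..1}" "lv (Suc j) \<in> {0..1}" using solution_levels_unit[OF s] j by auto
    then have "T (lv (Suc j)) \<le> T x" "T x \<le> T (lv j)" using x by (auto intro: T_le)
    then show ?thesis
      using solution_T_level_ge[OF s, of "Suc j"] solution_T_level[OF s j] j by auto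
  qed
  have "\<exists>j\<le>i. z \<in> {lv j..lv (Suc j)}" if "z \<le> lv (Suc i)" "i \<le> k" for i
    using that
  proof (induction i)
    case 0
    then show ?case using z s by (auto simp: solution_def)
  next
    case (Suc i)
    then show ?case by (cases "z \<le> lv (Suc i)") (auto intro: le_SucI)
  qed
  then obtain j where j: "j \<le> k" "z \<in> {lv j..lv (Suc j)}"
    using z s by (metis atLeastAtMost_iff order_refl solution_def)
  have "T (T z) \<in> {lv (k - (k - j))..lv (Suc k - (k - j))}"
    using map[OF j] j by (intro map) (auto simp: Suc_diff_le)
  then show ?thesis using that[of j] map[OF j] j by (simp add: Suc_diff_le)
qed

text \<open>Neighbouring corners of the staircase bound each other's energy, so all admissible
corners have the same energy, and it is at least the energy on every rectangle.\<close>

lemma solution_levels_maximize: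
  assumes s: "solution B k h lv" and j: "0 < j \<or> B" "j \<le> k \<or> B" "j \<le> Suc k"
  shows "lv j \<in> maximizers"
proof -
  let ?e = "\<lambda>j. energy (lv j) (lv (Suc k - j))"
  have step: "?e j = ?e (Suc j)" if "0 < j \<or> B" "j < k \<or> B" "j \<le> k" for j
  proof -
    have l: "lv j \<le> lv (Suc j)" "lv (k - j) \<le> lv (Suc k - j)"
      using solution_levels_less[OF s, of j] solution_levels_less[OF s, of "k - j"] that
      by (auto simp: Suc_diff_le)
    show ?thesis
    proof (rule antisym)
      show "?e j \<le> ?e (Suc j)"
        using solution_corner_right[OF s that(2,3), of "lv j" "lv (Suc k - j)"] l by simp
      show "?e (Suc j) \<le> ?e j"
        using solution_corner_left[OF s that(1,3), of "lv (Suc j)" "lv (k - j)"] l by simp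
    qed
  qed
  \<comment> \<open>for type A the corner at \<open>0\<close> is not admissible: ranks below the atom of \<open>h 0\<close> are not free\<close>
  define i0 where "i0 = (if B then 0 else 1 :: nat)"
  have const: "?e i = ?e i0" if "i0 \<le> i" "i \<le> k \<or> B" "i \<le> Suc k" for i
    using that
  proof (induction i rule: dec_induct)
    case (step n)
    then show ?case using \<open>\<And>j. 0 < j \<or> B \<Longrightarrow> j < k \<or> B \<Longrightarrow> j \<le> k \<Longrightarrow> ?e j = ?e (Suc j)\<close>[of n]
      by (auto simp: i0_def split: if_splits)
  qed simp
  have max: "energy (T (T z)) (T z) \<le> ?e i0" if z: "z \<in> {0..1}" for z
  proof -
    obtain i where i: "i \<le> k" "T (T z) \<in> {lv i..lv (Suc i)}" "T z \<in> {lv (k - i)..lv (Suc k - i)}"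
      by (rule solution_square[OF s z])
    show ?thesis
    proof (cases "0 < i \<or> B")
      case True
      then have "energy (T (T z)) (T z) \<le> ?e i" using i by (intro solution_corner_left[OF s]) auto
      also have "?e i = ?e i0" using True i by (intro const) (auto simp: i0_def)
      finally show ?thesis .
    next
      case False
      then have "0 < k" using s by (auto simp: solution_def)
      then have "energy (T (T z)) (T z) \<le> ?e (Suc i)"
        using solution_corner_right[OF s _ i] False by simp
      then show ?thesis using False by (simp add: i0_def)
    qed
  qed
  have j': "i0 \<le> j" using j by (auto simp: i0_def)
  show ?thesis
  proof (rule maximizers_energy[of "lv j" "lv (Suc k - j)"])
    show "lv j \<in> {0..1}" "lv (Suc k - j) \<in> {0..1}" using solution_levels_unit[OF s] j by auto
    have ends: "lv 0 = 0" "lv (Suc k) = 1" "j = Suc k \<Longrightarrow> B" using s j by (auto simp: solution_def)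
    show "T (lv j) = lv (Suc k - j)"
      using solution_T_level[OF s, of j] solution_T_top[of k h lv] s ends j by (cases "j = Suc k") auto
    show "T (lv (Suc k - j)) = lv j"
      using solution_T_level[OF s, of "Suc k - j"] solution_T_top[of k h lv] s ends j
      by (cases "j = 0") auto
    show "energy (T (T z)) (T z) \<le> ?e j" if "z \<in> {0..1}" for z
      using max[OF that] const[OF j' j(2,3)] by simp
  qed
qed

text \<open>Type B is excluded because it would make \<open>0\<close> and \<open>1\<close> two
different maximisers.\<close>

lemma solution_structure_single:
  assumes s: "solution B k h lv" and m: "maximizers = {\<gamma>}"
  shows "\<not> B \<and> k = 1 \<and> lv 1 = \<gamma>"
proof -
  note max = solution_levels_maximize[OF s, unfolded m]
  have e: "lv 0 = 0" "lv (Suc k) = 1" "B \<or> 1 \<le> k" using s by (auto simp: solution_def)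
  have B: "\<not> B" using max[of 0] max[of "Suc k"] e by auto
  then have 1: "lv 1 = \<gamma>" using max[of 1] e by auto
  have "k = 1"
  proof (rule ccontr)
    assume "k \<noteq> 1"
    then have "2 \<le> k" using B e by auto
    then show False using max[of 2] 1 solution_levels_mono[OF s, of 1 2] by auto
  qed
  then show ?thesis using B 1 by simp
qed

text \<open>The case \<open>k = 1\<close> is excluded because its only interior level would be fixed
by \<open>T\<close>, which exchanges the two maximisers.\<close>

lemma solution_structure_two:
  assumes s: "solution B k h lv" and m: "maximizers = {\<gamma>1, \<gamma>2}" "\<gamma>1 < \<gamma>2" "0 < \<gamma>1"
  shows "\<not> B \<and> k = 2 \<and> lv 1 = \<gamma>1 \<and> lv 2 = \<gamma>2"
proof -
  note max = solution_levels_maximize[OF s, unfolded m(1)]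
  note sw = maximizers_two[OF m(1,2)]
  have e: "lv 0 = 0" "lv (Suc k) = 1" "B \<or> 1 \<le> k" using s by (auto simp: solution_def)
  have B: "\<not> B" using max[of 0] e m by auto
  have 1: "lv 1 \<in> {\<gamma>1, \<gamma>2}" using max[of 1] e B by auto
  have k1: "k \<noteq> 1"
  proof
    assume "k = 1"
    then have "T (lv 1) = lv 1" using solution_T_level[OF s, of 1] by simp
    then show False using 1 sw m(2) by auto
  qed
  then have 2: "lv 2 \<in> {\<gamma>1, \<gamma>2}" "lv 1 < lv 2"
    using max[of 2] e B solution_levels_mono[OF s, of 1 2] by auto
  have "k = 2"
  proof (rule ccontr)
    assume "k \<noteq> 2"
    then have "lv 3 \<in> {\<gamma>1, \<gamma>2}" "lv 2 < lv 3"
      using max[of 3] e B k1 solution_levels_mono[OF s, of 2 3] by auto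
    then show False using 1 2 by auto
  qed
  then show ?thesis using B 1 2 m(2) by auto
qed

lemma solution_structure_extreme:
  assumes s: "solution B k h lv" and m: "maximizers = {0, 1}"
  shows "B \<and> k = 0"
proof -
  note max = solution_levels_maximize[OF s, unfolded m]
  have e: "lv 0 = 0" "lv (Suc k) = 1" using s by (auto simp: solution_def)
  have k: "k = 0"
  proof (rule ccontr)
    assume "k \<noteq> 0"
    then have "lv 1 \<in> {0, 1}" "lv 0 < lv 1" "lv 1 < lv (Suc k)"
      using max[of 1] solution_levels_mono[OF s, of 0 1] solution_levels_mono[OF s, of 1 "Suc k"] by auto
    then show False using e by auto
  qed
  then show ?thesis using s by (auto simp: solution_def)
qed

end

section \<open>The associated law\<close>

definition has_partial_cdfs :: "nat \<Rightarrow> (nat \<Rightarrow> real \<Rightarrow> real) \<Rightarrow> (nat \<times> real) measure \<Rightarrow> bool" where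
  "has_partial_cdfs k h \<zeta> \<longleftrightarrow>
     prob_space \<zeta> \<and> sets \<zeta> = sets (count_space {..k} \<Otimes>\<^sub>M borel) \<and>
     (\<forall>j\<le>k. \<forall>t. measure \<zeta> ({j} \<times> {..t}) = h j t - Lim at_bot (h j))"

lemma has_partial_cdfs_unique:
  assumes Z: "has_partial_cdfs k h \<zeta>" "has_partial_cdfs k h \<zeta>'"
  shows "\<zeta> = \<zeta>'"
proof -
  interpret Z: prob_space \<zeta> using Z by (simp add: has_partial_cdfs_def)
  interpret Z': prob_space \<zeta>' using Z by (simp add: has_partial_cdfs_def)
  define Ea where "Ea = insert {} ((\<lambda>j. {j}) ` {..k})"
  define Eb where "Eb = range (\<lambda>t::real. {..t})"
  define E where "E = {a \<times> b | a b. a \<in> Ea \<and> b \<in> Eb}"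
  have covb: "(\<Union>n::nat. {..real n}) = UNIV" using real_arch_simple by auto
  have "sets (count_space {..k} \<Otimes>\<^sub>M (borel :: real measure)) = sets (sigma (space (count_space {..k}) \<times> space borel) E)"
    unfolding E_def
  proof (rule sets_pair_eq[where Ca = Ea and Cb = "(\<lambda>n::nat. {..real n}) ` UNIV"])
    show "sets (count_space {..k}) = sigma_sets (space (count_space {..k})) Ea"
    proof
      show "sets (count_space {..k}) \<subseteq> sigma_sets (space (count_space {..k})) Ea"
      proof
        fix A assume "A \<in> sets (count_space {..k})"
        then have A: "A \<subseteq> {..k}" by simp
        interpret sigma_algebra "{..k}" "sigma_sets {..k} Ea"
          by (rule sigma_algebra_sigma_sets) (auto simp: Ea_def)
        have "(\<Union>j\<in>A. {j}) \<in> sigma_sets {..k} Ea"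
          using A finite_subset[OF A] by (intro finite_UN) (auto simp: Ea_def)
        then show "A \<in> sigma_sets (space (count_space {..k})) Ea" by simp
      qed
      show "sigma_sets (space (count_space {..k})) Ea \<subseteq> sets (count_space {..k})"
        by (rule sets.sigma_sets_subset') (auto simp: Ea_def)
    qed
    have "sets (borel :: real measure) = sets (sigma UNIV (range (\<lambda>t::real. {..t})))"
      by (subst borel_eq_atMost) simp
    then show "sets borel = sigma_sets (space borel) Eb" by (simp add: Eb_def)
    show "countable Ea" by (simp add: Ea_def)
  qed (use covb in \<open>auto simp: Ea_def Eb_def\<close>)
  then have gen: "sets (count_space {..k} \<Otimes>\<^sub>M (borel :: real measure)) = sigma_sets ({..k} \<times> UNIV) E"
    by (subst (asm) sets_measure_of) (auto simp: E_def Ea_def)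
  show ?thesis
  proof (rule measure_eqI_generator_eq_countable[where E = E and \<Omega> = "{..k} \<times> UNIV"
        and A = "(\<lambda>(j, n). {j} \<times> {..real n}) ` ({..k} \<times> (UNIV :: nat set))"])
    show "Int_stable E"
    proof (rule Int_stableI)
      fix A B assume "A \<in> E" "B \<in> E"
      then obtain a b c d where AB: "A = a \<times> b" "a \<in> Ea" "b \<in> Eb" "B = c \<times> d" "c \<in> Ea" "d \<in> Eb"
        by (auto simp: E_def)
      have "a \<inter> c \<in> Ea" using AB by (auto simp: Ea_def)
      moreover have "b \<inter> d \<in> Eb"
      proof -
        obtain s t where "b = {..s}" "d = {..t}" using AB by (auto simp: Eb_def)
        then have "b \<inter> d = {..min s t}" by auto
        then show ?thesis by (simp add: Eb_def)
      qed
      ultimately show "A \<inter> B \<in> E" using AB by (auto simp: E_def Times_Int_Times)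
    qed
    show "emeasure \<zeta> A = emeasure \<zeta>' A" if "A \<in> E" for A
      using that Z by (auto simp: E_def Ea_def Eb_def has_partial_cdfs_def Z.emeasure_eq_measure Z'.emeasure_eq_measure)
    show "sets \<zeta> = sigma_sets ({..k} \<times> UNIV) E" "sets \<zeta>' = sigma_sets ({..k} \<times> UNIV) E"
      using Z gen by (auto simp: has_partial_cdfs_def)
    show "(\<Union>((\<lambda>(j, n). {j} \<times> {..real n}) ` ({..k} \<times> (UNIV :: nat set)))) = {..k} \<times> UNIV"
      using covb by auto
  qed (auto simp: E_def Ea_def Eb_def Z.emeasure_eq_measure)
qed

text \<open>The law is the image of a uniform rank \<open>p\<close> under the map that sends
\<open>p\<close> to the index of the component whose levels surround it and to the quantile of that
component. The levels themselves form a null set, on which arbitrary values are taken.\<close>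

lemma has_partial_cdfs_exists:
  assumes p: "\<And>j. j \<le> k \<Longrightarrow> profile (h j) (lv j) (lv (Suc j))"
    and ends: "lv 0 = 0" "lv (Suc k) = 1"
  obtains \<zeta> where "has_partial_cdfs k h \<zeta>"
proof -
  have less: "lv j < lv (Suc j)" if "j \<le> k" for j using p[OF that] by (simp add: profile_def)
  have mono: "lv i \<le> lv j" if "i \<le> j" "j \<le> Suc k" for i j
    using that
  proof (induction j rule: dec_induct)
    case (step n)
    then show ?case using less[of n] by simp
  qed simp
  define I where "I j = {lv j<..<lv (Suc j)}" for j
  define \<iota> where "\<iota> p = card {i \<in> {1..k}. lv i < p}" for p
  define X where "X p = (\<Sum>j\<le>k. indicator (I j) p * quantile (h j) p)" for p
  have \<iota>_eq: "\<iota> p = j" if "j \<le> k" "p \<in> I j" for p j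
  proof -
    have "i \<in> {i \<in> {1..k}. lv i < p} \<longleftrightarrow> i \<in> {1..j}" for i
    proof (cases "i \<le> j")
      case True
      then show ?thesis using that mono[of i j] by (auto simp: I_def)
    next
      case False
      then show ?thesis using that mono[of "Suc j" i] by (auto simp: I_def)
    qed
    then have "{i \<in> {1..k}. lv i < p} = {1..j}" by blast
    then show ?thesis by (simp add: \<iota>_def)
  qed
  have X_eq: "X p = quantile (h j) p" if "j \<le> k" "p \<in> I j" for p j
  proof -
    have "X p = (\<Sum>i\<le>k. if i = j then quantile (h j) p else 0)"
      unfolding X_def using that \<iota>_eq by (intro sum.cong) (auto simp: indicator_def)
    then show ?thesis using that by simp
  qed
  have X_meas: "X \<in> borel_measurable borel"
    unfolding X_def
  proof (intro borel_measurable_sum)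
    fix j assume j: "j \<in> {..k}"
    have "quantile (h j) \<in> borel_measurable (restrict_space borel (I j))"
      using quantile_measurable[OF p[of j]] j
      by (simp add: I_def cong: measurable_cong_sets add: sets_slab)
    then show "(\<lambda>p. indicator (I j) p * quantile (h j) p) \<in> borel_measurable borel"
      by (subst (asm) borel_measurable_restrict_space_iff) (auto simp: I_def)
  qed
  have \<iota>_real: "(\<lambda>p. real (\<iota> p)) = (\<lambda>p. \<Sum>i\<in>{1..k}. indicator {lv i<..} p)"
  proof
    fix p
    have "(\<Sum>i\<in>{1..k}. indicator {lv i<..} p :: real) = (\<Sum>i\<in>{1..k}. if lv i < p then 1 else 0)"
      by (intro sum.cong) (auto simp: indicator_def)
    then show "real (\<iota> p) = (\<Sum>i\<in>{1..k}. indicator {lv i<..} p)"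
      by (simp add: \<iota>_def sum.If_cases Int_def conj_commute)
  qed
  have \<iota>_le: "\<iota> p \<le> k" for p
  proof -
    have "\<iota> p \<le> card {1..k}" unfolding \<iota>_def by (rule card_mono) auto
    then show ?thesis by simp
  qed
  have \<iota>_meas: "\<iota> \<in> borel \<rightarrow>\<^sub>M count_space {..k}"
    unfolding measurable_count_space_eq2[OF finite_atMost]
  proof (intro conjI ballI)
    fix a assume "a \<in> {..k}"
    have [measurable]: "(\<lambda>p. real (\<iota> p)) \<in> borel_measurable borel" unfolding \<iota>_real by measurable
    have "{p \<in> space borel. real (\<iota> p) = real a} \<in> sets borel" by measurable
    moreover have "\<iota> -` {a} \<inter> space borel = {p \<in> space borel. real (\<iota> p) = real a}" by auto
    ultimately show "\<iota> -` {a} \<inter> space borel \<in> sets borel" by simp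
  qed (use \<iota>_le in auto)
  have f_meas [measurable]: "(\<lambda>p. (\<iota> p, X p)) \<in> slab 0 1 \<rightarrow>\<^sub>M count_space {..k} \<Otimes>\<^sub>M borel"
    unfolding slab_def using \<iota>_meas X_meas
    by (intro measurable_restrict_space1 measurable_Pair) simp_all
  define \<zeta> where "\<zeta> = distr (slab 0 1) (count_space {..k} \<Otimes>\<^sub>M borel) (\<lambda>p. (\<iota> p, X p))"
  interpret U: prob_space "slab 0 1"
    by (rule prob_spaceI) (simp add: emeasure_slab)
  have "prob_space \<zeta>" unfolding \<zeta>_def by (rule U.prob_space_distr[OF f_meas])
  moreover have "sets \<zeta> = sets (count_space {..k} \<Otimes>\<^sub>M borel)" by (simp add: \<zeta>_def)
  moreover have "measure \<zeta> ({j} \<times> {..t}) = h j t - Lim at_bot (h j)" if j: "j \<le> k" for j t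
  proof -
    have I01: "I j \<subseteq> {0<..<1}" using mono[of 0 j] mono[of "Suc j" "Suc k"] j ends by (auto simp: I_def)
    have A: "{j} \<times> {..t} \<in> sets (count_space {..k} \<Otimes>\<^sub>M borel)" using j by (intro pair_measureI) auto
    let ?A = "(\<lambda>p. (\<iota> p, X p)) -` ({j} \<times> {..t}) \<inter> space (slab 0 1)"
    let ?B = "{p \<in> I j. p \<le> h j t}"
    have B: "?B \<in> sets borel" unfolding I_def by simp
    have "measure \<zeta> ({j} \<times> {..t}) = measure (slab 0 1) ?A"
      unfolding \<zeta>_def by (rule measure_distr[OF f_meas A])
    also have "\<dots> = measure (slab 0 1) ?B"
    proof (rule U.finite_measure_eq_AE)
      have "AE p in lborel. p \<notin> lv ` {..Suc k}"
        by (rule AE_not_in) (simp add: finite_imp_null_set_lborel)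
      then have "AE p in slab 0 1. p \<notin> lv ` {..Suc k}"
        unfolding slab_def by (subst AE_restrict_space_iff) auto
      then show "AE p in slab 0 1. p \<in> ?A \<longleftrightarrow> p \<in> ?B"
      proof (rule AE_mp, intro AE_I2 impI)
        fix p assume "p \<in> space (slab 0 1)" and out: "p \<notin> lv ` {..Suc k}"
        then have p01: "0 < p" "p < 1" by auto
        have "\<exists>i\<le>n. p \<in> I i" if "p < lv (Suc n)" "n \<le> k" for n
          using that
        proof (induction n)
          case 0
          then show ?case using p01 ends by (auto simp: I_def)
        next
          case (Suc n)
          have "p \<noteq> lv (Suc n)" using out Suc.prems by auto
          then show ?case using Suc by (cases "p < lv (Suc n)") (auto simp: I_def intro: le_SucI)
        qed
        from this[of k] obtain i where i: "i \<le> k" "p \<in> I i" using p01 ends by auto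
        show "p \<in> ?A \<longleftrightarrow> p \<in> ?B"
        proof (cases "i = j")
          case True
          then show ?thesis
            using i \<iota>_eq[OF i] X_eq[OF i] quantile_le_iff[OF p[OF j], of p t] p01 by (auto simp: I_def)
        next
          case False
          then have "p \<notin> I j" using \<iota>_eq[OF j] \<iota>_eq[OF i] by auto
          then show ?thesis using False \<iota>_eq[OF i] by auto
        qed
      qed
      show "?A \<in> sets (slab 0 1)" by (rule measurable_sets[OF f_meas A])
      show "?B \<in> sets (slab 0 1)"
        using B I01 by (auto simp: sets_slab sets_restrict_space intro!: image_eqI[of _ _ ?B])
    qed
    also have "\<dots> = measure (slab (lv j) (lv (Suc j))) ?B"
      unfolding measure_def using B I01 by (subst (1 2) emeasure_slab) (auto simp: I_def)
    also have "\<dots> = h j t - lv j"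
      unfolding I_def using measure_slab[OF less[OF j]] profile_bounds[OF p[OF j], of t] by auto
    also have "lv j = Lim at_bot (h j)"
      using p[OF j] by (intro tendsto_Lim[symmetric]) (auto simp: profile_def)
    finally show ?thesis .
  qed
  ultimately have "has_partial_cdfs k h \<zeta>" by (simp add: has_partial_cdfs_def)
  then show ?thesis by (rule that)
qed

lemma assoc_law_has_partial_cdfs:
  assumes "\<And>j. j \<le> k \<Longrightarrow> profile (h j) (lv j) (lv (Suc j))" "lv 0 = 0" "lv (Suc k) = 1"
  shows "has_partial_cdfs k h (assoc_law k h)"
proof -
  obtain \<zeta> where z: "has_partial_cdfs k h \<zeta>" by (rule has_partial_cdfs_exists[OF assms])
  have "assoc_law k h = (THE \<zeta>. has_partial_cdfs k h \<zeta>)"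
    by (simp add: assoc_law_def has_partial_cdfs_def)
  then show ?thesis
    using theI'[of "has_partial_cdfs k h"] z has_partial_cdfs_unique by metis
qed

lemma assoc_law_cong:
  assumes "\<And>j. j \<le> k \<Longrightarrow> h j = h' j"
  shows "assoc_law k h = assoc_law k h'"
proof -
  have "has_partial_cdfs k h = has_partial_cdfs k h'"
    using assms by (simp add: has_partial_cdfs_def fun_eq_iff[of "has_partial_cdfs k h"] cong: conj_cong)
  then show ?thesis by (simp add: assoc_law_def has_partial_cdfs_def[abs_def] fun_eq_iff)
qed

lemma index_law_singleton:
  assumes p: "\<And>j. j \<le> k \<Longrightarrow> profile (h j) (lv j) (lv (Suc j))" and ends: "lv 0 = 0" "lv (Suc k) = 1"
  shows "emeasure (index_law k h) {j} = (if j \<le> k then ennreal (lv (Suc j) - lv j) else 0)"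
proof -
  let ?Z = "assoc_law k h"
  have Z: "has_partial_cdfs k h ?Z" by (rule assoc_law_has_partial_cdfs[OF assms])
  then interpret Z: prob_space ?Z by (simp add: has_partial_cdfs_def)
  have sets: "sets ?Z = sets (count_space {..k} \<Otimes>\<^sub>M borel)" using Z by (simp add: has_partial_cdfs_def)
  then have space: "space ?Z = {..k} \<times> UNIV" by (auto dest: sets_eq_imp_space_eq simp: space_pair_measure)
  have "fst \<in> count_space {..k} \<Otimes>\<^sub>M (borel :: real measure) \<rightarrow>\<^sub>M count_space UNIV"
    by (rule measurable_compose[OF measurable_fst]) simp
  then have fst: "fst \<in> ?Z \<rightarrow>\<^sub>M count_space UNIV" using measurable_cong_sets[OF sets refl] by blast
  have E: "emeasure (index_law k h) {j} = emeasure ?Z (fst -` {j} \<inter> space ?Z)"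
    unfolding index_law_def by (rule emeasure_distr[OF fst]) simp
  show ?thesis
  proof (cases "j \<le> k")
    case False
    then have "fst -` {j} \<inter> space ?Z = {}" by (auto simp: space)
    then show ?thesis using E False by simp
  next
    case True
    have pre: "fst -` {j} \<inter> space ?Z = (\<Union>n::nat. {j} \<times> {..real n})"
      using True real_arch_simple by (auto simp: space)
    have lim: "(\<lambda>n. measure ?Z ({j} \<times> {..real n})) \<longlonglongrightarrow> measure ?Z (\<Union>n::nat. {j} \<times> {..real n})"
    proof (rule Z.finite_Lim_measure_incseq)
      show "range (\<lambda>n::nat. {j} \<times> {..real n}) \<subseteq> sets ?Z"
        unfolding sets using True by (auto intro!: pair_measureI)
    qed (auto simp: incseq_def)
    have bot: "Lim at_bot (h j) = lv j" and top: "(h j \<longlongrightarrow> lv (Suc j)) at_top"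
      using p[OF True] by (auto intro!: tendsto_Lim simp: profile_def)
    have "(\<lambda>n. h j (real n) - lv j) \<longlonglongrightarrow> lv (Suc j) - lv j"
      by (intro tendsto_intros filterlim_compose[OF top filterlim_real_sequentially])
    then have "measure ?Z (\<Union>n::nat. {j} \<times> {..real n}) = lv (Suc j) - lv j"
      using LIMSEQ_unique[OF lim] Z True bot by (simp add: has_partial_cdfs_def)
    then show ?thesis using E pre True by (simp add: Z.emeasure_eq_measure)
  qed
qed

lemma index_law_eqI:
  assumes "\<And>j. emeasure (index_law k h) {j} = w j"
  shows "index_law k h = point_measure UNIV w"
  by (rule measure_eqI_countable[where A = UNIV])
     (auto simp: index_law_def assms[unfolded index_law_def] emeasure_point_measure_finite2 sets_point_measure)

section \<open>Existence, uniqueness and the index\<close>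

lemma card_2_less_cases:
  fixes A :: "real set"
  assumes "card A = 2"
  obtains x y where "A = {x, y}" "x < y"
proof -
  obtain x y where A: "A = {x, y}" "x \<noteq> y" using assms by (auto simp: card_2_iff)
  then consider "x < y" | "y < x" by linarith
  then show ?thesis using A that[of x y] that[of y x] by cases auto
qed

context matching_system
begin

lemma solution_index_law:
  assumes s: "solution B k h lv"
  shows "emeasure (index_law k h) {j} = (if j \<le> k then ennreal (lv (Suc j) - lv j) else 0)"
  by (rule index_law_singleton[of k h lv, OF solution_profile[OF s]])
     (use s in \<open>auto simp: solution_def\<close>)

text \<open>The number of maximisers decides which of the limits of \<open>exists_layers\<close> are
nonconstant and have to be listed.\<close>

lemma exists_solution:
  assumes "finite maximizers" "card maximizers \<le> 2"
  obtains B k h lv where "solution B k h lv"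
proof -
  obtain f g c x y u v where
    eqs: "\<And>t. f t = (if 0 \<le> t then T (K g t) else 0)" "\<And>t. g t = T (K f t)" "\<And>t. c t = T (K c t)"
    and um: "unit_mono f" "unit_mono g" "unit_mono c"
    and lim: "(f \<longlongrightarrow> x) at_top" "(g \<longlongrightarrow> y) at_bot" "(c \<longlongrightarrow> u) at_bot" "(c \<longlongrightarrow> v) at_top"
    and xy: "x = T y" "y = T x" "u = T v" "v = T u" "x \<le> y" "u \<le> v"
    and max: "x \<in> maximizers" "u \<in> maximizers"
    by (rule exists_layers) (rule that)
  have bot: "(f \<longlongrightarrow> 0) at_bot"
    by (rule tendsto_eventually) (auto simp: eqs(1) eventually_at_bot_linorder intro!: exI[of _ "-1"])
  have x01: "x \<in> {0..1}" using maximizersD max by blast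
  have f: "responds f g 0 x (\<lambda>t. 0 \<le> t)" if "0 < x"
    using responds_cutI[OF eqs(1) um(2) lim(2)] xy(1) that by simp
  have g: "responds g f y 1 (\<lambda>_. True)" if "0 < x"
  proof -
    have "T x < T 0" using that x01 by (intro T_less) auto
    then show ?thesis using responds_fullI[OF eqs(2) um(1) bot lim(1)] xy(2) T_0 by simp
  qed
  have c: "responds c c u v (\<lambda>_. True)" if "u < v"
    using responds_fullI[OF eqs(3) um(3) lim(3,4)] that unfolding xy(3,4)[symmetric] by blast
  have "card maximizers \<noteq> 0" using assms(1) maximizers_nonempty by simp
  then consider "card maximizers = 1" | "card maximizers = 2" using assms(2) by linarith
  then show ?thesis
  proof cases
    case 1
    then obtain \<gamma> where m: "maximizers = {\<gamma>}" by (auto simp: card_1_singleton_iff)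
    have xg: "x = \<gamma>" "y = \<gamma>" "0 < \<gamma>" using max(1) m maximizers_single[OF m] xy(2) by auto
    have "solution False 1 (\<lambda>j. if j = 0 then f else g) (\<lambda>j. if j = 0 then 0 else if j = 1 then \<gamma> else 1)"
      using f g xg by (auto simp: solution_def le_Suc_eq)
    then show ?thesis by (rule that)
  next
    case 2
    obtain \<gamma>1 \<gamma>2 where m: "maximizers = {\<gamma>1, \<gamma>2}" "\<gamma>1 < \<gamma>2"
      by (rule card_2_less_cases[OF 2])
    note sw = maximizers_two[OF m]
    \<comment> \<open>\<open>x \<le> T x\<close> selects the smaller maximiser, since \<open>T\<close> exchanges the two\<close>
    have x: "x = \<gamma>1" "y = \<gamma>2" using max(1) m(1) sw(1,2) m(2) xy(2,5) by auto
    have u: "u = \<gamma>1" "v = \<gamma>2" using max(2) m(1) sw(1,2) m(2) xy(4,6) by auto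
    show ?thesis
    proof (cases "0 < \<gamma>1")
      case True
      have "solution False 2 (\<lambda>j. if j = 0 then f else if j = 1 then c else g)
        (\<lambda>j. if j = 0 then 0 else if j = 1 then \<gamma>1 else if j = 2 then \<gamma>2 else 1)"
        using f g c x u m(2) True by (auto simp: solution_def le_Suc_eq numeral_2_eq_2)
      then show ?thesis by (rule that)
    next
      case False
      then have "\<gamma>1 = 0" "\<gamma>2 = 1" using sw(3) by auto
      then have "solution True 0 (\<lambda>_. c) (\<lambda>j. if j = 0 then 0 else 1)"
        using c u by (auto simp: solution_def)
      then show ?thesis by (rule that)
    qed
  qed
qed

end

context supported_system
begin

lemma solution_unique:
  assumes fin: "finite maximizers" "card maximizers \<le> 2"
    and s: "solution B k h lv" and s': "solution B' k' h' lv'"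
  shows "k' = k \<and> (\<forall>j\<le>k. h' j = h j)"
proof -
  have "card maximizers \<noteq> 0" using fin(1) maximizers_nonempty by simp
  then consider "card maximizers = 1" | "card maximizers = 2" using fin(2) by linarith
  then show ?thesis
  proof cases
    case 1
    then obtain \<gamma> where m: "maximizers = {\<gamma>}" by (auto simp: card_1_singleton_iff)
    have k: "\<not> B" "k = 1" "lv 1 = \<gamma>" "\<not> B'" "k' = 1" "lv' 1 = \<gamma>"
      using solution_structure_single[OF s m] solution_structure_single[OF s' m] by auto
    have "responds (h 0) (h 1) 0 \<gamma> (\<lambda>t. 0 \<le> t)" "responds (h 1) (h 0) \<gamma> 1 (\<lambda>_. True)"
      "responds (h' 0) (h' 1) 0 \<gamma> (\<lambda>t. 0 \<le> t)" "responds (h' 1) (h' 0) \<gamma> 1 (\<lambda>_. True)"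
      using solution_responds[OF s, of 0] solution_responds[OF s, of 1] solution_responds[OF s', of 0]
        solution_responds[OF s', of 1] k s s' by (auto simp: solution_def numeral_2_eq_2)
    from cut_solution_unique[OF this] show ?thesis using k by (auto simp: le_Suc_eq fun_eq_iff)
  next
    case 2
    obtain \<gamma>1 \<gamma>2 where m: "maximizers = {\<gamma>1, \<gamma>2}" "\<gamma>1 < \<gamma>2"
      by (rule card_2_less_cases[OF 2])
    show ?thesis
    proof (cases "0 < \<gamma>1")
      case True
      have k: "\<not> B" "k = 2" "lv 1 = \<gamma>1" "lv 2 = \<gamma>2" "\<not> B'" "k' = 2" "lv' 1 = \<gamma>1" "lv' 2 = \<gamma>2"
        using solution_structure_two[OF s m True] solution_structure_two[OF s' m True] by auto
      have e: "lv 0 = 0" "lv 3 = 1" "lv' 0 = 0" "lv' 3 = 1"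
        using s s' k by (auto simp: solution_def numeral_3_eq_3 numeral_2_eq_2)
      have S: "Suc 0 = 1" "Suc 1 = 2" "Suc 2 = 3" by auto
      have "responds (h 0) (h 2) 0 \<gamma>1 (\<lambda>t. 0 \<le> t)" "responds (h 2) (h 0) \<gamma>2 1 (\<lambda>_. True)"
        "responds (h' 0) (h' 2) 0 \<gamma>1 (\<lambda>t. 0 \<le> t)" "responds (h' 2) (h' 0) \<gamma>2 1 (\<lambda>_. True)"
        using solution_responds[OF s, of 0, unfolded S] solution_responds[OF s, of 2, unfolded S]
          solution_responds[OF s', of 0, unfolded S] solution_responds[OF s', of 2, unfolded S] k e by auto
      note ends = cut_solution_unique[OF this]
      have "responds (h 1) (h 1) \<gamma>1 \<gamma>2 (\<lambda>_. True)" "responds (h' 1) (h' 1) \<gamma>1 \<gamma>2 (\<lambda>_. True)"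
        using solution_responds[OF s, of 1, unfolded S] solution_responds[OF s', of 1, unfolded S] k by auto
      note mid = self_solution_unique[OF this]
      have "h' j = h j" if "j \<le> 2" for j
      proof -
        have "j = 0 \<or> j = 1 \<or> j = 2" using that by auto
        then show ?thesis using ends mid by auto
      qed
      then show ?thesis using k by simp
    next
      case False
      then have "maximizers = {0, 1}" using maximizers_two(3)[OF m] m(1) by auto
      then have k: "B" "k = 0" "B'" "k' = 0"
        using solution_structure_extreme[OF s] solution_structure_extreme[OF s'] by auto
      have "responds (h 0) (h 0) 0 1 (\<lambda>_. True)" "responds (h' 0) (h' 0) 0 1 (\<lambda>_. True)"
        using solution_responds[OF s, of 0] solution_responds[OF s', of 0] k s s' by (auto simp: solution_def)
      from self_solution_unique[OF this] show ?thesis using k by (auto simp: fun_eq_iff)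
    qed
  qed
qed

end

theorem theorem5p1:
  fixes \<pi> :: "nat pmf" and \<omega> :: "real measure"
  assumes "integrable (measure_pmf \<pi>) real"
    and "0 < gen_fun_deriv \<pi> 1"
    and "real_distribution \<omega>"
    and "integrable \<omega> (\<lambda>w. w)"
    and "atomless \<omega>"
    and "positive_density_on_some_interval \<omega>"
    and "finite {t \<in> {0..1}. phi_hat \<pi> (1 - phi_hat \<pi> (1 - t)) = t}"
    and "finite (argmax_F \<pi>)" and "card (argmax_F \<pi>) \<le> 2"
  shows
    "(\<forall>\<gamma>. argmax_F \<pi> = {\<gamma>} \<longrightarrow>
        (\<forall>k h. is_solution \<pi> \<omega> k h \<longrightarrow>
           k = 1 \<and>
           index_law k h =
             point_measure UNIV (\<lambda>j. ennreal \<gamma> * indicator {0} j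
                                   + ennreal (1 - \<gamma>) * indicator {1} j))) \<and>
     (\<forall>\<gamma>1 \<gamma>2. 0 < \<gamma>1 \<and> \<gamma>1 < \<gamma>2 \<and> \<gamma>2 < 1 \<and> argmax_F \<pi> = {\<gamma>1, \<gamma>2} \<longrightarrow>
        (\<forall>k h. is_solution \<pi> \<omega> k h \<longrightarrow>
           k = 2 \<and>
           index_law k h =
             point_measure UNIV (\<lambda>j. ennreal \<gamma>1 * indicator {0} j
                                   + ennreal (\<gamma>2 - \<gamma>1) * indicator {1} j
                                   + ennreal (1 - \<gamma>2) * indicator {2} j))) \<and>
     ((\<nexists>\<gamma>. argmax_F \<pi> = {\<gamma>}) \<and>
      (\<nexists>\<gamma>1 \<gamma>2. 0 < \<gamma>1 \<and> \<gamma>1 < \<gamma>2 \<and> \<gamma>2 < 1 \<and> argmax_F \<pi> = {\<gamma>1, \<gamma>2}) \<longrightarrow>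
        argmax_F \<pi> = {0, 1} \<and>
        (\<forall>k h. is_solution \<pi> \<omega> k h \<longrightarrow>
           k = 0 \<and> (AE z in assoc_law k h. fst z = 0))) \<and>
     (\<forall>b. b = Sup (ereal ` msupport \<omega>) \<and> (\<exists>a<b. einterval a b \<subseteq> msupport \<omega>) \<longrightarrow>
        (\<exists>!\<zeta>. \<exists>k h. is_solution \<pi> \<omega> k h \<and> \<zeta> = assoc_law k h))"
proof -
  define T where "T = (\<lambda>x. phi_hat \<pi> (1 - x))"
  define \<Phi> where "\<Phi> = (\<lambda>x. gen_fun \<pi> (1 - x) / gen_fun_deriv \<pi> 1)"
  note r = response_of_gen_fun[OF assms(1,2,8), folded T_def \<Phi>_def]
  interpret response T \<Phi> by (rule r(1))
  interpret real_distribution \<omega> by (rule assms(3))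
  interpret matching_system T \<Phi> \<omega>
    by unfold_locales (use assms(5) in \<open>simp add: atomless_def\<close>)
  note argmax = r(2)
  note fin = assms(8,9)[unfolded argmax]
  have T_app: "phi_hat \<pi> (1 - x) = T x" for x by (simp add: T_def)
  have sol_iff: "is_solution \<pi> \<omega> k h \<longleftrightarrow> (\<exists>B lv. solution B k h lv)" for k h
  proof -
    have "type_A \<pi> \<omega> k h \<longleftrightarrow> (\<exists>lv. solution False k h lv)"
      unfolding typeA_equations_iff type_A_def K_def T_app by simp
    moreover have "type_B \<pi> \<omega> k h \<longleftrightarrow> (\<exists>lv. solution True k h lv)"
      unfolding typeB_equations_iff type_B_def K_def T_app by simp
    ultimately show ?thesis unfolding is_solution_def by (metis (full_types))
  qed
  have one: "k = 1 \<and> index_law k h = point_measure UNIV (\<lambda>j. ennreal \<gamma> * indicator {0} j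
      + ennreal (1 - \<gamma>) * indicator {1} j)"
    if m: "maximizers = {\<gamma>}" and s: "solution B k h lv" for \<gamma> B k h lv
  proof -
    have k: "k = 1" "lv 1 = \<gamma>" "lv 0 = 0" "lv 2 = 1"
      using solution_structure_single[OF s m] s by (auto simp: solution_def numeral_2_eq_2)
    have "emeasure (index_law k h) {j} = ennreal \<gamma> * indicator {0} j + ennreal (1 - \<gamma>) * indicator {1} j" for j
      unfolding solution_index_law[OF s] using k by (auto simp: indicator_def le_Suc_eq numeral_2_eq_2)
    from index_law_eqI[OF this] show ?thesis using k(1) by blast
  qed
  have two: "k = 2 \<and> index_law k h = point_measure UNIV (\<lambda>j. ennreal \<gamma>1 * indicator {0} j
      + ennreal (\<gamma>2 - \<gamma>1) * indicator {1} j + ennreal (1 - \<gamma>2) * indicator {2} j)"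
    if m: "0 < \<gamma>1" "\<gamma>1 < \<gamma>2" "maximizers = {\<gamma>1, \<gamma>2}" and s: "solution B k h lv" for \<gamma>1 \<gamma>2 B k h lv
  proof -
    have k: "k = 2" "lv 1 = \<gamma>1" "lv 2 = \<gamma>2" "lv 0 = 0" "lv 3 = 1"
      using solution_structure_two[OF s m(3,2,1)] s by (auto simp: solution_def numeral_2_eq_2 numeral_3_eq_3)
    have "emeasure (index_law k h) {j} = ennreal \<gamma>1 * indicator {0} j
      + ennreal (\<gamma>2 - \<gamma>1) * indicator {1} j + ennreal (1 - \<gamma>2) * indicator {2} j" for j
      unfolding solution_index_law[OF s] using k
      by (auto simp: indicator_def le_Suc_eq numeral_2_eq_2 numeral_3_eq_3)
    from index_law_eqI[OF this] show ?thesis using k(1) by blast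
  qed
  have extreme: "maximizers = {0, 1}"
    if no: "\<nexists>\<gamma>. maximizers = {\<gamma>}"
      "\<nexists>\<gamma>1 \<gamma>2. 0 < \<gamma>1 \<and> \<gamma>1 < \<gamma>2 \<and> \<gamma>2 < 1 \<and> maximizers = {\<gamma>1, \<gamma>2}"
  proof -
    have "card maximizers \<noteq> 0" "card maximizers \<noteq> 1"
      using fin(1) maximizers_nonempty no(1) by (auto simp: card_1_singleton_iff)
    then have 2: "card maximizers = 2" using fin(2) by linarith
    obtain \<gamma>1 \<gamma>2 where m: "maximizers = {\<gamma>1, \<gamma>2}" "\<gamma>1 < \<gamma>2"
      by (rule card_2_less_cases[OF 2])
    then show ?thesis using maximizers_two(3)[OF m] no(2) by auto
  qed
  have ae: "k = 0 \<and> (AE z in assoc_law k h. fst z = 0)"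
    if m: "maximizers = {0, 1}" and s: "solution B k h lv" for B k h lv
  proof -
    have k: "k = 0" using solution_structure_extreme[OF s m] by simp
    have "has_partial_cdfs k h (assoc_law k h)"
      using assoc_law_has_partial_cdfs[of k h lv, OF solution_profile[OF s]] s by (simp add: solution_def)
    then have "sets (assoc_law k h) = sets (count_space {..k} \<Otimes>\<^sub>M borel)"
      by (simp add: has_partial_cdfs_def)
    from sets_eq_imp_space_eq[OF this] have sp: "space (assoc_law k h) = {..0} \<times> UNIV"
      using k by (simp add: space_pair_measure)
    have "AE z in assoc_law k h. fst z = 0"
      by (rule AE_I2) (simp only: sp mem_Times_iff atMost_iff le_zero_eq)
    with k show ?thesis by blast
  qed
  have uniq: "\<exists>!\<zeta>. \<exists>k h. is_solution \<pi> \<omega> k h \<and> \<zeta> = assoc_law k h"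
    if b: "b = Sup (ereal ` msupport \<omega>)" "a < b" "einterval a b \<subseteq> msupport \<omega>" for a b
  proof -
    interpret supported_system T \<Phi> \<omega> a b by unfold_locales (use b in auto)
    obtain B k h lv where s: "solution B k h lv" by (rule exists_solution[OF fin])
    show ?thesis
    proof (rule ex1I[of _ "assoc_law k h"])
      show "\<exists>k' h'. is_solution \<pi> \<omega> k' h' \<and> assoc_law k h = assoc_law k' h'"
        using s sol_iff by blast
      fix \<zeta> assume "\<exists>k' h'. is_solution \<pi> \<omega> k' h' \<and> \<zeta> = assoc_law k' h'"
      then obtain k' h' B' lv' where s': "solution B' k' h' lv'" "\<zeta> = assoc_law k' h'"
        using sol_iff by blast
      then show "\<zeta> = assoc_law k h"
        using solution_unique[OF fin s s'(1)] assoc_law_cong[of k h' h] by simp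
    qed
  qed
  show ?thesis
    unfolding sol_iff argmax
    apply (intro conjI)
       apply (intro allI impI, elim exE, rule one; assumption)
      apply (intro allI impI, elim conjE exE, rule two; assumption)
     apply (intro impI conjI allI; elim conjE exE)
       apply (rule extreme; assumption)
      apply (rule conjunct1[OF ae[OF extreme]]; assumption)
     apply (rule conjunct2[OF ae[OF extreme]]; assumption)
    apply (intro allI impI, elim conjE exE, rule uniq[unfolded sol_iff]; assumption)
    done
qed

end
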